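(* Let $0<q<1$, and let $(s_0,s_1,s_2,s_3)$ be an admissible quadruple, with $s_2=-\zeta q^R$ and $s_3=\zeta^{-1}q^{-L}$ for some $\zeta>0$ and integers $L\ge R$. Let $\Omega^{qR}$ be the space of all point configurations (subsets) on the grid $$\Delta_{L,R}=\{-\zeta^{-1}q^{-L},-\zeta^{-1}q^{1-L},-\zeta^{-1}q^{2-L},\dots\}\sqcup\{\dots,\zeta q^{R+2},\zeta q^{R+1},\zeta q^R\}.$$ Then there exists a unique probability measure $M^{qR}_{q,\zeta,s_0,s_1,s_2,s_3}$ on $\Omega^{qR}$ such that $$\int_{\Omega^{qR}}\Phi^{qR}_\lambda(X;q;s_0,s_1,s_2,s_3)\,M^{qR}_{q,\zeta,s_0,s_1,s_2,s_3}(dX)=\delta_{\lambda,\emptyset}\qquad\text{for all partitions }\lambda,$$ where $\Phi^{qR}_\lambda$ are the $q$-Racah symmetric functions.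
   Context: Admissible quadruple: $s_2=-\zeta q^R$, $s_3=\zeta^{-1}q^{-L}$ with $\zeta>0$ and integers $L\ge R$, and $(s_0,s_1)$ satisfies one of: (a) $s_0=\overline{s_1}\in\mathbb C\setminus\mathbb R$; (b) $\zeta^{-1}q^{m+1}<s_0,s_1<\zeta^{-1}q^m$ for some $m\in\mathbb Z$; (c) $-\zeta q^m<s_0,s_1<-\zeta q^{m+1}$ for some $m\in\mathbb Z$. $\Omega^{qR}$ carries the compact metrizable topology of $\{0,1\}^{\Delta_{L,R}}$; measures are Borel. A symmetric function is evaluated at $X\in\Omega^{qR}$ through the power sums $p_k(X)=\sum_{x\in X}x^k$, $k\ge1$ (the sums converge); this gives continuous functions on $\Omega^{qR}$. Notation: $(x;q)_n=\prod_{k=0}^{n-1}(1-xq^k)$ for $n\ge0$, $(x_1,\dots,x_m;q)_n=\prod_j(x_j;q)_n$. $\ell(\lambda)$ is the number of nonzero parts, $|\lambda|=\sum\lambda_i$, $\mathbb Y(N)$ is the set of partitions with at most $N$ nonzero parts. $\mathrm{Sym}$ is the algebra of symmetric functions over $\mathbb C$, $\mathrm{Sym}(N)$ the symmetric polynomials in $N$ variables, the subscript $\le d$ means degree at most $d$. $V(x_1,\dots,x_N)=\prod_{i<j}(x_i-x_j)$. Convergence: $F_N\in\mathrm{Sym}(N)$ converges to $F\in\mathrm{Sym}$ if $\sup_N\deg F_N<\infty$ and, for every sufficiently large $d$, $\iota_{d,N}(F_N)\to F$ in the finite-dimensional space $\mathrm{Sym}_{\le d}$, where for $N\ge d$, $\iota_{d,N}:\mathrm{Sym}_{\le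 d}(N)\to\mathrm{Sym}_{\le d}$ is the inverse of the isomorphism $F\mapsto F(x_1,\dots,x_N,0,0,\dots)$. Interpolation functions: $(x\mid c_0,c_1,\dots)^m=\prod_{i=0}^{m-1}(x-c_i)$; for $\mu\in\mathbb Y(N)$, $s_{\mu|N}(x_1,\dots,x_N\mid c_0,c_1,\dots)=\det[(x_j\mid c_0,c_1,\dots)^{\mu_i+N-i}]_{i,j=1}^N/V(x_1,\dots,x_N)$. For $s\ne0$, $I^{BC}_\mu(\cdot;q;s)\in\mathrm{Sym}$ is the limit as $N\to\infty$ (which exists) of $s_{\mu|N}(\cdot\mid c^{(N)}_0,c^{(N)}_1,\dots)$ with $c_i^{(N)}=sq^i+s^{-1}q^{N-i-1}$. $q$-Racah symmetric functions: $\Phi^{qR}_\lambda(\cdot;q;s_0,s_1,s_2,s_3)=\sum_{\mu\subseteq\lambda}\sigma^{qR}(\lambda,\mu;q;s_0,s_1,s_2,s_3)\,I^{BC}_\mu(\cdot;q;s_0)$, where $$\sigma^{qR}(\lambda,\mu;q;s_0,s_1,s_2,s_3)=s_0^{|\mu|-|\lambda|}\det\left[\frac{(-s_0s_1q^{\mu_k+1-k},-s_0s_2q^{\mu_k+1-k},-s_0s_3q^{\mu_k+1-k};q)_{\lambda_j-j-\mu_k+k}}{q^{(\mu_k+1-k)(\lambda_j-j-\mu_k+k)}\,(q,\,s_0s_1s_2s_3q^{\lambda_j+\mu_k+1-j-k};q)_{\lambda_j-j-\mu_k+k}}\right]_{j,k=1}^{\ell(\lambda)};$$ an entry with $\lambda_j-j-\mu_k+k<0$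 is $0$, and $\sigma^{qR}(\emptyset,\emptyset)=1$.
   Formalization: The nodes defining I^BC are taken as c_i^(N) = -s q^i + s^{-1} q^{N-i-1}, with a minus sign in place of the stated plus; with the plus sign the condition for λ=(1) would give the real function p_1 a nonreal mean when s_0 is the conjugate of s_1. *)

theory Defs
  imports
    "HOL-Probability.Probability_Measure"
    "HOL-Analysis.Infinite_Sum"
    "HOL-Analysis.Function_Topology"
    "HOL-Library.Poly_Mapping"
    "Jordan_Normal_Form.Determinant"
begin

section \<open>Polynomials and symmetric functions\<close>

text \<open>
  Variables are numbered from 0: \<open>x\<^sub>0, x\<^sub>1, \<dots>\<close>. A monomial is its finitely supported exponent
  function. Polynomials form the commutative ring below (convolution product); formal power series of possibly infinite support are just
  coefficient functions.
\<close>

type_synonym monomial = "nat \<Rightarrow>\<^sub>0 nat"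
type_synonym cpoly = "monomial \<Rightarrow>\<^sub>0 complex"
type_synonym cseries = "monomial \<Rightarrow> complex"

definition mdeg :: "monomial \<Rightarrow> nat" where
  "mdeg m = (\<Sum>i\<in>Poly_Mapping.keys m. Poly_Mapping.lookup m i)"

definition symmetric_in :: "nat set \<Rightarrow> cseries \<Rightarrow> bool" where
  "symmetric_in A F \<longleftrightarrow> (\<forall>\<pi>. \<pi> permutes A \<longrightarrow> (\<forall>m. F (Poly_Mapping.map_key \<pi> m) = F m))"

definition Sym_le :: "nat \<Rightarrow> cseries set" where
  "Sym_le d = {F. symmetric_in UNIV F \<and> (\<forall>m. F m \<noteq> 0 \<longrightarrow> mdeg m \<le> d)}"

definition Sym :: "cseries set" where
  "Sym = (\<Union>d. Sym_le d)"

definition Sym_poly_le :: "nat \<Rightarrow> nat \<Rightarrow> cpoly set" where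
  "Sym_poly_le d N = {f. symmetric_in {..<N} (Poly_Mapping.lookup f)
     \<and> (\<forall>m\<in>Poly_Mapping.keys f. Poly_Mapping.keys m \<subseteq> {..<N} \<and> mdeg m \<le> d)}"

text \<open>\<open>F(x\<^sub>0,\<dots>,x\<^bsub>N-1\<^esub>,0,0,\<dots>)\<close>; the support is finite whenever \<open>F\<close> has bounded degree.\<close>

definition restrict_vars :: "nat \<Rightarrow> cseries \<Rightarrow> cpoly" where
  "restrict_vars N F =
     Poly_Mapping.Abs_poly_mapping (\<lambda>m. if Poly_Mapping.keys m \<subseteq> {..<N} then F m else 0)"

definition iota :: "nat \<Rightarrow> nat \<Rightarrow> cpoly \<Rightarrow> cseries" where
  "iota d N = inv_into (Sym_le d) (restrict_vars N)"

text \<open>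
  \<open>F\<^sub>N\<close> need only be meaningful for large \<open>N\<close>, hence the eventual degree bound. The topology of
  the finite-dimensional space \<open>Sym_le d\<close> is that of convergence of every coefficient.
\<close>

definition Sym_tendsto :: "(nat \<Rightarrow> cpoly) \<Rightarrow> cseries \<Rightarrow> bool" where
  "Sym_tendsto f F \<longleftrightarrow> F \<in> Sym
     \<and> (\<exists>D. \<forall>\<^sub>F N in sequentially. f N \<in> Sym_poly_le D N)
     \<and> (\<forall>\<^sub>F d in sequentially. \<forall>m. (\<lambda>N. iota d N (f N) m) \<longlonglongrightarrow> F m)"

definition pvar :: "nat \<Rightarrow> cpoly" where
  "pvar j = Poly_Mapping.single (Poly_Mapping.single j 1) 1"

definition pconst :: "complex \<Rightarrow> cpoly" where
  "pconst c = Poly_Mapping.single 0 c"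

text \<open>
  Substitution of \<open>g k\<close> for the \<open>k\<close>-th variable; \<open>h\<close> embeds the scalars.
\<close>

definition poly_subst :: "(complex \<Rightarrow> 'b::comm_ring_1) \<Rightarrow> (nat \<Rightarrow> 'b) \<Rightarrow> cpoly \<Rightarrow> 'b" where
  "poly_subst h g P = (\<Sum>m\<in>Poly_Mapping.keys P.
     h (Poly_Mapping.lookup P m) * (\<Prod>k\<in>Poly_Mapping.keys m. g k ^ Poly_Mapping.lookup m k))"

text \<open>
  Evaluation of \<open>F \<in> Sym\<close> at a configuration through power sums: write
  \<open>F = P(p\<^sub>1, p\<^sub>2, \<dots>)\<close> with a polynomial \<open>P\<close>, whose variable number \<open>k\<close> stands for the power sum
  of exponent \<open>k + 1\<close>, and replace the power sums by their values at \<open>X\<close>.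
\<close>

definition power_sum_at :: "real set \<Rightarrow> nat \<Rightarrow> real" where
  "power_sum_at X k = (\<Sum>\<^sub>\<infinity>x\<in>X. x ^ k)"

definition power_sum_presentation :: "cpoly \<Rightarrow> cseries \<Rightarrow> bool" where
  "power_sum_presentation P F \<longleftrightarrow>
     (\<forall>N. restrict_vars N F = poly_subst pconst (\<lambda>k. \<Sum>j<N. pvar j ^ Suc k) P)"

definition Sym_eval :: "cseries \<Rightarrow> real set \<Rightarrow> complex" where
  "Sym_eval F X = (THE c. \<exists>P. power_sum_presentation P F
     \<and> c = poly_subst (\<lambda>a. a) (\<lambda>k. complex_of_real (power_sum_at X (Suc k))) P)"

section \<open>Partitions and interpolation functions\<close>

text \<open>The parts are numbered from 0: \<open>\<lambda>\<^sub>i\<close> in the usual numbering is \<open>lam (i - 1)\<close>.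
  Inclusion of diagrams is the pointwise order on functions.\<close>

definition is_partition :: "(nat \<Rightarrow> nat) \<Rightarrow> bool" where
  "is_partition lam \<longleftrightarrow> antimono lam \<and> finite {i. lam i \<noteq> 0}"

definition plen :: "(nat \<Rightarrow> nat) \<Rightarrow> nat" where
  "plen lam = card {i. lam i \<noteq> 0}"

definition psize :: "(nat \<Rightarrow> nat) \<Rightarrow> nat" where
  "psize lam = (\<Sum>i | lam i \<noteq> 0. lam i)"

definition empty_partition :: "nat \<Rightarrow> nat" where
  "empty_partition = (\<lambda>_. 0)"

definition vandermonde :: "nat \<Rightarrow> cpoly" where
  "vandermonde N = (\<Prod>j<N. \<Prod>i<j. pvar i - pvar j)"

definition gen_power :: "cpoly \<Rightarrow> (nat \<Rightarrow> complex) \<Rightarrow> nat \<Rightarrow> cpoly" where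
  "gen_power x c m = (\<Prod>i<m. x - pconst (c i))"

text \<open>The quotient of the determinant by the Vandermonde polynomial (for \<open>plen mu \<le> N\<close>).\<close>

definition schur_interp :: "(nat \<Rightarrow> nat) \<Rightarrow> nat \<Rightarrow> (nat \<Rightarrow> complex) \<Rightarrow> cpoly" where
  "schur_interp mu N c = (THE f. f * vandermonde N =
     Determinant.det (mat N N (\<lambda>(i, j). gen_power (pvar j) c (mu i + (N - 1 - i)))))"

text \<open>
  Pitfall: the nodes are \<open>- s q\<^sup>i + s\<^sup>-\<^sup>1 q\<^bsup>N-i-1\<^esup>\<close>, with a minus sign. This matches the pre-limit grid
  \<open>\<zeta> q\<^sup>n - \<zeta>\<^sup>-\<^sup>1 q\<^bsup>N-1-n\<^esup>\<close> and the minus signs in \<open>sigma_qR\<close>. With \<open>s q\<^sup>i + s\<^sup>-\<^sup>1 q\<^bsup>N-i-1\<^esup>\<close> instead,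
  vanishing of the integral for \<open>\<lambda> = (1)\<close> would give the real function \<open>p\<^sub>1\<close> a mean with
  imaginary part \<open>2 Im s\<^sub>0 / (1 - q)\<close> whenever \<open>s\<^sub>0 = cnj s\<^sub>1\<close>.
\<close>

definition I_BC :: "(nat \<Rightarrow> nat) \<Rightarrow> complex \<Rightarrow> complex \<Rightarrow> cseries" where
  "I_BC mu q s = (THE F. Sym_tendsto
     (\<lambda>N. schur_interp mu N (\<lambda>i. - s * q ^ i + inverse s * q powi (int N - int i - 1))) F)"

section \<open>The q-Racah symmetric functions\<close>

definition qpoch :: "complex \<Rightarrow> complex \<Rightarrow> nat \<Rightarrow> complex" where
  "qpoch x q n = (\<Prod>k<n. 1 - x * q ^ k)"

text \<open>
  Row \<open>j\<close> and column \<open>k\<close> below correspond to the usual indices \<open>j + 1\<close>, \<open>k + 1\<close>; thus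
  \<open>e = \<mu>\<^sub>k + 1 - k\<close> and \<open>\<lambda>\<^sub>j + \<mu>\<^sub>k + 1 - j - k\<close> become \<open>mu k - k\<close> and \<open>lam j + mu k - 1 - j - k\<close>.
\<close>

definition sigma_qR_entry ::
  "(nat \<Rightarrow> nat) \<Rightarrow> (nat \<Rightarrow> nat) \<Rightarrow> complex \<Rightarrow> complex \<Rightarrow> complex \<Rightarrow> complex \<Rightarrow> complex
     \<Rightarrow> nat \<Rightarrow> nat \<Rightarrow> complex" where
  "sigma_qR_entry lam mu q s0 s1 s2 s3 j k =
     (let d = int (lam j) - int j - int (mu k) + int k;
          e = int (mu k) - int k;
          n = nat d
      in if d < 0 then 0
         else (qpoch (- s0 * s1 * q powi e) q n * qpoch (- s0 * s2 * q powi e) q n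
                 * qpoch (- s0 * s3 * q powi e) q n)
              / (q powi (e * d) * (qpoch q q n
                 * qpoch (s0 * s1 * s2 * s3 *
                     q powi (int (lam j) + int (mu k) - 1 - int j - int k)) q n)))"

definition sigma_qR ::
  "(nat \<Rightarrow> nat) \<Rightarrow> (nat \<Rightarrow> nat) \<Rightarrow> complex \<Rightarrow> complex \<Rightarrow> complex \<Rightarrow> complex \<Rightarrow> complex
     \<Rightarrow> complex" where
  "sigma_qR lam mu q s0 s1 s2 s3 =
     s0 powi (int (psize mu) - int (psize lam)) *
     Determinant.det (mat (plen lam) (plen lam)
       (\<lambda>(j, k). sigma_qR_entry lam mu q s0 s1 s2 s3 j k))"

definition Phi_qR ::
  "(nat \<Rightarrow> nat) \<Rightarrow> complex \<Rightarrow> complex \<Rightarrow> complex \<Rightarrow> complex \<Rightarrow> complex \<Rightarrow> cseries" where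
  "Phi_qR lam q s0 s1 s2 s3 =
     (\<lambda>m. \<Sum>mu | is_partition mu \<and> mu \<le> lam. sigma_qR lam mu q s0 s1 s2 s3 * I_BC mu q s0 m)"

section \<open>Parameters and configurations\<close>

definition admissible ::
  "real \<Rightarrow> real \<Rightarrow> int \<Rightarrow> int \<Rightarrow> complex \<Rightarrow> complex \<Rightarrow> complex \<Rightarrow> complex \<Rightarrow> bool" where
  "admissible q \<zeta> L R s0 s1 s2 s3 \<longleftrightarrow>
     \<zeta> > 0 \<and> R \<le> L \<and>
     s2 = complex_of_real (- \<zeta> * q powi R) \<and> s3 = complex_of_real (inverse \<zeta> * q powi (- L)) \<and>
     ((s0 = cnj s1 \<and> s0 \<notin> \<real>)
      \<or> (\<exists>a b m. s0 = complex_of_real a \<and> s1 = complex_of_real b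
           \<and> a \<in> {inverse \<zeta> * q powi (m + 1) <..< inverse \<zeta> * q powi m}
           \<and> b \<in> {inverse \<zeta> * q powi (m + 1) <..< inverse \<zeta> * q powi m})
      \<or> (\<exists>a b m. s0 = complex_of_real a \<and> s1 = complex_of_real b
           \<and> a \<in> {- \<zeta> * q powi m <..< - \<zeta> * q powi (m + 1)}
           \<and> b \<in> {- \<zeta> * q powi m <..< - \<zeta> * q powi (m + 1)}))"

definition qgrid :: "real \<Rightarrow> real \<Rightarrow> int \<Rightarrow> int \<Rightarrow> real set" where
  "qgrid q \<zeta> L R = {- inverse \<zeta> * q powi n |n. - L \<le> n} \<union> {\<zeta> * q powi n |n. R \<le> n}"

text \<open>The subsets of \<open>D\<close> with the product topology of \<open>{0,1}\<^sup>D\<close>, via indicator functions.\<close>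

definition config_topology :: "real set \<Rightarrow> real set topology" where
  "config_topology D = pullback_topology (Pow D) (\<lambda>X. \<lambda>x\<in>D. x \<in> X)
     (product_topology (\<lambda>_. discrete_topology (UNIV :: bool set)) D)"

definition config_borel :: "real set \<Rightarrow> real set measure" where
  "config_borel D = sigma (Pow D) {U. openin (config_topology D) U}"

end

theory Submission
  imports Defs "HOL-Probability.Probability" "HOL-Computational_Algebra.Formal_Power_Series"
begin

text \<open>
  A determinant formula of Jacobi-Trudi type expresses an interpolation Schur polynomial in $N$
  variables through power sums of the variables minus power sums of the nodes, one set of nodes for
  each row. Its size does not depend on $N$, so that the limits $I^{BC}_\<mu>$ become explicit
  polynomials in the power sums. By Cauchy-Binet, $\Phi^{qR}_\<lambda>$ is the limit of $N$-variate
  polynomials: determinants of univariate $q$-Racah polynomials divided by the Vandermonde determinant.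

  For admissible parameters these univariate polynomials are orthogonal for a positive weight on the
  finitely many nodes $y_k - q^{N-1}/y_k$, where $y_k = \<zeta> q^{R+k}$. The associated orthogonal
  polynomial ensemble of $N$ points therefore annihilates all the $N$-variate polynomials with
  $\<lambda> \<noteq> \<emptyset>$. As $N$ grows, the nodes approach the points of the grid, and compactness of the
  configuration space, realised as a Cantor set in the real line, gives a limit measure.

  Conversely, the integrals determine the expectations of all $I^{BC}_\<mu>$. These span the algebra
  generated by the power sums, which separates configurations, so Stone-Weierstrass gives uniqueness.
\<close>

section \<open>Power sum presentations of symmetric series\<close>

text \<open>All finite objects come from the map y -> y - T/y with T = q^(N-1). The interpolation
  nodes of a parameter s are its values at y = -s q^i, and the ensemble lives on its values at y_k.
  The smaller of y_k and T/y_k is at most sqrt T, so each node is close either to the positive point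
  y_k or to the negative point -T/y_k. For orthogonality, a polynomial expanded in the node products
  of s0 is tested against the node products of s1. Multiplying the weight by such products merely
  replaces s0 by s0 q^m and s1 by s1 q^l in its ratio equation, so a single telescoping sum yields
  every mixed moment. Admissibility gives s0 s1 > 0 and s2 s3 < 0, which keeps the denominators away
  from 0. Two obstacles shape the passage to the limit and back. The finite determinants carry
  quotients of q-factorials, which tend to 1. The shifts of the power sums in the Jacobi-Trudi
  determinants depend on the row and on the partition, so the spanning argument can rely only on
  terms of highest degree.\<close>

definition monom_val :: "(nat \<Rightarrow> 'b::comm_ring_1) \<Rightarrow> monomial \<Rightarrow> 'b" where
  "monom_val g m = (\<Prod>k\<in>Poly_Mapping.keys m. g k ^ Poly_Mapping.lookup m k)"

lemma poly_subst_monom_val: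
  "poly_subst h g P = (\<Sum>m\<in>Poly_Mapping.keys P. h (Poly_Mapping.lookup P m) * monom_val g m)"
  by (simp add: poly_subst_def monom_val_def)

lemma monom_val_superset:
  assumes "finite A" "Poly_Mapping.keys m \<subseteq> A"
  shows "monom_val g m = (\<Prod>k\<in>A. g k ^ Poly_Mapping.lookup m k)"
  unfolding monom_val_def
  by (rule prod.mono_neutral_left) (use assms in \<open>auto simp: in_keys_iff\<close>)

lemma monom_val_add: "monom_val g (m + n) = monom_val g m * monom_val g n"
proof -
  let ?A = "Poly_Mapping.keys m \<union> Poly_Mapping.keys n"
  have "Poly_Mapping.keys (m + n) \<subseteq> ?A" by (rule Poly_Mapping.keys_add)
  then show ?thesis
    by (simp add: monom_val_superset[of ?A] lookup_add power_add prod.distrib)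
qed

lemma monom_val_0 [simp]: "monom_val g 0 = 1"
  by (simp add: monom_val_def)

lemma poly_mapping_eq_sum_single:
  fixes P :: "'a \<Rightarrow>\<^sub>0 'b::comm_monoid_add"
  shows "P = (\<Sum>m\<in>Poly_Mapping.keys P. Poly_Mapping.single m (Poly_Mapping.lookup P m))"
proof (rule poly_mapping_eqI)
  fix k
  have "(\<Sum>m\<in>Poly_Mapping.keys P. Poly_Mapping.lookup P m when m = k) = Poly_Mapping.lookup P k"
  proof (cases "k \<in> Poly_Mapping.keys P")
    case True
    then show ?thesis by (subst sum.remove[of _ k]) (auto intro!: sum.neutral)
  next
    case False
    then show ?thesis by (auto simp: in_keys_iff when_def intro!: sum.neutral)
  qed
  then show "Poly_Mapping.lookup P k = Poly_Mapping.lookup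
      (\<Sum>m\<in>Poly_Mapping.keys P. Poly_Mapping.single m (Poly_Mapping.lookup P m)) k"
    by (simp add: lookup_sum lookup_single)
qed

context
  fixes h :: "complex \<Rightarrow> 'b::comm_ring_1"
  assumes h: "comm_ring_hom h"
begin

interpretation h: comm_ring_hom h by (rule h)

lemma poly_subst_superset:
  assumes "finite A" "Poly_Mapping.keys P \<subseteq> A"
  shows "poly_subst h g P = (\<Sum>m\<in>A. h (Poly_Mapping.lookup P m) * monom_val g m)"
  unfolding poly_subst_monom_val
  by (rule sum.mono_neutral_left) (use assms in \<open>auto simp: in_keys_iff\<close>)

lemma poly_subst_single: "poly_subst h g (Poly_Mapping.single m a) = h a * monom_val g m"
  by (subst poly_subst_superset[of "{m}"]) auto

lemma poly_subst_add: "poly_subst h g (P + Q) = poly_subst h g P + poly_subst h g Q"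
proof -
  let ?A = "Poly_Mapping.keys P \<union> Poly_Mapping.keys Q"
  have "Poly_Mapping.keys (P + Q) \<subseteq> ?A" by (rule Poly_Mapping.keys_add)
  then show ?thesis
    by (simp add: poly_subst_superset[of ?A] lookup_add h.hom_add algebra_simps sum.distrib)
qed

lemma poly_subst_sum: "poly_subst h g (\<Sum>i\<in>I. F i) = (\<Sum>i\<in>I. poly_subst h g (F i))"
proof (induction I rule: infinite_finite_induct)
  case (insert x I)
  then show ?case by (simp add: poly_subst_add)
qed (simp_all add: poly_subst_monom_val)

lemma poly_subst_mult: "poly_subst h g (P * Q) = poly_subst h g P * poly_subst h g Q"
proof -
  let ?s = "\<lambda>P m. Poly_Mapping.single m (Poly_Mapping.lookup P m)"
  have "P * Q = (\<Sum>m\<in>Poly_Mapping.keys P. \<Sum>n\<in>Poly_Mapping.keys Q. ?s P m * ?s Q n)"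
    by (subst (1) poly_mapping_eq_sum_single[of P], subst (1) poly_mapping_eq_sum_single[of Q])
      (simp add: sum_product)
  then have "poly_subst h g (P * Q) = (\<Sum>m\<in>Poly_Mapping.keys P. \<Sum>n\<in>Poly_Mapping.keys Q.
      h (Poly_Mapping.lookup P m) * monom_val g m * (h (Poly_Mapping.lookup Q n) * monom_val g n))"
    by (simp add: poly_subst_sum mult_single poly_subst_single monom_val_add h.hom_mult algebra_simps)
  then show ?thesis
    by (simp add: poly_subst_monom_val sum_product)
qed

lemma poly_subst_hom: "comm_ring_hom (poly_subst h g)"
proof
  show "poly_subst h g 0 = 0" by (simp add: poly_subst_def)
  show "poly_subst h g 1 = 1"
    using poly_subst_single[of g 0 1] by simp
qed (simp_all add: poly_subst_add poly_subst_mult)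

lemma poly_subst_pconst: "poly_subst h g (pconst a) = h a"
  unfolding pconst_def by (simp add: poly_subst_single)

lemma poly_subst_pvar: "poly_subst h g (pvar j) = g j"
  unfolding pvar_def by (simp add: poly_subst_single monom_val_def)

end

lemma hom_poly_subst:
  assumes "comm_ring_hom \<phi>"
  shows "\<phi> (poly_subst h g P) = poly_subst (\<lambda>a. \<phi> (h a)) (\<lambda>k. \<phi> (g k)) P"
proof -
  interpret comm_ring_hom \<phi> by (rule assms)
  show ?thesis by (simp add: poly_subst_def hom_distribs)
qed

lemma pconst_hom: "comm_ring_hom pconst"
  by standard (simp_all add: pconst_def single_add mult_single)

lemma comm_ring_hom_ident: "comm_ring_hom (\<lambda>a. a)"
  by standard simp_all

lemma poly_subst_sum_monom_val:
  "P = (\<Sum>m\<in>Poly_Mapping.keys P. pconst (Poly_Mapping.lookup P m) * Poly_Mapping.single m 1)"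
  by (subst poly_mapping_eq_sum_single[of P]) (simp add: pconst_def mult_single)

lemma pvar_power: "pvar i ^ a = Poly_Mapping.single (Poly_Mapping.single i a) 1"
  by (induction a) (simp_all add: pvar_def mult_single flip: single_add)

lemma prod_single_one:
  "(\<Prod>k\<in>A. Poly_Mapping.single (e k :: monomial) (1::complex)) = Poly_Mapping.single (\<Sum>k\<in>A. e k) 1"
  by (induction A rule: infinite_finite_induct) (simp_all add: mult_single)

lemma monom_val_pvar: "monom_val pvar m = Poly_Mapping.single m 1"
  unfolding monom_val_def pvar_power prod_single_one
  by (subst (3) poly_mapping_eq_sum_single) simp

lemma poly_subst_ident: "poly_subst pconst pvar P = P"
  unfolding poly_subst_monom_val monom_val_pvar by (rule poly_subst_sum_monom_val[symmetric])

lemma map_key_sum: "inj f \<Longrightarrow> Poly_Mapping.map_key f (\<Sum>i\<in>I. F i) = (\<Sum>i\<in>I. Poly_Mapping.map_key f (F i))"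
  by (induction I rule: infinite_finite_induct) (simp_all add: map_key_plus)

lemma monom_val_rename:
  assumes "bij \<pi>"
  shows "monom_val (\<lambda>j. pvar (\<pi> j)) m = Poly_Mapping.single (Poly_Mapping.map_key (inv_into UNIV \<pi>) m) 1"
proof -
  have inj: "inj (inv_into UNIV \<pi>)" using assms by (simp add: bij_imp_bij_inv bij_is_inj)
  have "Poly_Mapping.map_key (inv_into UNIV \<pi>) (Poly_Mapping.single k v) = Poly_Mapping.single (\<pi> k) v"
    for k and v :: nat
    using map_key_single[OF inj, of "\<pi> k" v] assms by (simp add: bij_is_inj)
  then have "Poly_Mapping.map_key (inv_into UNIV \<pi>) m
      = (\<Sum>k\<in>Poly_Mapping.keys m. Poly_Mapping.single (\<pi> k) (Poly_Mapping.lookup m k))"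
    by (subst poly_mapping_eq_sum_single[of m]) (simp add: map_key_sum[OF inj])
  then show ?thesis
    by (simp add: monom_val_def pvar_power prod_single_one)
qed

lemma lookup_pconst_mult: "Poly_Mapping.lookup (pconst a * P) m = a * Poly_Mapping.lookup P m"
  unfolding pconst_def mult_map_scale_conv_mult[symmetric]
  by (simp add: Poly_Mapping.map.rep_eq when_def)

text \<open>Links the symmetry condition, phrased through \<open>map_key\<close> on exponents, with
  renaming of variables, which is a ring homomorphism and so passes through power sums.\<close>

lemma lookup_poly_subst_rename:
  assumes "bij \<pi>"
  shows "Poly_Mapping.lookup (poly_subst pconst (\<lambda>j. pvar (\<pi> j)) P) m
    = Poly_Mapping.lookup P (Poly_Mapping.map_key \<pi> m)"
proof -
  have inj: "inj (inv_into UNIV \<pi>)" "inj \<pi>" using assms by (simp_all add: bij_imp_bij_inv bij_is_inj)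
  have iff: "Poly_Mapping.map_key (inv_into UNIV \<pi>) n = m \<longleftrightarrow> n = Poly_Mapping.map_key \<pi> m" for n :: monomial
  proof -
    have "\<pi> \<circ> inv_into UNIV \<pi> = id" "inv_into UNIV \<pi> \<circ> \<pi> = id"
      using assms by (simp_all add: bij_is_surj inj(2) surj_iff[symmetric])
    then have "Poly_Mapping.map_key \<pi> (Poly_Mapping.map_key (inv_into UNIV \<pi>) n) = n"
      "Poly_Mapping.map_key (inv_into UNIV \<pi>) (Poly_Mapping.map_key \<pi> m) = m"
      by (simp_all add: map_key_compose inj map_key_id[unfolded id_def[symmetric]])
    then show ?thesis by metis
  qed
  have "Poly_Mapping.lookup (poly_subst pconst (\<lambda>j. pvar (\<pi> j)) P) m
      = (\<Sum>n\<in>Poly_Mapping.keys P. Poly_Mapping.lookup P n when n = Poly_Mapping.map_key \<pi> m)"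
    unfolding poly_subst_monom_val
    by (simp add: monom_val_rename[OF assms] lookup_sum lookup_pconst_mult lookup_single iff mult_when)
  also have "\<dots> = (\<Sum>n\<in>Poly_Mapping.keys P. if Poly_Mapping.map_key \<pi> m = n then Poly_Mapping.lookup P n else 0)"
    by (intro sum.cong) (auto simp: when_def)
  also have "\<dots> = Poly_Mapping.lookup P (Poly_Mapping.map_key \<pi> m)"
    by (simp add: in_keys_iff)
  finally show ?thesis .
qed

lemma lookup_poly_subst_truncate:
  "Poly_Mapping.lookup (poly_subst pconst (\<lambda>j. if j \<in> A then pvar j else 0) P) m
    = (if Poly_Mapping.keys m \<subseteq> A then Poly_Mapping.lookup P m else 0)"
proof -
  have mv: "monom_val (\<lambda>j. if j \<in> A then pvar j else 0) n
      = (if Poly_Mapping.keys n \<subseteq> A then Poly_Mapping.single n 1 else 0)" for n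
  proof (cases "Poly_Mapping.keys n \<subseteq> A")
    case True
    then have "monom_val (\<lambda>j. if j \<in> A then pvar j else 0) n = monom_val pvar n"
      unfolding monom_val_def by (intro prod.cong) auto
    with True show ?thesis by (simp add: monom_val_pvar)
  next
    case False
    then obtain k where "k \<in> Poly_Mapping.keys n" "k \<notin> A" by auto
    then have "monom_val (\<lambda>j. if j \<in> A then pvar j else 0) n = 0"
      unfolding monom_val_def by (intro prod_zero) (auto simp: in_keys_iff intro!: bexI[of _ k])
    with False show ?thesis by simp
  qed
  have "Poly_Mapping.lookup (poly_subst pconst (\<lambda>j. if j \<in> A then pvar j else 0) P) m
     = (\<Sum>n\<in>Poly_Mapping.keys P. if m = n then (if Poly_Mapping.keys n \<subseteq> A then Poly_Mapping.lookup P n else 0) else 0)"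
    unfolding poly_subst_monom_val lookup_sum
    by (intro sum.cong) (auto simp: mv lookup_pconst_mult lookup_single when_def)
  then show ?thesis by (auto simp: in_keys_iff)
qed

text \<open>An arbitrary set of variables, rather than an initial segment, is stable under
  permutations of all variables; for finite sets, truncation and symmetry are then both statements
  about changing \<open>A\<close>.\<close>

definition psub :: "nat set \<Rightarrow> cpoly \<Rightarrow> cpoly" where
  "psub A P = poly_subst pconst (\<lambda>k. \<Sum>j\<in>A. pvar j ^ Suc k) P"

lemma psub_hom: "comm_ring_hom (psub A)"
  unfolding psub_def by (rule poly_subst_hom[OF pconst_hom])

lemma psub_pconst [simp]: "psub A (pconst a) = pconst a"
  by (simp add: psub_def poly_subst_pconst[OF pconst_hom])

lemma psub_pvar [simp]: "psub A (pvar k) = (\<Sum>j\<in>A. pvar j ^ Suc k)"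
  by (simp only: psub_def poly_subst_pvar[OF pconst_hom])

text \<open>Power sums have exponent at least 1, so a variable set to 0 simply leaves every one of
  them.\<close>

lemma psub_truncate:
  assumes "A \<subseteq> B" "finite B"
  shows "poly_subst pconst (\<lambda>j. if j \<in> A then pvar j else 0) (psub B P) = psub A P"
proof -
  let ?\<tau> = "poly_subst pconst (\<lambda>j. if j \<in> A then pvar j else 0)"
  interpret \<tau>: comm_ring_hom ?\<tau> by (rule poly_subst_hom[OF pconst_hom])
  have "?\<tau> (\<Sum>j\<in>B. pvar j ^ Suc k) = (\<Sum>j\<in>A. pvar j ^ Suc k)" for k
  proof -
    have "?\<tau> (\<Sum>j\<in>B. pvar j ^ Suc k) = (\<Sum>j\<in>B. (if j \<in> A then pvar j else 0) ^ Suc k)"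
      by (simp only: \<tau>.hom_sum \<tau>.hom_power poly_subst_pvar[OF pconst_hom])
    also have "\<dots> = (\<Sum>j\<in>A. pvar j ^ Suc k)"
      by (rule sum.mono_neutral_cong_right) (use assms in auto)
    finally show ?thesis .
  qed
  then show ?thesis
    unfolding psub_def hom_poly_subst[OF \<tau>.comm_ring_hom_axioms]
    by (simp add: poly_subst_pconst[OF pconst_hom])
qed

lemma lookup_psub_mono:
  assumes "A \<subseteq> B" "finite B" "Poly_Mapping.keys m \<subseteq> A"
  shows "Poly_Mapping.lookup (psub B P) m = Poly_Mapping.lookup (psub A P) m"
  using lookup_poly_subst_truncate[of A "psub B P" m] assms by (simp add: psub_truncate)

lemma lookup_psub_eq_0:
  assumes "finite A" "\<not> Poly_Mapping.keys m \<subseteq> A"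
  shows "Poly_Mapping.lookup (psub A P) m = 0"
  using lookup_poly_subst_truncate[of A "psub A P" m] assms by (simp add: psub_truncate)

lemma psub_rename:
  assumes "bij \<pi>"
  shows "Poly_Mapping.lookup (psub A P) (Poly_Mapping.map_key \<pi> m) = Poly_Mapping.lookup (psub (\<pi> ` A) P) m"
proof -
  let ?\<tau> = "poly_subst pconst (\<lambda>j. pvar (\<pi> j))"
  interpret \<tau>: comm_ring_hom ?\<tau> by (rule poly_subst_hom[OF pconst_hom])
  have "?\<tau> (\<Sum>j\<in>A. pvar j ^ Suc k) = (\<Sum>j\<in>\<pi> ` A. pvar j ^ Suc k)" for k
    by (simp only: \<tau>.hom_sum \<tau>.hom_power poly_subst_pvar[OF pconst_hom])
      (use assms in \<open>simp add: sum.reindex bij_is_inj inj_on_subset[of _ UNIV]\<close>)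
  then have "?\<tau> (psub A P) = psub (\<pi> ` A) P"
    unfolding psub_def hom_poly_subst[OF \<tau>.comm_ring_hom_axioms]
    by (simp add: poly_subst_pconst[OF pconst_hom])
  with lookup_poly_subst_rename[OF assms, of "psub A P" m] show ?thesis by simp
qed

text \<open>The symmetric series in infinitely many variables: the coefficient at \<open>m\<close>
  sees only the variables of \<open>m\<close>, and by \<open>lookup_psub_mono\<close> every larger
  finite set gives the same value.\<close>

definition ps_series :: "cpoly \<Rightarrow> cseries" where
  "ps_series P m = Poly_Mapping.lookup (psub (Poly_Mapping.keys m) P) m"

lemma ps_series_eq:
  assumes "finite A" "Poly_Mapping.keys m \<subseteq> A"
  shows "ps_series P m = Poly_Mapping.lookup (psub A P) m"
  unfolding ps_series_def by (rule lookup_psub_mono[symmetric]) (use assms in auto)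

lemma keys_map_key_bij:
  assumes "bij \<pi>"
  shows "\<pi> ` Poly_Mapping.keys (Poly_Mapping.map_key \<pi> m) = Poly_Mapping.keys m"
  using assms by (simp add: keys_map_key bij_is_inj bij_is_surj surj_image_vimage_eq)

lemma ps_series_symmetric: "symmetric_in UNIV (ps_series P)"
  unfolding symmetric_in_def
proof (intro allI impI)
  fix \<pi> :: "nat \<Rightarrow> nat" and m
  assume "\<pi> permutes UNIV"
  then have \<pi>: "bij \<pi>" by (simp add: permutes_bij)
  show "ps_series P (Poly_Mapping.map_key \<pi> m) = ps_series P m"
    unfolding ps_series_def psub_rename[OF \<pi>] keys_map_key_bij[OF \<pi>] ..
qed

lemma psub_symmetric: "symmetric_in A (Poly_Mapping.lookup (psub A P))"
  unfolding symmetric_in_def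
  by (auto simp: psub_rename permutes_bij permutes_image)

lemma restrict_vars_ps_series: "restrict_vars N (ps_series P) = psub {..<N} P"
proof -
  have "(\<lambda>m. if Poly_Mapping.keys m \<subseteq> {..<N} then ps_series P m else 0) = Poly_Mapping.lookup (psub {..<N} P)"
    by (auto simp: fun_eq_iff ps_series_eq[of "{..<N}"] lookup_psub_eq_0)
  then show ?thesis unfolding restrict_vars_def by (simp add: lookup_inverse)
qed

lemma ps_series_presentation: "power_sum_presentation P (ps_series P)"
  unfolding power_sum_presentation_def restrict_vars_ps_series by (simp add: psub_def)

section \<open>Degrees of monomials and polynomials\<close>

lemma mdeg_superset: "finite A \<Longrightarrow> Poly_Mapping.keys m \<subseteq> A \<Longrightarrow> mdeg m = (\<Sum>i\<in>A. Poly_Mapping.lookup m i)"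
  unfolding mdeg_def by (rule sum.mono_neutral_left) (auto simp: in_keys_iff)

lemma mdeg_add: "mdeg (m + n) = mdeg m + mdeg n"
proof -
  let ?A = "Poly_Mapping.keys m \<union> Poly_Mapping.keys n"
  have "Poly_Mapping.keys (m + n) \<subseteq> ?A" by (rule Poly_Mapping.keys_add)
  then show ?thesis by (simp add: mdeg_superset[of ?A] lookup_add sum.distrib)
qed

lemma lookup_le_mdeg: "Poly_Mapping.lookup m i \<le> mdeg m"
  by (cases "i \<in> Poly_Mapping.keys m") (auto simp: mdeg_def in_keys_iff intro: member_le_sum)

definition deg_le :: "nat \<Rightarrow> cpoly set" where
  "deg_le d = {f. \<forall>m\<in>Poly_Mapping.keys f. mdeg m \<le> d}"

lemma deg_le_mono: "f \<in> deg_le d \<Longrightarrow> d \<le> e \<Longrightarrow> f \<in> deg_le e"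
  by (auto simp: deg_le_def)

lemma deg_le_0 [simp]: "0 \<in> deg_le d" by (simp add: deg_le_def)

lemma deg_le_pconst [simp]: "pconst a \<in> deg_le d"
  by (auto simp: deg_le_def pconst_def mdeg_def split: if_splits)

lemma deg_le_1 [simp]: "1 \<in> deg_le d"
  by (auto simp: deg_le_def mdeg_def)

lemma deg_le_add: "f \<in> deg_le d \<Longrightarrow> g \<in> deg_le d \<Longrightarrow> f + g \<in> deg_le d"
  using Poly_Mapping.keys_add[of f g] by (auto simp: deg_le_def)

lemma deg_le_uminus: "f \<in> deg_le d \<Longrightarrow> - f \<in> deg_le d"
  by (auto simp: deg_le_def in_keys_iff)

lemma deg_le_diff: "f \<in> deg_le d \<Longrightarrow> g \<in> deg_le d \<Longrightarrow> f - g \<in> deg_le d"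
  using deg_le_add[of f d "- g"] deg_le_uminus[of g d] by simp

lemma deg_le_sum: "(\<And>i. i \<in> I \<Longrightarrow> F i \<in> deg_le d) \<Longrightarrow> (\<Sum>i\<in>I. F i) \<in> deg_le d"
  by (induction I rule: infinite_finite_induct) (auto intro: deg_le_add)

lemma deg_le_mult: "f \<in> deg_le d \<Longrightarrow> g \<in> deg_le e \<Longrightarrow> f * g \<in> deg_le (d + e)"
  using Poly_Mapping.keys_mult[of f g] by (fastforce simp: deg_le_def mdeg_add intro: add_mono)

lemma deg_le_prod: "finite I \<Longrightarrow> (\<And>i. i \<in> I \<Longrightarrow> F i \<in> deg_le (d i)) \<Longrightarrow> (\<Prod>i\<in>I. F i) \<in> deg_le (\<Sum>i\<in>I. d i)"
  by (induction I rule: finite_induct) (auto intro: deg_le_mult)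

lemma deg_le_pvar_power: "pvar j ^ k \<in> deg_le k"
  by (auto simp: pvar_power deg_le_def mdeg_def)

lemma ps_series_deg:
  assumes "\<And>A. finite A \<Longrightarrow> psub A P \<in> deg_le d"
  shows "ps_series P \<in> Sym_le d" and "psub {..<N} P \<in> Sym_poly_le d N"
proof -
  have "ps_series P m \<noteq> 0 \<Longrightarrow> mdeg m \<le> d" for m
    using assms[of "Poly_Mapping.keys m"] by (auto simp: ps_series_def deg_le_def in_keys_iff)
  then show "ps_series P \<in> Sym_le d" by (simp add: Sym_le_def ps_series_symmetric)
  show "psub {..<N} P \<in> Sym_poly_le d N"
    using assms[of "{..<N}"] lookup_psub_eq_0[of "{..<N}" _ P]
    by (auto simp: Sym_poly_le_def psub_symmetric deg_le_def in_keys_iff) 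
qed

lemma finite_monomials: "finite A \<Longrightarrow> finite {m :: monomial. Poly_Mapping.keys m \<subseteq> A \<and> (\<forall>i. Poly_Mapping.lookup m i \<le> d)}"
proof -
  assume A: "finite A"
  let ?M = "{m :: monomial. Poly_Mapping.keys m \<subseteq> A \<and> (\<forall>i. Poly_Mapping.lookup m i \<le> d)}"
  have "inj_on (\<lambda>m. restrict (Poly_Mapping.lookup m) A) ?M"
  proof (rule inj_onI)
    fix m n assume m: "m \<in> ?M" "n \<in> ?M"
      and eq: "restrict (Poly_Mapping.lookup m) A = restrict (Poly_Mapping.lookup n) A"
    show "m = n"
    proof (rule poly_mapping_eqI)
      fix k show "Poly_Mapping.lookup m k = Poly_Mapping.lookup n k"
      proof (cases "k \<in> A")
        case True
        with fun_cong[OF eq, of k] show ?thesis by simp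
      next
        case False
        with m have "k \<notin> Poly_Mapping.keys m" "k \<notin> Poly_Mapping.keys n" by auto
        then show ?thesis by (simp add: in_keys_iff)
      qed
    qed
  qed
  moreover have "(\<lambda>m. restrict (Poly_Mapping.lookup m) A) ` ?M \<subseteq> PiE A (\<lambda>_. {..d})" by auto
  ultimately show "finite ?M"
    using A by (meson finite_PiE finite_atMost inj_on_finite)
qed

lemma finite_monomial_splits: "finite {(a, b). a + b = (m :: monomial)}"
proof -
  let ?M = "{a :: monomial. Poly_Mapping.keys a \<subseteq> Poly_Mapping.keys m \<and> (\<forall>i. Poly_Mapping.lookup a i \<le> mdeg m)}"
  have *: "a \<in> ?M" if "a + b = m" for a b
  proof -
    have "Poly_Mapping.lookup a i \<le> Poly_Mapping.lookup m i" for i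
      using that by (auto simp: lookup_add)
    then have "Poly_Mapping.keys a \<subseteq> Poly_Mapping.keys m" "\<forall>i. Poly_Mapping.lookup a i \<le> mdeg m"
      using lookup_le_mdeg[of m] order_trans by (fastforce simp: in_keys_iff, blast)
    then show ?thesis by simp
  qed
  have "b \<in> ?M" if "a + b = m" for a b
    using *[of b a] that by (simp add: add.commute)
  with * have "{(a, b). a + b = m} \<subseteq> ?M \<times> ?M" by blast
  moreover have "finite ?M" by (rule finite_monomials) simp
  ultimately show ?thesis by (meson finite_SigmaI finite_subset)
qed

text \<open>The index set is finite and depends on \<open>m\<close> alone, not on the supports of
  the factors. Coefficientwise limits therefore pass to products even when the supports vary with
  N.\<close>

lemma lookup_mult_splits:
  "Poly_Mapping.lookup (f * g :: cpoly) m
    = (\<Sum>(a, b)\<in>{(a, b). a + b = m}. Poly_Mapping.lookup f a * Poly_Mapping.lookup g b)"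
proof -
  have "Poly_Mapping.lookup (f * g) m
      = (\<Sum>(a, b). Poly_Mapping.lookup f a * Poly_Mapping.lookup g b when m = a + b)"
    unfolding times_poly_mapping.rep_eq by (rule prod_fun_unfold_prod) simp_all
  also have "\<dots> = (\<Sum>x\<in>{(a, b). a + b = m}. case x of (a, b) \<Rightarrow>
      Poly_Mapping.lookup f a * Poly_Mapping.lookup g b when m = a + b)"
    by (rule Sum_any.expand_superset[OF finite_monomial_splits]) auto
  also have "\<dots> = (\<Sum>(a, b)\<in>{(a, b). a + b = m}. Poly_Mapping.lookup f a * Poly_Mapping.lookup g b)"
    by (intro sum.cong) auto
  finally show ?thesis .
qed

lemma permutes_lessThan_less: "p permutes {0..<n} \<Longrightarrow> i < n \<Longrightarrow> p i < (n::nat)"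
  using permutes_in_image[of p "{0..<n}" i] by simp

lemma det_mat_leibniz:
  "Determinant.det (mat n n (\<lambda>(i, j). G i j))
     = (\<Sum>p\<in>{p. p permutes {0..<n}}. signof p * (\<Prod>i = 0..<n. G i (p i)))"
  unfolding Determinant.det_def
  by (auto intro!: sum.cong prod.cong simp: permutes_lessThan_less)

section \<open>Coefficientwise limits of polynomials\<close>

definition coeff_tendsto :: "(nat \<Rightarrow> cpoly) \<Rightarrow> cpoly \<Rightarrow> bool" where
  "coeff_tendsto f F \<longleftrightarrow> (\<forall>m. (\<lambda>N. Poly_Mapping.lookup (f N) m) \<longlonglongrightarrow> Poly_Mapping.lookup F m)"

lemma coeff_tendsto_const: "coeff_tendsto (\<lambda>_. F) F"
  by (simp add: coeff_tendsto_def)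

lemma coeff_tendsto_pconst: "c \<longlonglongrightarrow> a \<Longrightarrow> coeff_tendsto (\<lambda>N. pconst (c N)) (pconst a)"
  by (auto simp: coeff_tendsto_def pconst_def lookup_single when_def)

lemma coeff_tendsto_add: "coeff_tendsto f F \<Longrightarrow> coeff_tendsto g G \<Longrightarrow> coeff_tendsto (\<lambda>N. f N + g N) (F + G)"
  by (auto simp: coeff_tendsto_def lookup_add intro: tendsto_add)

lemma coeff_tendsto_diff: "coeff_tendsto f F \<Longrightarrow> coeff_tendsto g G \<Longrightarrow> coeff_tendsto (\<lambda>N. f N - g N) (F - G)"
  by (auto simp: coeff_tendsto_def lookup_minus intro: tendsto_diff)

lemma coeff_tendsto_mult: "coeff_tendsto f F \<Longrightarrow> coeff_tendsto g G \<Longrightarrow> coeff_tendsto (\<lambda>N. f N * g N) (F * G)"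
  unfolding coeff_tendsto_def lookup_mult_splits
  by (auto intro!: tendsto_sum tendsto_mult split: prod.splits)

lemma coeff_tendsto_sum:
  "(\<And>i. i \<in> I \<Longrightarrow> coeff_tendsto (\<lambda>N. f N i) (F i)) \<Longrightarrow> coeff_tendsto (\<lambda>N. \<Sum>i\<in>I. f N i) (\<Sum>i\<in>I. F i)"
  by (induction I rule: infinite_finite_induct) (auto intro: coeff_tendsto_add coeff_tendsto_const)

lemma coeff_tendsto_prod:
  "(\<And>i. i \<in> I \<Longrightarrow> coeff_tendsto (\<lambda>N. f N i) (F i)) \<Longrightarrow> coeff_tendsto (\<lambda>N. \<Prod>i\<in>I. f N i) (\<Prod>i\<in>I. F i)"
  by (induction I rule: infinite_finite_induct) (auto intro: coeff_tendsto_mult coeff_tendsto_const)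

lemma coeff_tendsto_det:
  assumes "\<And>i j. i < n \<Longrightarrow> j < n \<Longrightarrow> coeff_tendsto (\<lambda>N. f N i j) (F i j)"
  shows "coeff_tendsto (\<lambda>N. Determinant.det (mat n n (\<lambda>(i, j). f N i j))) (Determinant.det (mat n n (\<lambda>(i, j). F i j)))"
proof -
  have "coeff_tendsto (\<lambda>N. \<Sum>p\<in>{p. p permutes {0..<n}}. signof p * (\<Prod>i = 0..<n. f N i (p i)))
     (\<Sum>p\<in>{p. p permutes {0..<n}}. signof p * (\<Prod>i = 0..<n. F i (p i)))"
    by (intro coeff_tendsto_sum coeff_tendsto_mult coeff_tendsto_prod coeff_tendsto_const assms)
      (auto dest: permutes_lessThan_less)
  then show ?thesis by (simp add: det_mat_leibniz)
qed

lemma deg_le_det: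
  assumes "\<And>i j. i < n \<Longrightarrow> j < n \<Longrightarrow> F i j \<in> deg_le (d i)"
  shows "Determinant.det (mat n n (\<lambda>(i, j). F i j)) \<in> deg_le (\<Sum>i<n. d i)"
proof -
  have "signof p * (\<Prod>i = 0..<n. F i (p i)) \<in> deg_le (0 + (\<Sum>i=0..<n. d i))" if "p permutes {0..<n}" for p
  proof (rule deg_le_mult)
    show "signof p \<in> deg_le 0" by (simp add: sign_def deg_le_uminus)
    show "(\<Prod>i = 0..<n. F i (p i)) \<in> deg_le (\<Sum>i=0..<n. d i)"
      by (rule deg_le_prod) (use that assms permutes_lessThan_less in auto)
  qed
  then show ?thesis unfolding det_mat_leibniz by (auto simp: atLeast0LessThan intro!: deg_le_sum)
qed

section \<open>Jacobi-Trudi determinants\<close>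

unbundle no vec_syntax
no_notation Matrix.vec_index (infixl "$" 100)
unbundle fps_syntax

text \<open>Newton's recursion: if \<open>p r\<close> is the power sum of degree \<open>r + 1\<close>, then \<open>hsym h p\<close> are the complete
  homogeneous functions. The map \<open>h\<close> embeds the rational scalars.\<close>

fun hsym :: "(complex \<Rightarrow> 'b::comm_ring_1) \<Rightarrow> (nat \<Rightarrow> 'b) \<Rightarrow> nat \<Rightarrow> 'b" where
  "hsym h p 0 = 1"
| "hsym h p (Suc r) = h (1 / of_nat (Suc r)) * (\<Sum>j\<le>r. p j * hsym h p (r - j))"

definition hsym_int :: "(complex \<Rightarrow> 'b::comm_ring_1) \<Rightarrow> (nat \<Rightarrow> 'b) \<Rightarrow> int \<Rightarrow> 'b" where
  "hsym_int h p z = (if z < 0 then 0 else hsym h p (nat z))"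

text \<open>Each row \<open>i\<close> has its own specialisation \<open>p i\<close> of the power sums.\<close>

definition jt :: "(complex \<Rightarrow> 'b::comm_ring_1) \<Rightarrow> nat \<Rightarrow> (nat \<Rightarrow> nat) \<Rightarrow> (nat \<Rightarrow> nat \<Rightarrow> 'b) \<Rightarrow> 'b" where
  "jt h n mu p = Determinant.det (mat n n (\<lambda>(i, k). hsym_int h (p i) (int (mu i) - int i + int k)))"

lemma hom_hsym:
  assumes "comm_ring_hom \<phi>"
  shows "\<phi> (hsym h p r) = hsym (\<lambda>a. \<phi> (h a)) (\<lambda>j. \<phi> (p j)) r"
proof -
  interpret comm_ring_hom \<phi> by (rule assms)
  show ?thesis
    by (induction r rule: less_induct, case_tac x) (simp_all add: hom_distribs)
qed

lemma hom_det_mat: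
  assumes "comm_ring_hom \<phi>"
  shows "\<phi> (Determinant.det (mat n n (\<lambda>(i, k). G i k))) = Determinant.det (mat n n (\<lambda>(i, k). \<phi> (G i k)))"
proof -
  interpret comm_ring_hom \<phi> by (rule assms)
  have "map_mat \<phi> (mat n n (\<lambda>(i, k). G i k)) = mat n n (\<lambda>(i, k). \<phi> (G i k))"
    by (rule eq_matI) auto
  then show ?thesis by (metis hom_det)
qed

lemma hom_jt:
  assumes "comm_ring_hom \<phi>"
  shows "\<phi> (jt h n mu p) = jt (\<lambda>a. \<phi> (h a)) n mu (\<lambda>i j. \<phi> (p i j))"
proof -
  interpret comm_ring_hom \<phi> by (rule assms)
  show ?thesis
    unfolding jt_def hsym_int_def hom_det_mat[OF assms]
    by (simp add: if_distrib[of \<phi>] hom_hsym[OF assms] hom_zero cong: if_cong)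
qed

text \<open>Newton's recursion is the coefficient form of the differential equation H' = H P, where
  P generates the power sums.\<close>

lemma fps_deriv_hsym:
  fixes h :: "complex \<Rightarrow> 'b::comm_ring_1"
  assumes h: "comm_ring_hom h"
  shows "fps_deriv (Abs_fps (hsym h p)) = Abs_fps (hsym h p) * Abs_fps p"
proof (rule fps_ext)
  fix n
  interpret h: comm_ring_hom h by (rule h)
  have "of_nat (Suc n) * h (1 / of_nat (Suc n)) = h (of_nat (Suc n) * (1 / of_nat (Suc n)))"
    by (simp only: h.hom_mult h.hom_of_nat)
  also have "of_nat (Suc n) * (1 / of_nat (Suc n)) = (1 :: complex)"
    by (simp del: of_nat_Suc)
  finally have 1: "of_nat (Suc n) * h (1 / of_nat (Suc n)) = 1" by simp
  have "fps_deriv (Abs_fps (hsym h p)) $ n = (of_nat (Suc n) * h (1 / of_nat (Suc n))) * (\<Sum>j\<le>n. p j * hsym h p (n - j))"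
    by (simp add: mult.assoc del: of_nat_Suc)
  also have "\<dots> = (Abs_fps p * Abs_fps (hsym h p)) $ n"
    by (simp only: 1) (simp add: fps_mult_nth atLeast0AtMost)
  finally show "fps_deriv (Abs_fps (hsym h p)) $ n = (Abs_fps (hsym h p) * Abs_fps p) $ n"
    by (simp add: mult.commute)
qed

text \<open>The coefficient equation reads (n+1) F_(n+1) = known terms, and n+1 is invertible in the
  target ring because \<open>h\<close> carries 1/(n+1) there.\<close>

lemma fps_ode_unique:
  fixes h :: "complex \<Rightarrow> 'b::comm_ring_1"
  assumes h: "comm_ring_hom h" and "F $ 0 = 1" "fps_deriv F = F * Abs_fps p"
  shows "F = Abs_fps (hsym h p)"
proof -
  interpret h: comm_ring_hom h by (rule h)
  have "F $ r = hsym h p r" for r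
  proof (induction r rule: less_induct)
    case (less r)
    show ?case
    proof (cases r)
      case 0 with assms show ?thesis by simp
    next
      case (Suc n)
      have "h (1 / of_nat (Suc n)) * of_nat (Suc n) = h (1 / of_nat (Suc n) * of_nat (Suc n))"
        by (simp only: h.hom_mult h.hom_of_nat)
      also have "1 / of_nat (Suc n) * of_nat (Suc n) = (1 :: complex)"
        by (simp del: of_nat_Suc)
      finally have 1: "h (1 / of_nat (Suc n)) * of_nat (Suc n) = 1" by simp
      have "F $ r = h (1 / of_nat (Suc n)) * of_nat (Suc n) * F $ (Suc n)" by (simp only: 1 Suc) simp
      also have "\<dots> = h (1 / of_nat (Suc n)) * fps_deriv F $ n" by (simp add: mult.assoc del: of_nat_Suc)
      also have "fps_deriv F $ n = (Abs_fps p * F) $ n" using assms(3) by (simp add: mult.commute)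
      also have "\<dots> = (\<Sum>j\<le>n. p j * hsym h p (n - j))"
        unfolding fps_mult_nth atLeast0AtMost using less Suc by (intro sum.cong) auto
      finally show ?thesis by (simp add: Suc del: of_nat_Suc)
    qed
  qed
  then show ?thesis by (intro fps_ext) simp
qed

text \<open>Formally the series is the exponential of the integral of P, so sums of power sums
  become products of series; the product solves the equation with right-hand side P + Q.\<close>

lemma hsym_add:
  fixes h :: "complex \<Rightarrow> 'b::comm_ring_1"
  assumes h: "comm_ring_hom h"
  shows "Abs_fps (hsym h p) * Abs_fps (hsym h q) = Abs_fps (hsym h (\<lambda>j. p j + q j))"
proof (rule fps_ode_unique[OF h])
  have "Abs_fps (\<lambda>j. p j + q j) = Abs_fps p + Abs_fps q" by (rule fps_ext) simp
  then show "fps_deriv (Abs_fps (hsym h p) * Abs_fps (hsym h q))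
      = Abs_fps (hsym h p) * Abs_fps (hsym h q) * Abs_fps (\<lambda>j. p j + q j)"
    by (simp add: fps_deriv_hsym[OF h] algebra_simps)
qed simp

text \<open>The generating function of the elementary symmetric functions; it solves the same linear ODE as that of
  \<open>hsym\<close>, with the sign of the power sums reversed.\<close>

definition efps :: "(nat \<Rightarrow> 'b::comm_ring_1) \<Rightarrow> nat set \<Rightarrow> 'b fps" where
  "efps x A = (\<Prod>j\<in>A. 1 - fps_const (x j) * fps_X)"

lemma fps_geometric_mult: "(1 - fps_const c * fps_X) * Abs_fps (\<lambda>r. c ^ r) = (1 :: 'b::comm_ring_1 fps)"
proof (rule fps_ext)
  fix n show "((1 - fps_const c * fps_X) * Abs_fps (\<lambda>r. c ^ r)) $ n = (1 :: 'b fps) $ n"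
    by (cases n) (simp_all add: algebra_simps)
qed

lemma fps_deriv_efps:
  assumes "finite A"
  shows "fps_deriv (efps x A) = - (efps x A * Abs_fps (\<lambda>r. \<Sum>j\<in>A. x j ^ Suc r))"
  using assms
proof (induction A rule: finite_induct)
  case empty
  have "Abs_fps (\<lambda>r. 0 :: 'a) = 0" by (rule fps_ext) simp
  then show ?case by (simp add: efps_def)
next
  case (insert a A)
  let ?l = "1 - fps_const (x a) * fps_X" and ?P = "Abs_fps (\<lambda>r. \<Sum>j\<in>A. x j ^ Suc r)"
    and ?G = "Abs_fps (\<lambda>r. x a ^ r)"
  have e: "efps x (insert a A) = ?l * efps x A" using insert by (simp add: efps_def)
  have P: "Abs_fps (\<lambda>r. \<Sum>j\<in>insert a A. x j ^ Suc r) = fps_const (x a) * ?G + ?P"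
    using insert by (intro fps_ext) simp
  have "efps x (insert a A) * Abs_fps (\<lambda>r. \<Sum>j\<in>insert a A. x j ^ Suc r)
     = (?l * ?G) * (fps_const (x a) * efps x A) + ?l * (efps x A * ?P)"
    unfolding e P by (simp only: algebra_simps)
  also have "\<dots> = - fps_deriv (efps x (insert a A))"
    unfolding e fps_geometric_mult using insert by (simp add: algebra_simps)
  finally show ?case by simp
qed

lemma efps_eq_hsym:
  fixes h :: "complex \<Rightarrow> 'b::comm_ring_1"
  assumes h: "comm_ring_hom h" and "finite A"
  shows "efps x A = Abs_fps (hsym h (\<lambda>r. - (\<Sum>j\<in>A. x j ^ Suc r)))"
proof (rule fps_ode_unique[OF h])
  show "efps x A $ 0 = 1" using \<open>finite A\<close> unfolding efps_def
    by (induction A rule: finite_induct) simp_all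
  have "Abs_fps (\<lambda>r. - (\<Sum>j\<in>A. x j ^ Suc r)) = - Abs_fps (\<lambda>r. \<Sum>j\<in>A. x j ^ Suc r)"
    by (rule fps_ext) simp
  then show "fps_deriv (efps x A) = efps x A * Abs_fps (\<lambda>r. - (\<Sum>j\<in>A. x j ^ Suc r))"
    by (simp only: fps_deriv_efps[OF \<open>finite A\<close>]) simp
qed

lemma efps_nth_eq_0: "finite A \<Longrightarrow> card A < n \<Longrightarrow> efps x A $ n = 0"
proof (induction A arbitrary: n rule: finite_induct)
  case empty then show ?case by (simp add: efps_def)
next
  case (insert a A)
  then have "efps x (insert a A) = efps x A - fps_const (x a) * (fps_X * efps x A)"
    by (simp add: efps_def algebra_simps)
  with insert show ?case by simp
qed

text \<open>The case \<open>r = m\<close> produces a generalised power of y as a coefficient of (1 -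
  c_0 t)...(1 - c_(m-1) t) / (1 - y t); larger \<open>r\<close> are carried along for the induction
  on \<open>m\<close>.\<close>

lemma efps_geometric_nth:
  "m \<le> r \<Longrightarrow> (efps c {..<m} * Abs_fps (\<lambda>r. y ^ r)) $ r = y ^ (r - m) * (\<Prod>l<m. y - c l)"
proof (induction m arbitrary: r)
  case 0 then show ?case by (simp add: efps_def)
next
  case (Suc m)
  then obtain r' where r: "r = Suc r'" "m \<le> r'" by (cases r) auto
  have "efps c {..<Suc m} * Abs_fps (\<lambda>r. y ^ r)
     = efps c {..<m} * Abs_fps (\<lambda>r. y ^ r) - fps_const (c m) * (fps_X * (efps c {..<m} * Abs_fps (\<lambda>r. y ^ r)))"
    by (simp add: efps_def algebra_simps)
  then have "(efps c {..<Suc m} * Abs_fps (\<lambda>r. y ^ r)) $ r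
     = y ^ (r - m) * (\<Prod>l<m. y - c l) - c m * (y ^ (r' - m) * (\<Prod>l<m. y - c l))"
    using Suc.IH[of r] Suc.IH[of r'] r by simp
  also have "\<dots> = y ^ (r - Suc m) * (\<Prod>l<Suc m. y - c l)"
    using r by (simp add: Suc_diff_le algebra_simps)
  finally show ?case .
qed

text \<open>Writing the node polynomial as H times the full product of the 1 - x_j t and cancelling
  one factor gives H E_j, where E_j omits x_j. Comparing coefficients of t^m separates the
  variables: the nodes and \<open>m\<close> enter only through H, the index j only through
  E_j.\<close>

lemma prod_diff_eq_sum_hsym_int:
  fixes h :: "complex \<Rightarrow> 'b::comm_ring_1"
  assumes h: "comm_ring_hom h" and j: "j < N"
  shows "(\<Prod>l<m. x j - c l) = (\<Sum>k<N. hsym_int h (\<lambda>r. (\<Sum>j<N. x j ^ Suc r) - (\<Sum>l<m. c l ^ Suc r)) (int m - int N + 1 + int k)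
            * efps x ({..<N} - {j}) $ (N - 1 - k))"
proof -
  let ?p = "\<lambda>r. (\<Sum>j<N. x j ^ Suc r) - (\<Sum>l<m. c l ^ Suc r)"
  let ?H = "Abs_fps (hsym h ?p)" and ?G = "Abs_fps (\<lambda>r. x j ^ r)" and ?E = "efps x ({..<N} - {j})"
  have "efps c {..<m} = ?H * efps x {..<N}"
    by (simp add: efps_eq_hsym[OF h] hsym_add[OF h])
  moreover have "efps x {..<N} * ?G = ?E"
  proof -
    have "efps x {..<N} = (1 - fps_const (x j) * fps_X) * ?E"
      unfolding efps_def using j by (subst prod.remove[of _ j]) auto
    then have "efps x {..<N} * ?G = ((1 - fps_const (x j) * fps_X) * ?G) * ?E" by (simp only: ac_simps)
    then show ?thesis by (simp add: fps_geometric_mult)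
  qed
  ultimately have "efps c {..<m} * ?G = ?E * ?H" by (simp add: mult.assoc)
  then have "(\<Prod>l<m. x j - c l) = (?E * ?H) $ m"
    using efps_geometric_nth[of m m c "x j"] by simp
  also have "\<dots> = (\<Sum>r=0..m. ?E $ r * hsym h ?p (m - r))" by (simp add: fps_mult_nth)
  \<comment> \<open>Indices from N on vanish because the second series has degree N - 1; indices
    above \<open>m\<close> vanish because \<open>hsym_int\<close> is 0 at negative
    arguments.\<close>
  also have "\<dots> = (\<Sum>r\<in>{..<N}. ?E $ r * hsym_int h ?p (int m - int r))"
  proof (rule sum.mono_neutral_cong)
    fix r assume "r \<in> {0..m} - {..<N}"
    moreover have "card ({..<N} - {j}) = N - 1" using j by simp
    ultimately have "card ({..<N} - {j}) < r" using j by auto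
    then show "?E $ r * hsym h ?p (m - r) = 0" by (simp only: efps_nth_eq_0 finite_Diff finite_lessThan mult_zero_left)
  qed (auto simp: hsym_int_def nat_diff_distrib)
  also have "\<dots> = (\<Sum>k<N. ?E $ (N - 1 - k) * hsym_int h ?p (int m - int (N - 1 - k)))"
    by (rule sum.reindex_bij_witness[of _ "\<lambda>k. N - 1 - k" "\<lambda>k. N - 1 - k"]) (use j in auto)
  also have "\<dots> = (\<Sum>k<N. hsym_int h ?p (int m - int N + 1 + int k) * ?E $ (N - 1 - k))"
    by (intro sum.cong) (auto simp: algebra_simps of_nat_diff)
  finally show ?thesis .
qed

text \<open>Block triangularity with a unit upper triangular lower block. This removes the
  dependence on N from all determinants whose rows beyond the length of a partition are
  trivial.\<close>

lemma det_unitriangular_tail: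
  fixes G :: "nat \<Rightarrow> nat \<Rightarrow> 'b::idom"
  assumes "n \<le> N" and "\<And>i k. n \<le> i \<Longrightarrow> i < N \<Longrightarrow> k < i \<Longrightarrow> G i k = 0" and "\<And>i. n \<le> i \<Longrightarrow> i < N \<Longrightarrow> G i i = 1"
  shows "Determinant.det (mat N N (\<lambda>(i, k). G i k)) = Determinant.det (mat n n (\<lambda>(i, k). G i k))"
proof -
  let ?A2 = "mat n (N - n) (\<lambda>(i, k). G i (n + k))" and ?A4 = "mat (N - n) (N - n) (\<lambda>(i, k). G (n + i) (n + k))"
  have "mat N N (\<lambda>(i, k). G i k) = four_block_mat (mat n n (\<lambda>(i, k). G i k)) ?A2 (0\<^sub>m (N - n) n) ?A4"
    by (rule eq_matI) (use assms in \<open>auto simp: four_block_mat_def Let_def\<close>)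
  then have "Determinant.det (mat N N (\<lambda>(i, k). G i k)) = Determinant.det (mat n n (\<lambda>(i, k). G i k)) * Determinant.det ?A4"
    by (simp add: det_four_block_mat_lower_left_zero[of _ n _ "N - n"])
  also have "Determinant.det ?A4 = prod_list (diag_mat ?A4)"
    by (rule det_upper_triangular[of _ "N - n"]) (use assms in \<open>auto simp: upper_triangular_def\<close>)
  also have "\<dots> = 1"
    using assms by (simp add: diag_mat_def prod.list_conv_set_nth)
  finally show ?thesis by simp
qed

lemma jt_stable:
  fixes h :: "complex \<Rightarrow> 'b::idom"
  assumes "n \<le> N" and "\<And>i. n \<le> i \<Longrightarrow> mu i = 0"
  shows "jt h N mu p = jt h n mu p"
  unfolding jt_def by (rule det_unitriangular_tail) (use assms in \<open>auto simp: hsym_int_def\<close>)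

text \<open>By \<open>prod_diff_eq_sum_hsym_int\<close> the matrix is a Jacobi-Trudi matrix times a
  matrix of elementary symmetric functions that depends on neither the nodes nor the partition. The
  determinant of the latter may thus be computed from any convenient special case.\<close>

lemma det_interp_eq_jt:
  fixes h :: "complex \<Rightarrow> 'b::idom"
  assumes h: "comm_ring_hom h"
  shows "Determinant.det (mat N N (\<lambda>(i, j). \<Prod>l<mu i + (N - 1 - i). x j - c l))
    = jt h N mu (\<lambda>i r. (\<Sum>j<N. x j ^ Suc r) - (\<Sum>l<mu i + (N - 1 - i). c l ^ Suc r))
      * (\<Prod>j<N. \<Prod>i<j. x i - x j)"
proof -
  let ?M = "mat N N (\<lambda>(k, j). efps x ({..<N} - {j}) $ (N - 1 - k))"
  let ?A = "\<lambda>mu c. mat N N (\<lambda>(i, k). hsym_int h (\<lambda>r. (\<Sum>j<N. x j ^ Suc r) - (\<Sum>l<mu i + (N - 1 - i). c l ^ Suc r)) (int (mu i) - int i + int k))"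
  have "mat N N (\<lambda>(i, j). \<Prod>l<mu i + (N - 1 - i). x j - c l) = ?A mu c * ?M" for mu c
  proof (rule eq_matI)
    fix i j assume "i < dim_row (?A mu c * ?M)" "j < dim_col (?A mu c * ?M)"
    then have ij: "i < N" "j < N" by auto
    then have e: "int (mu i + (N - 1 - i)) - int N + 1 + int k = int (mu i) - int i + int k" for k by auto
    show "mat N N (\<lambda>(i, j). \<Prod>l<mu i + (N - 1 - i). x j - c l) $$ (i, j) = (?A mu c * ?M) $$ (i, j)"
      using ij prod_diff_eq_sum_hsym_int[OF h, of j N x c "mu i + (N - 1 - i)"]
      by (simp add: e scalar_prod_def atLeast0LessThan del: power_Suc)
  qed auto
  then have D: "Determinant.det (mat N N (\<lambda>(i, j). \<Prod>l<mu i + (N - 1 - i). x j - c l)) = Determinant.det (?A mu c) * Determinant.det ?M" for mu c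
    by (simp add: det_mult[of _ N] del: power_Suc)
  \<comment> \<open>For the empty partition and these nodes, every entry with i < j contains the
    factor x_j - x_j, so the matrix is lower triangular and its diagonal multiplies to the
    Vandermonde product.\<close>
  let ?c = "\<lambda>l. x (N - 1 - l)"
  have "Determinant.det (?A (\<lambda>_. 0) ?c) = jt h N (\<lambda>_. 0) (\<lambda>i r. (\<Sum>j<N. x j ^ Suc r) - (\<Sum>l<0 + (N - 1 - i). ?c l ^ Suc r))"
    by (simp add: jt_def del: power_Suc)
  also have "\<dots> = 1" by (subst jt_stable[of 0]) (simp_all add: jt_def)
  finally have "Determinant.det ?M = Determinant.det (mat N N (\<lambda>(i, j). \<Prod>l<0 + (N - 1 - i). x j - ?c l))"
    using D[where mu = "\<lambda>_. 0" and c = ?c] by simp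
  also have "\<dots> = prod_list (diag_mat (mat N N (\<lambda>(i, j). \<Prod>l<0 + (N - 1 - i). x j - ?c l)))"
  proof (rule det_lower_triangular)
    fix i j assume "i < j" "j < N"
    then show "mat N N (\<lambda>(i, j). \<Prod>l<0 + (N - 1 - i). x j - ?c l) $$ (i, j) = 0"
      by (auto intro!: prod_zero bexI[of _ "N - 1 - j"])
  qed auto
  also have "\<dots> = (\<Prod>i<N. \<Prod>l<N - 1 - i. x i - ?c l)"
    by (simp add: diag_mat_def prod.list_conv_set_nth atLeast0LessThan)
  also have "\<dots> = (\<Prod>i<N. \<Prod>j\<in>{i<..<N}. x i - x j)"
    by (intro prod.cong refl prod.reindex_bij_witness[of _ "\<lambda>j. N - 1 - j" "\<lambda>l. N - 1 - l"]) auto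
  also have "\<dots> = (\<Prod>j<N. \<Prod>i<j. x i - x j)"
    unfolding prod.Sigma[OF finite_lessThan ballI[OF finite_greaterThanLessThan]] prod.Sigma[OF finite_lessThan ballI[OF finite_lessThan]]
    by (rule prod.reindex_bij_witness[of _ "\<lambda>(j, i). (i, j)" "\<lambda>(i, j). (j, i)"]) auto
  finally show ?thesis unfolding D by (simp add: jt_def del: power_Suc)
qed

section \<open>The interpolation functions and the q-Racah functions in power sums\<close>

lemma hsym_deg_le:
  assumes "\<And>r. p r \<in> deg_le (Suc r)"
  shows "hsym pconst p r \<in> deg_le r"
proof (induction r rule: less_induct)
  case (less r)
  show ?case
  proof (cases r)
    case (Suc n)
    have "p j * hsym pconst p (n - j) \<in> deg_le (Suc n)" if "j \<le> n" for j
      using deg_le_mult[OF assms[of j] less[of "n - j"]] that Suc by simp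
    then have "pconst (1 / of_nat (Suc n)) * (\<Sum>j\<le>n. p j * hsym pconst p (n - j)) \<in> deg_le (0 + Suc n)"
      by (intro deg_le_mult deg_le_sum) auto
    then show ?thesis using Suc by simp
  qed simp
qed

lemma hsym_int_deg_le:
  assumes "\<And>r. p r \<in> deg_le (Suc r)" "z \<le> int d"
  shows "hsym_int pconst p z \<in> deg_le d"
  unfolding hsym_int_def using assms by (auto intro: deg_le_mono[OF hsym_deg_le])

lemma psub_jt:
  "psub A (jt pconst n mu (\<lambda>i r. pvar r - pconst (C i r)))
    = jt pconst n mu (\<lambda>i r. (\<Sum>j\<in>A. pvar j ^ Suc r) - pconst (C i r))"
proof -
  interpret p: comm_ring_hom "psub A" by (rule psub_hom)
  show ?thesis
    unfolding hom_jt[OF psub_hom]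
    by (simp only: hom_distribs p.hom_minus psub_pvar psub_pconst)
qed

lemma psub_jt_deg_le:
  "psub A (jt pconst n mu (\<lambda>i r. pvar r - pconst (C i r))) \<in> deg_le (\<Sum>i<n. mu i + n)"
  unfolding psub_jt unfolding jt_def
  by (intro deg_le_det hsym_int_deg_le deg_le_diff deg_le_sum deg_le_pvar_power deg_le_pconst) auto

lemma coeff_tendsto_hsym:
  assumes "\<And>r. coeff_tendsto (\<lambda>N. p N r) (P r)"
  shows "coeff_tendsto (\<lambda>N. hsym pconst (p N) r) (hsym pconst P r)"
proof (induction r rule: less_induct)
  case (less r)
  show ?case
  proof (cases r)
    case 0 then show ?thesis by (simp add: coeff_tendsto_const)
  next
    case (Suc n)
    then show ?thesis unfolding Suc hsym.simps
      by (intro coeff_tendsto_mult coeff_tendsto_sum coeff_tendsto_const assms less) (auto simp: Suc)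
  qed
qed

lemma coeff_tendsto_psub_jt:
  assumes "\<And>i r. i < n \<Longrightarrow> (\<lambda>N. C N i r) \<longlonglongrightarrow> D i r"
  shows "coeff_tendsto (\<lambda>N. psub A (jt pconst n mu (\<lambda>i r. pvar r - pconst (C N i r))))
     (psub A (jt pconst n mu (\<lambda>i r. pvar r - pconst (D i r))))"
  unfolding psub_jt unfolding jt_def hsym_int_def
proof (rule coeff_tendsto_det, goal_cases)
  case (1 i k)
  then show ?case
    by (auto intro!: coeff_tendsto_const coeff_tendsto_hsym coeff_tendsto_diff coeff_tendsto_pconst assms)
qed

section \<open>Limits of symmetric polynomials in a growing number of variables\<close>

lemma lookup_restrict_vars:
  assumes "F \<in> Sym_le d" "Poly_Mapping.keys m \<subseteq> {..<N}"
  shows "Poly_Mapping.lookup (restrict_vars N F) m = F m"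
proof -
  let ?g = "\<lambda>m. if Poly_Mapping.keys m \<subseteq> {..<N} then F m else 0"
  have "{m. ?g m \<noteq> 0} \<subseteq> {m. Poly_Mapping.keys m \<subseteq> {..<N} \<and> (\<forall>i. Poly_Mapping.lookup m i \<le> d)}"
    using assms(1) by (auto simp: Sym_le_def intro: order_trans[OF lookup_le_mdeg])
  then have "finite {m. ?g m \<noteq> 0}"
    by (rule finite_subset) (rule finite_monomials, simp)
  then have "Poly_Mapping.lookup (restrict_vars N F) = ?g"
    unfolding restrict_vars_def by (rule lookup_Abs_poly_mapping)
  with assms(2) show ?thesis by simp
qed

text \<open>\<open>iota\<close> selects some preimage under restriction; every preimage of bounded
  degree has the prescribed coefficients on monomials in the first N variables, whichever is
  selected.\<close>

lemma iota_psub: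
  assumes "ps_series P \<in> Sym_le d" "Poly_Mapping.keys m \<subseteq> {..<N}"
  shows "iota d N (psub {..<N} P) m = Poly_Mapping.lookup (psub {..<N} P) m"
proof -
  have im: "psub {..<N} P \<in> restrict_vars N ` Sym_le d"
    using assms(1) restrict_vars_ps_series[of N P] by (metis imageI)
  have "restrict_vars N (iota d N (psub {..<N} P)) = psub {..<N} P"
    unfolding iota_def by (rule f_inv_into_f[OF im])
  moreover have "iota d N (psub {..<N} P) \<in> Sym_le d"
    unfolding iota_def by (rule inv_into_into[OF im])
  ultimately show ?thesis using lookup_restrict_vars assms(2) by metis
qed

text \<open>A fixed coefficient involves only finitely many variables, so from some N on it can be
  read off in a fixed polynomial ring, where the coefficientwise limit is known.\<close>

lemma Sym_tendsto_ps_series: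
  assumes f: "\<forall>\<^sub>F N in sequentially. f N = psub {..<N} (P N)"
    and deg: "\<And>N A. finite A \<Longrightarrow> psub A (P N) \<in> deg_le D" "\<And>A. finite A \<Longrightarrow> psub A Q \<in> deg_le D"
    and lim: "\<And>A. finite A \<Longrightarrow> coeff_tendsto (\<lambda>N. psub A (P N)) (psub A Q)"
  shows "Sym_tendsto f (ps_series Q)"
  unfolding Sym_tendsto_def
proof (intro conjI exI)
  show "ps_series Q \<in> Sym" using ps_series_deg(1)[OF deg(2)] by (auto simp: Sym_def)
  show "\<forall>\<^sub>F N in sequentially. f N \<in> Sym_poly_le D N"
    using f by eventually_elim (use ps_series_deg(2)[OF deg(1)] in auto)
  show "\<forall>\<^sub>F d in sequentially. \<forall>m. (\<lambda>N. iota d N (f N) m) \<longlonglongrightarrow> ps_series Q m"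
    using eventually_ge_at_top[of D]
  proof eventually_elim
    case (elim d)
    show ?case
    proof
      fix m :: monomial
      have Sd: "ps_series (P N) \<in> Sym_le d" for N
        using ps_series_deg(1)[OF deg(1)] elim by (force simp: Sym_le_def)
      obtain N0 where N0: "Poly_Mapping.keys m \<subseteq> {..<N0}"
        using finite_nat_set_iff_bounded[of "Poly_Mapping.keys m"] by auto
      have "\<forall>\<^sub>F N in sequentially. iota d N (f N) m = Poly_Mapping.lookup (psub {..<N0} (P N)) m"
        using f eventually_ge_at_top[of N0]
      proof eventually_elim
        case (elim N)
        then have "Poly_Mapping.keys m \<subseteq> {..<N}" using N0 by auto
        with elim iota_psub[OF Sd[of N] this] lookup_psub_mono[of "{..<N0}" "{..<N}" m "P N"] N0
        show ?case by simp
      qed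
      moreover have "(\<lambda>N. Poly_Mapping.lookup (psub {..<N0} (P N)) m) \<longlonglongrightarrow> ps_series Q m"
        using lim[of "{..<N0}"] N0 by (simp add: coeff_tendsto_def ps_series_eq[of "{..<N0}"])
      ultimately show "(\<lambda>N. iota d N (f N) m) \<longlonglongrightarrow> ps_series Q m"
        by (simp add: tendsto_cong)
    qed
  qed
qed

lemma Sym_tendsto_unique:
  assumes "Sym_tendsto f F" "Sym_tendsto f G"
  shows "F = G"
proof -
  have "\<forall>\<^sub>F d in sequentially. (\<forall>m. (\<lambda>N. iota d N (f N) m) \<longlonglongrightarrow> F m) \<and> (\<forall>m. (\<lambda>N. iota d N (f N) m) \<longlonglongrightarrow> G m)"
    using assms by (auto simp: Sym_tendsto_def intro: eventually_conj)
  from eventually_happens[OF this] obtain d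
    where "(\<lambda>N. iota d N (f N) m) \<longlonglongrightarrow> F m" "(\<lambda>N. iota d N (f N) m) \<longlonglongrightarrow> G m" for m
    by auto
  then show ?thesis using LIMSEQ_unique by (intro ext) blast
qed

text \<open>Makes division by the Vandermonde polynomial unambiguous, since polynomials form an
  integral domain.\<close>

lemma vandermonde_nonzero: "vandermonde N \<noteq> 0"
proof -
  have "pvar i \<noteq> pvar j" if "i < j" for i j
  proof
    assume "pvar i = pvar j"
    then have "Poly_Mapping.keys (pvar i) = Poly_Mapping.keys (pvar j)" by simp
    then have "Poly_Mapping.single i (1::nat) = Poly_Mapping.single j 1" by (simp add: pvar_def)
    then have "Poly_Mapping.keys (Poly_Mapping.single i (1::nat)) = Poly_Mapping.keys (Poly_Mapping.single j (1::nat))" by simp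
    then show False using that by simp
  qed
  then show ?thesis unfolding vandermonde_def by (auto simp: prod_zero_iff)
qed

lemma schur_interp_eq:
  assumes n: "n \<le> N" "\<And>i. n \<le> i \<Longrightarrow> mu i = 0"
  shows "schur_interp mu N c
    = psub {..<N} (jt pconst n mu (\<lambda>i r. pvar r - pconst (\<Sum>l<mu i + (N - 1 - i). c l ^ Suc r)))"
    (is "_ = ?R")
proof -
  interpret pc: comm_ring_hom pconst by (rule pconst_hom)
  have "Determinant.det (mat N N (\<lambda>(i, j). gen_power (pvar j) c (mu i + (N - 1 - i))))
     = jt pconst N mu (\<lambda>i r. (\<Sum>j<N. pvar j ^ Suc r) - (\<Sum>l<mu i + (N - 1 - i). pconst (c l) ^ Suc r)) * vandermonde N"
    unfolding gen_power_def vandermonde_def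
    by (rule det_interp_eq_jt[OF pconst_hom])
  also have "\<dots> = ?R * vandermonde N"
    unfolding psub_jt by (simp only: jt_stable[OF n] hom_distribs)
  finally have eq: "?R * vandermonde N = Determinant.det (mat N N (\<lambda>(i, j). gen_power (pvar j) c (mu i + (N - 1 - i))))" ..
  show ?thesis
    unfolding schur_interp_def
  proof (rule the_equality)
    show "?R * vandermonde N = Determinant.det (mat N N (\<lambda>(i, j). gen_power (pvar j) c (mu i + (N - 1 - i))))" by (rule eq)
  next
    fix f assume "f * vandermonde N = Determinant.det (mat N N (\<lambda>(i, j). gen_power (pvar j) c (mu i + (N - 1 - i))))"
    then have "f * vandermonde N = ?R * vandermonde N" by (rule trans[OF _ eq[symmetric]])
    then show "f = ?R" by (simp only: mult_right_cancel[OF vandermonde_nonzero])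
  qed
qed

text \<open>These are the values of y - q^(N-1)/y at y = -s q^i: the same map that sends
  \<open>ynode\<close> to \<open>racah_node\<close> later on.\<close>

definition qnode :: "complex \<Rightarrow> complex \<Rightarrow> nat \<Rightarrow> nat \<Rightarrow> complex" where
  "qnode q s N i = - s * q ^ i + inverse s * q powi (int N - int i - 1)"

definition qnode_sum :: "complex \<Rightarrow> complex \<Rightarrow> (nat \<Rightarrow> nat) \<Rightarrow> nat \<Rightarrow> nat \<Rightarrow> nat \<Rightarrow> complex" where
  "qnode_sum q s mu N i r = (\<Sum>l<mu i + (N - 1 - i). qnode q s N l ^ Suc r)"

definition ibc_pres :: "complex \<Rightarrow> complex \<Rightarrow> nat \<Rightarrow> (nat \<Rightarrow> nat) \<Rightarrow> cpoly" where
  "ibc_pres q s n mu = jt pconst n mu (\<lambda>i r. pvar r - pconst (lim (\<lambda>N. qnode_sum q s mu N i r)))"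

context
  fixes q :: real and s :: complex
  assumes q: "0 < q" "q < 1" and s: "s \<noteq> 0"
begin

text \<open>One term of the binomial expansion of a power sum of the nodes. Pure powers of the first
  summand form a geometric series, pure powers of the second form one when read backwards, and a
  mixed term carries q^(N-1) from combining q^l with q^(N-l-1), which beats the number of
  terms.\<close>

lemma convergent_qnode_term:
  assumes k: "0 < k" and b: "b \<le> k"
  shows "convergent (\<lambda>N. \<Sum>l<a + (N - 1 - i). (- s * of_real q ^ l) ^ b * (inverse s * of_real q powi (int N - int l - 1)) ^ (k - b))"
proof -
  let ?q = "complex_of_real q"
  have q0: "?q \<noteq> 0" and qr: "q \<noteq> 0" using q by simp_all
  have geo: "convergent (\<lambda>N. \<Sum>l<a + (N - 1 - i). (?q ^ k) ^ l)"
  proof -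
    have "norm (?q ^ k) < 1" using q k by (simp add: norm_power power_less_one_iff)
    then have "(\<lambda>M. \<Sum>l<M. (?q ^ k) ^ l) \<longlonglongrightarrow> 1 / (1 - ?q ^ k)"
      using geometric_sums sums_def by blast
    moreover have "filterlim (\<lambda>N. a + (N - 1 - i)) sequentially sequentially"
    proof (rule filterlim_at_top_mono)
      show "filterlim (\<lambda>N. N - (1 + i)) sequentially sequentially" by (rule filterlim_minus_const_nat_at_top)
    qed auto
    ultimately have "(\<lambda>N. \<Sum>l<a + (N - 1 - i). (?q ^ k) ^ l) \<longlonglongrightarrow> 1 / (1 - ?q ^ k)"
      by (rule filterlim_compose)
    then show ?thesis by (rule convergentI)
  qed
  consider "b = k" | "b = 0" | "0 < b" "b < k" using b by linarith
  then show ?thesis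
  proof cases
    case 1
    have "(\<lambda>N. \<Sum>l<a + (N - 1 - i). (- s * ?q ^ l) ^ b * (inverse s * ?q powi (int N - int l - 1)) ^ (k - b))
       = (\<lambda>N. (- s) ^ k * (\<Sum>l<a + (N - 1 - i). (?q ^ k) ^ l))"
      unfolding sum_distrib_left using 1
      by (intro ext sum.cong refl)
        (simp only: power_mult_distrib power_mult[symmetric] mult.commute[of k] diff_self_eq_0 power_0 mult_1_right)
    then show ?thesis by (simp only:) (intro convergent_mult convergent_const geo)
  next
    case 2
    have "\<forall>\<^sub>F N in sequentially. (\<Sum>l<a + (N - 1 - i). (- s * ?q ^ l) ^ b * (inverse s * ?q powi (int N - int l - 1)) ^ (k - b))
       = (inverse s * ?q powi (int i + 1 - int a)) ^ k * (\<Sum>l<a + (N - 1 - i). (?q ^ k) ^ l)"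
      using eventually_ge_at_top[of "Suc i"]
    proof eventually_elim
      case (elim N)
      let ?M = "a + (N - 1 - i)"
      \<comment> \<open>Reversing the order puts the largest terms in front; their exponents start
        at i + 1 - a, independently of N.\<close>
      have "(\<Sum>l<?M. (- s * ?q ^ l) ^ b * (inverse s * ?q powi (int N - int l - 1)) ^ (k - b))
         = (\<Sum>l<?M. (inverse s * ?q powi (int N - int (?M - 1 - l) - 1)) ^ k)"
        using 2 by (intro sum.reindex_bij_witness[of _ "\<lambda>l. ?M - 1 - l" "\<lambda>l. ?M - 1 - l"]) auto
      also have "\<dots> = (\<Sum>l<?M. (inverse s * ?q powi (int i + 1 - int a)) ^ k * (?q ^ k) ^ l)"
      proof (rule sum.cong[OF refl])
        fix l assume "l \<in> {..<?M}"
        then have "int N - int (?M - 1 - l) - 1 = int i + 1 - int a + int l" using elim by auto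
        then have "?q powi (int N - int (?M - 1 - l) - 1) = ?q powi (int i + 1 - int a) * ?q ^ l"
          by (simp only: power_int_add[OF disjI1[OF q0]] power_int_of_nat)
        then show "(inverse s * ?q powi (int N - int (?M - 1 - l) - 1)) ^ k = (inverse s * ?q powi (int i + 1 - int a)) ^ k * (?q ^ k) ^ l"
          by (simp only: power_mult_distrib power_mult[symmetric] mult.assoc mult.commute[of k l])
      qed
      finally show ?case by (simp add: sum_distrib_left)
    qed
    moreover have "convergent (\<lambda>N. (inverse s * ?q powi (int i + 1 - int a)) ^ k * (\<Sum>l<a + (N - 1 - i). (?q ^ k) ^ l))"
      by (intro convergent_mult convergent_const geo)
    ultimately show ?thesis
      by (simp add: convergent_def tendsto_cong)
  next
    case 3
    \<comment> \<open>The summation runs \<open>a\<close> steps beyond N - 1 - i, so N - l - 1 can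
      become negative, but not below -a; the factor q^(-ak) pays for this.\<close>
    define K where "K = norm s ^ b * norm (inverse s) ^ (k - b) * (q powi (- int (a * k)))"
    have K: "0 \<le> K" unfolding K_def using q by (intro mult_nonneg_nonneg) auto
    have "(\<lambda>N. \<Sum>l<a + (N - 1 - i). (- s * ?q ^ l) ^ b * (inverse s * ?q powi (int N - int l - 1)) ^ (k - b)) \<longlonglongrightarrow> 0"
    proof (rule Lim_null_comparison)
      show "\<forall>\<^sub>F N in sequentially. norm (\<Sum>l<a + (N - 1 - i). (- s * ?q ^ l) ^ b * (inverse s * ?q powi (int N - int l - 1)) ^ (k - b))
        \<le> real (a + N) * (q powi (int N - 1) * K)"
        using eventually_ge_at_top[of "Suc i"]
      proof eventually_elim
        case (elim N)
        have "norm ((- s * ?q ^ l) ^ b * (inverse s * ?q powi (int N - int l - 1)) ^ (k - b)) \<le> q powi (int N - 1) * K"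
          if l: "l < a + (N - 1 - i)" for l
        proof -
          have "norm ((- s * ?q ^ l) ^ b * (inverse s * ?q powi (int N - int l - 1)) ^ (k - b))
            = norm s ^ b * norm (inverse s) ^ (k - b) * ((q ^ l) ^ b * (q powi (int N - int l - 1)) ^ (k - b))"
            using q by (simp add: norm_mult norm_power norm_power_int power_mult_distrib)
          also have "(q ^ l) ^ b * (q powi (int N - int l - 1)) ^ (k - b)
              = q powi (int l * int b + (int N - int l - 1) * int (k - b))"
          proof -
            have "(q ^ l) ^ b = q powi (int l * int b)"
              "(q powi (int N - int l - 1)) ^ (k - b) = q powi ((int N - int l - 1) * int (k - b))"
              by (simp_all only: power_int_mult power_int_of_nat)
            then show ?thesis by (simp only: power_int_add[OF disjI1[OF qr]])
          qed
          also have "\<dots> \<le> q powi ((int N - 1) + (- int (a * k)))"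
          proof (rule power_int_decreasing)
            \<comment> \<open>One factor of each kind is set aside to form q^(N-1); \<open>B\<close>
              and \<open>E\<close> are the exponents left over.\<close>
            obtain B E where B: "int b = B + 1" "0 \<le> B" and E: "int (k - b) = E + 1" "0 \<le> E" "E \<le> int k"
              using 3 by (intro that[of "int b - 1" "int (k - b) - 1"]) auto
            have "0 \<le> int l * B" using B by simp
            moreover have "(- int a) * E \<le> (int N - int l - 1) * E"
              by (rule mult_right_mono) (use l elim E in auto)
            moreover have "int a * E \<le> int a * int k" by (rule mult_left_mono) (use E in auto)
            ultimately show "(int N - 1) + (- int (a * k)) \<le> int l * int b + (int N - int l - 1) * int (k - b)"
              unfolding B E of_nat_mult by (simp add: algebra_simps)
          qed (use q in auto)
          also have "\<dots> = q powi (int N - 1) * q powi (- int (a * k))"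
            by (simp only: power_int_add[OF disjI1[OF qr]])
          finally show ?thesis unfolding K_def
            by (simp add: mult_left_mono mult.assoc mult.left_commute)
        qed
        then have "norm (\<Sum>l<a + (N - 1 - i). (- s * ?q ^ l) ^ b * (inverse s * ?q powi (int N - int l - 1)) ^ (k - b))
            \<le> (\<Sum>l<a + (N - 1 - i). q powi (int N - 1) * K)"
          by (intro order_trans[OF norm_sum] sum_mono) auto
        also have "\<dots> = real (a + (N - 1 - i)) * (q powi (int N - 1) * K)" by simp
        also have "\<dots> \<le> real (a + N) * (q powi (int N - 1) * K)"
          using K q by (intro mult_right_mono mult_nonneg_nonneg) auto
        finally show ?case .
      qed
      have "(\<lambda>N. real N * q ^ N) \<longlonglongrightarrow> 0" using q powser_times_n_limit_0[of q] by simp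
      moreover have q0: "(\<lambda>N. q ^ N) \<longlonglongrightarrow> 0" using q by (intro LIMSEQ_power_zero) simp
      ultimately have "(\<lambda>N. (K / q) * (real a * q ^ N + real N * q ^ N)) \<longlonglongrightarrow> (K / q) * (real a * 0 + 0)"
        by (intro tendsto_mult tendsto_add tendsto_const)
      moreover have "(K / q) * (real a * q ^ N + real N * q ^ N) = real (a + N) * (q powi (int N - 1) * K)" for N
        using q by (simp add: power_int_diff field_simps)
      ultimately show "(\<lambda>N. real (a + N) * (q powi (int N - 1) * K)) \<longlonglongrightarrow> 0" by simp
    qed
    then show ?thesis by (auto simp: convergent_def)
  qed
qed

lemma convergent_qnode_sum: "convergent (\<lambda>N. qnode_sum (of_real q) s mu N i r)"
proof -
  let ?q = "complex_of_real q"
  have eq: "qnode_sum ?q s mu N i r = (\<Sum>b\<le>Suc r. of_nat (Suc r choose b) * (\<Sum>l<mu i + (N - 1 - i). (- s * ?q ^ l) ^ b * (inverse s * ?q powi (int N - int l - 1)) ^ (Suc r - b)))" for N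
    unfolding qnode_sum_def qnode_def binomial_ring sum_distrib_left
    by (subst sum.swap) (simp only: mult.assoc)
  show ?thesis unfolding eq
    by (intro convergent_sum convergent_mult convergent_const convergent_qnode_term) auto
qed

lemma qnode_sum_tendsto: "(\<lambda>N. qnode_sum (of_real q) s mu N i r) \<longlonglongrightarrow> lim (\<lambda>N. qnode_sum (of_real q) s mu N i r)"
  using convergent_qnode_sum by (simp add: convergent_LIMSEQ_iff)

lemma I_BC_eq:
  assumes n: "\<And>i. n \<le> i \<Longrightarrow> mu i = 0"
  shows "I_BC mu (of_real q) s = ps_series (ibc_pres (of_real q) s n mu)"
proof -
  have "Sym_tendsto (\<lambda>N. schur_interp mu N (qnode (of_real q) s N)) (ps_series (ibc_pres (of_real q) s n mu))"
  proof (rule Sym_tendsto_ps_series)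
    show "\<forall>\<^sub>F N in sequentially. schur_interp mu N (qnode (of_real q) s N)
        = psub {..<N} (jt pconst n mu (\<lambda>i r. pvar r - pconst (qnode_sum (of_real q) s mu N i r)))"
      using eventually_ge_at_top[of n]
      by eventually_elim (simp only: schur_interp_eq[OF _ n] qnode_sum_def)
  qed (unfold ibc_pres_def, auto intro: psub_jt_deg_le coeff_tendsto_psub_jt qnode_sum_tendsto)
  then have "(THE F. Sym_tendsto (\<lambda>N. schur_interp mu N (qnode (of_real q) s N)) F) = ps_series (ibc_pres (of_real q) s n mu)"
    by (intro the_equality) (auto intro: Sym_tendsto_unique)
  then show ?thesis unfolding I_BC_def qnode_def .
qed

end

section \<open>Evaluation of polynomials in power sums\<close>

definition pval :: "(nat \<Rightarrow> complex) \<Rightarrow> cpoly \<Rightarrow> complex" where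
  "pval p P = poly_subst (\<lambda>a. a) p P"

lemma pval_hom: "comm_ring_hom (pval p)"
  unfolding pval_def by (rule poly_subst_hom[OF comm_ring_hom_ident])

lemma pval_pconst [simp]: "pval p (pconst a) = a"
  by (simp add: pval_def poly_subst_pconst[OF comm_ring_hom_ident])

lemma pval_pvar [simp]: "pval p (pvar k) = p k"
  by (simp add: pval_def poly_subst_pvar[OF comm_ring_hom_ident])

lemma pval_psub: "pval x (psub A P) = pval (\<lambda>k. \<Sum>j\<in>A. x j ^ Suc k) P"
proof -
  interpret v: comm_ring_hom "pval x" by (rule pval_hom)
  show ?thesis
    unfolding psub_def hom_poly_subst[OF pval_hom] unfolding pval_pconst
    by (simp only: v.hom_sum v.hom_power pval_pvar pval_def[symmetric])
qed

lemma tendsto_pval: "(\<And>k. ((\<lambda>x. p x k) \<longlongrightarrow> P k) F) \<Longrightarrow> ((\<lambda>x. pval (p x) Q) \<longlongrightarrow> pval P Q) F"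
  unfolding pval_def poly_subst_def by (intro tendsto_intros) auto

lemma presentation_iff: "power_sum_presentation P F \<longleftrightarrow> (\<forall>N. restrict_vars N F = psub {..<N} P)"
  by (simp add: power_sum_presentation_def psub_def)

definition psums :: "real set \<Rightarrow> nat \<Rightarrow> complex" where
  "psums X k = complex_of_real (power_sum_at X (Suc k))"

text \<open>The value is independent of the presentation: two presentations agree as polynomials in
  x_0, ..., x_(N-1) for every N, hence at the first N points of the configuration, and the partial
  power sums converge to the actual ones.\<close>

lemma Sym_eval_ps_series:
  assumes lim: "\<And>k. (\<lambda>N. \<Sum>j<N. x j ^ Suc k) \<longlonglongrightarrow> power_sum_at X (Suc k)"
  shows "Sym_eval (ps_series P) X = pval (psums X) P"
proof -
  let ?x = "\<lambda>j. complex_of_real (x j)"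
  have lim': "(\<lambda>N. pval (\<lambda>k. \<Sum>j<N. ?x j ^ Suc k) Q) \<longlonglongrightarrow> pval (psums X) Q" for Q
  proof (rule tendsto_pval)
    fix k
    have "(\<lambda>N. complex_of_real (\<Sum>j<N. x j ^ Suc k)) \<longlonglongrightarrow> psums X k"
      unfolding psums_def by (intro tendsto_of_real lim)
    then show "(\<lambda>N. \<Sum>j<N. ?x j ^ Suc k) \<longlonglongrightarrow> psums X k" by simp
  qed
  have uniq: "pval (psums X) Q = pval (psums X) P" if "power_sum_presentation Q (ps_series P)" for Q
  proof -
    have "psub {..<N} Q = psub {..<N} P" for N
      using that ps_series_presentation[of P] by (simp add: presentation_iff)
    then have "pval (\<lambda>k. \<Sum>j<N. ?x j ^ Suc k) Q = pval (\<lambda>k. \<Sum>j<N. ?x j ^ Suc k) P" for N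
      unfolding pval_psub[symmetric] by simp
    then show ?thesis using lim'[of P] lim'[of Q] LIMSEQ_unique by simp
  qed
  show ?thesis unfolding Sym_eval_def
  proof (rule the_equality)
    show "\<exists>Q. power_sum_presentation Q (ps_series P) \<and>
       pval (psums X) P = poly_subst (\<lambda>a. a) (\<lambda>k. complex_of_real (power_sum_at X (Suc k))) Q"
      using ps_series_presentation[of P] by (auto simp: pval_def psums_def[abs_def])
  qed (use uniq in \<open>auto simp: pval_def psums_def[abs_def]\<close>)
qed

lemma ps_series_lincomb:
  "ps_series (\<Sum>i\<in>I. pconst (a i) * P i) m = (\<Sum>i\<in>I. a i * ps_series (P i) m)"
proof -
  interpret p: comm_ring_hom "psub (Poly_Mapping.keys m)" by (rule psub_hom)
  show ?thesis
    by (simp add: ps_series_def p.hom_sum p.hom_mult lookup_sum lookup_pconst_mult)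
qed

section \<open>Supports and finiteness of partitions\<close>

lemma partition_support:
  assumes "is_partition mu"
  shows "{i. mu i \<noteq> 0} = {..<plen mu}"
proof -
  let ?S = "{i. mu i \<noteq> 0}"
  have fin: "finite ?S" and anti: "antimono mu" using assms by (auto simp: is_partition_def)
  have down: "j \<in> ?S" if "i \<in> ?S" "j \<le> i" for i j
    using antimonoD[OF anti \<open>j \<le> i\<close>] that by auto
  obtain n where "?S = {..<n}"
  proof (cases "?S = {}")
    case True then show ?thesis using that[of 0] by auto
  next
    case False
    have mem: "x \<in> ?S \<longleftrightarrow> x \<in> {..<Suc (Max ?S)}" for x
      unfolding lessThan_iff less_Suc_eq_le
      using down[OF Max_in[OF fin False], of x] Max_ge[OF fin, of x] by blast
    have "?S = {..<Suc (Max ?S)}" by (rule Set.set_eqI) (rule mem)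
    then show ?thesis using that by blast
  qed
  then show ?thesis by (simp add: plen_def)
qed

lemma partition_eq_0_iff: "is_partition mu \<Longrightarrow> mu i = 0 \<longleftrightarrow> plen mu \<le> i"
  using partition_support[of mu] by (metis (mono_tags) lessThan_iff mem_Collect_eq not_le)

lemma finite_partitions_le:
  assumes "is_partition lam"
  shows "finite {mu. is_partition mu \<and> mu \<le> lam}"
proof -
  have "{mu. is_partition mu \<and> mu \<le> lam} \<subseteq> {mu. \<forall>i. (i \<in> {..<plen lam} \<longrightarrow> mu i \<in> {..lam 0}) \<and> (i \<notin> {..<plen lam} \<longrightarrow> mu i = 0)}"
  proof (clarify, intro conjI impI)
    fix mu i assume mu: "is_partition mu" "mu \<le> lam"
    have "mu i \<le> lam i" "lam i \<le> lam 0"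
      using mu assms by (auto simp: le_fun_def is_partition_def antimono_def)
    then show "mu i \<in> {..lam 0}" "i \<notin> {..<plen lam} \<Longrightarrow> mu i = 0"
      using partition_eq_0_iff[OF assms, of i] by auto
  qed
  moreover have "finite {mu :: nat \<Rightarrow> nat. \<forall>i. (i \<in> {..<plen lam} \<longrightarrow> mu i \<in> {..lam 0}) \<and> (i \<notin> {..<plen lam} \<longrightarrow> mu i = 0)}"
    by (rule finite_set_of_finite_funs) auto
  ultimately show ?thesis by (rule finite_subset)
qed

lemma Phi_qR_eq:
  assumes q: "0 < q" "q < 1" "s0 \<noteq> 0" and lam: "is_partition lam"
  shows "Phi_qR lam (complex_of_real q) s0 s1 s2 s3
    = ps_series (\<Sum>mu | is_partition mu \<and> mu \<le> lam. pconst (sigma_qR lam mu (of_real q) s0 s1 s2 s3) * ibc_pres (of_real q) s0 (plen lam) mu)"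
proof
  fix m
  have "I_BC mu (of_real q) s0 = ps_series (ibc_pres (of_real q) s0 (plen lam) mu)" if "mu \<le> lam" for mu
  proof (rule I_BC_eq[OF q])
    fix i assume "plen lam \<le> i"
    then have "lam i = 0" using partition_eq_0_iff[OF lam] by simp
    with that show "mu i = 0" by (metis le_fun_def le_zero_eq)
  qed
  then show "Phi_qR lam (complex_of_real q) s0 s1 s2 s3 m = ps_series (\<Sum>mu | is_partition mu \<and> mu \<le> lam. pconst (sigma_qR lam mu (of_real q) s0 s1 s2 s3) * ibc_pres (of_real q) s0 (plen lam) mu) m"
    unfolding Phi_qR_def ps_series_lincomb by (intro sum.cong) auto
qed

section \<open>Straightening\<close>

definition hprod :: "nat \<Rightarrow> (nat \<Rightarrow> nat) \<Rightarrow> cpoly" where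
  "hprod n a = (\<Prod>i<n. hsym pconst pvar (a i))"

text \<open>Subtracting constants from the power sums multiplies the generating series by a series
  with constant term 1, so each complete function changes only by multiples of those of lower
  degree.\<close>

lemma hsym_shift:
  "hsym pconst (\<lambda>r. pvar r - pconst (c r)) m
    = (\<Sum>j\<le>m. pconst (hsym (\<lambda>a. a) (\<lambda>r. - c r) j) * hsym pconst pvar (m - j))"
proof -
  interpret pc: comm_ring_hom pconst by (rule pconst_hom)
  have "Abs_fps (hsym pconst (\<lambda>r. - pconst (c r))) * Abs_fps (hsym pconst pvar)
      = Abs_fps (hsym pconst (\<lambda>r. - pconst (c r) + pvar r))"
    by (rule hsym_add[OF pconst_hom])
  moreover have "hsym pconst (\<lambda>r. - pconst (c r)) = (\<lambda>j. pconst (hsym (\<lambda>a. a) (\<lambda>r. - c r) j))"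
    by (rule ext) (simp add: hom_hsym[OF pconst_hom] pc.hom_uminus)
  ultimately have "hsym pconst (\<lambda>r. - pconst (c r) + pvar r) m
      = (Abs_fps (\<lambda>j. pconst (hsym (\<lambda>a. a) (\<lambda>r. - c r) j)) * Abs_fps (hsym pconst pvar)) $ m"
    by simp
  then show ?thesis by (simp add: fps_mult_nth atLeast0AtMost)
qed

text \<open>Newton's recursion solved for the last power sum: the complete functions generate the
  whole polynomial ring.\<close>

lemma pvar_eq_hsym:
  "pvar r = of_nat (Suc r) * hsym pconst pvar (Suc r) - (\<Sum>j<r. pvar j * hsym pconst pvar (r - j))"
proof -
  have "of_nat (Suc r) * hsym pconst pvar (Suc r) = fps_deriv (Abs_fps (hsym pconst pvar)) $ r"
    by (simp del: hsym.simps)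
  also have "\<dots> = (Abs_fps pvar * Abs_fps (hsym pconst pvar)) $ r"
    by (simp add: fps_deriv_hsym[OF pconst_hom] mult.commute)
  also have "\<dots> = (\<Sum>j<Suc r. pvar j * hsym pconst pvar (r - j))"
    by (simp add: fps_mult_nth atLeast0AtMost lessThan_Suc_atMost del: sum.lessThan_Suc)
  finally show ?thesis by simp
qed

lemma ex_sorting_permutation:
  fixes a :: "nat \<Rightarrow> 'a::linorder"
  obtains p where "p permutes {..<n}" "\<And>i j. i \<le> j \<Longrightarrow> j < n \<Longrightarrow> a (p j) \<le> a (p i)"
proof -
  let ?ys = "map a [0..<n]"
  obtain p where p: "p permutes {..<length ?ys}" "permute_list p ?ys = rev (sort ?ys)"
    by (rule mset_eq_permutation[of "rev (sort ?ys)" ?ys]) simp_all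
  then have pn: "p permutes {..<n}" by simp
  have less: "p i < n" if "i < n" for i using permutes_in_image[OF pn, of i] that by simp
  have nth: "rev (sort ?ys) ! i = a (p i)" if "i < n" for i
    using that less[OF that] p by (simp add: p(2)[symmetric] permute_list_nth)
  have "a (p j) \<le> a (p i)" if "i \<le> j" "j < n" for i j
    using that nth[of i] nth[of j] sorted_nth_mono[of "sort ?ys" "n - Suc j" "n - Suc i"]
    by (simp add: rev_nth)
  with pn that show thesis by blast
qed

text \<open>At the first index k moved by \<open>p\<close>, injectivity forces p k > k, so the
  exponent there exceeds mu_k by at least 1. With base n + 1 this single term outweighs the at most
  n terms of the original tail, all bounded by (n+1)^(mu_k).\<close>

lemma sum_power_permuted_less:
  assumes anti: "\<And>i j. i \<le> j \<Longrightarrow> j < n \<Longrightarrow> mu j \<le> mu i"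
    and p: "p permutes {0..<n}" "p \<noteq> id"
    and a: "\<And>i. i < n \<Longrightarrow> int (a i) = int (mu i) - int i + int (p i)"
  shows "(\<Sum>i<n. Suc n ^ mu i) < (\<Sum>i<n. Suc n ^ a i)"
proof -
  define k where "k = (LEAST i. p i \<noteq> i)"
  obtain i0 where "p i0 \<noteq> i0" using p(2) by (auto simp: fun_eq_iff)
  then have k: "p k \<noteq> k" unfolding k_def by (rule LeastI)
  have fix_less: "p i = i" if "i < k" for i
    using not_less_Least[of i "\<lambda>i. p i \<noteq> i"] that unfolding k_def by blast
  have kn: "k < n" using k permutes_not_in[OF p(1), of k] by (cases "k < n") auto
  have "k < p k"
  proof (rule ccontr)
    assume "\<not> k < p k"
    with k have "p k < k" by simp
    with fix_less[OF this] have "p (p k) = p k" by simp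
    with injD[OF permutes_inj[OF p(1)], of "p k" k] k show False by blast
  qed
  then have ak: "Suc (mu k) \<le> a k" using a[OF kn] by linarith
  have split: "(\<Sum>i<n. f i) = (\<Sum>i<k. f i) + (\<Sum>i\<in>{k..<n}. f i)" for f :: "nat \<Rightarrow> nat"
    using kn by (simp add: sum.atLeastLessThan_concat[of 0 k n f, simplified] atLeast0LessThan[symmetric])
  have eq: "(\<Sum>i<k. Suc n ^ mu i) = (\<Sum>i<k. Suc n ^ a i)"
  proof (rule sum.cong[OF refl])
    fix i assume "i \<in> {..<k}"
    then have "a i = mu i" using a[of i] fix_less[of i] kn by simp
    then show "Suc n ^ mu i = Suc n ^ a i" by simp
  qed
  have "(\<Sum>i\<in>{k..<n}. Suc n ^ mu i) \<le> (\<Sum>i\<in>{k..<n}. Suc n ^ mu k)"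
    by (intro sum_mono power_increasing anti) auto
  also have "\<dots> \<le> n * Suc n ^ mu k" by simp
  also have "\<dots> < Suc n ^ Suc (mu k)" by simp
  also have "\<dots> \<le> Suc n ^ a k" by (rule power_increasing[OF ak]) simp
  also have "\<dots> \<le> (\<Sum>i\<in>{k..<n}. Suc n ^ a i)" by (rule member_le_sum) (use kn in auto)
  finally show ?thesis unfolding split eq by simp
qed

context
  fixes W :: "cpoly set" and C :: "(nat \<Rightarrow> nat) \<Rightarrow> nat \<Rightarrow> nat \<Rightarrow> complex"
  assumes W_add: "\<And>P Q. P \<in> W \<Longrightarrow> Q \<in> W \<Longrightarrow> P + Q \<in> W"
    and W_scale: "\<And>a P. P \<in> W \<Longrightarrow> pconst a * P \<in> W"
    and W_jt: "\<And>mu n. is_partition mu \<Longrightarrow> (\<And>i. n \<le> i \<Longrightarrow> mu i = 0) \<Longrightarrow>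
      jt pconst n mu (\<lambda>i r. pvar r - pconst (C mu i r)) \<in> W"
begin

lemma W_1: "1 \<in> W"
  using W_jt[of "\<lambda>_. 0" 0] by (simp add: is_partition_def antimono_def jt_def)

lemma W_0: "0 \<in> W"
  using W_scale[OF W_1, of 0] by (simp add: pconst_def)

lemma W_sum: "(\<And>i. i \<in> I \<Longrightarrow> F i \<in> W) \<Longrightarrow> (\<Sum>i\<in>I. F i) \<in> W"
  by (induction I rule: infinite_finite_induct) (auto intro: W_add W_0)

lemma W_uminus: "P \<in> W \<Longrightarrow> - P \<in> W"
  using W_scale[of P "- 1"] by (simp add: pconst_def single_uminus)

lemma W_diff: "P \<in> W \<Longrightarrow> Q \<in> W \<Longrightarrow> P - Q \<in> W"
  using W_add[of P "- Q"] W_uminus[of Q] by simp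

text \<open>Expanding each factor by \<open>hsym_shift\<close>, the choice of zero shift in every
  factor gives \<open>hprod n a\<close>; any other choice lowers the total degree.\<close>

lemma W_lower_terms:
  assumes lower: "\<And>b. (\<Sum>i<n. b i) < (\<Sum>i<n. a i) \<Longrightarrow> hprod n b \<in> W"
  shows "(\<Prod>i<n. hsym pconst (\<lambda>r. pvar r - pconst (c i r)) (a i)) - hprod n a \<in> W"
proof -
  interpret pc: comm_ring_hom pconst by (rule pconst_hom)
  let ?e = "\<lambda>i. hsym (\<lambda>a. a) (\<lambda>r. - c i r)"
  let ?F = "\<lambda>J. \<Prod>i<n. pconst (?e i (J i)) * hsym pconst pvar (a i - J i)"
  let ?X = "PiE {..<n} (\<lambda>i. {..a i})" and ?z = "\<lambda>i\<in>{..<n}. 0::nat"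
  have F: "?F J = pconst (\<Prod>i<n. ?e i (J i)) * hprod n (\<lambda>i. a i - J i)" for J
    by (simp add: prod.distrib hprod_def pc.hom_prod)
  have "(\<Prod>i<n. hsym pconst (\<lambda>r. pvar r - pconst (c i r)) (a i)) = (\<Sum>J\<in>?X. ?F J)"
    unfolding hsym_shift by (rule prod_sum_PiE) auto
  also have "\<dots> = ?F ?z + (\<Sum>J\<in>?X - {?z}. ?F J)"
    by (rule sum.remove) (auto intro: finite_PiE split: if_splits)
  also have "?F ?z = hprod n a"
    unfolding hprod_def by (intro prod.cong) (auto simp: pconst_def)
  finally have "(\<Prod>i<n. hsym pconst (\<lambda>r. pvar r - pconst (c i r)) (a i)) - hprod n a = (\<Sum>J\<in>?X - {?z}. ?F J)"
    by (simp only: add_diff_cancel_left')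
  also have "\<dots> \<in> W"
  proof (rule W_sum)
    fix J assume J: "J \<in> ?X - {?z}"
    obtain k where k: "k < n" "J k \<noteq> 0"
    proof (rule ccontr)
      assume "\<not> thesis"
      with that have "\<And>k. k < n \<Longrightarrow> J k = 0" by blast
      then have "J = ?z"
        using J by (intro extensionalityI[of J "{..<n}"]) (auto simp: PiE_def)
      with J show False by simp
    qed
    have "(\<Sum>i<n. a i - J i) < (\<Sum>i<n. a i)"
    proof (rule sum_strict_mono_ex1)
      show "\<exists>i\<in>{..<n}. a i - J i < a i" using PiE_mem[of J "{..<n}" "\<lambda>i. {..a i}" k] J k by (intro bexI[of _ k]) auto
    qed auto
    then show "?F J \<in> W" unfolding F by (intro W_scale lower)
  qed
  finally show ?thesis .
qed

text \<open>Expanding the determinant indexed by the sorted exponents, every non-identity permutation gives a product of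
  the same degree with larger value of $\sum_i (n+1)^{a_i}$, up to products of lower degree: the induction is
  on the degree and then downwards on that value.\<close>

lemma hprod_in_W: "hprod n a \<in> W"
proof (induction "\<Sum>i<n. a i" arbitrary: a rule: less_induct)
  case outer: less
  define d where "d = (\<Sum>i<n. a i)"
  have lower: "hprod n b \<in> W" if "(\<Sum>i<n. b i) < d" for b
    using outer[of b] that by (simp add: d_def)
  have "(\<Sum>i<n. b i) = d \<Longrightarrow> hprod n b \<in> W" for b
  \<comment> \<open>All exponents are at most \<open>d\<close>, so n (n+1)^d bounds the sum of
    powers; the truncated difference thus decreases strictly as that sum grows.\<close>
  proof (induction "n * Suc n ^ d - (\<Sum>i<n. Suc n ^ b i)" arbitrary: b rule: less_induct)
    case inner: less
    obtain p where p: "p permutes {..<n}" and sorted: "\<And>i j. i \<le> j \<Longrightarrow> j < n \<Longrightarrow> b (p j) \<le> b (p i)"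
      using ex_sorting_permutation[of n b] by blast
    define mu where "mu = (\<lambda>i. if i < n then b (p i) else 0)"
    have perm: "(\<Sum>i<n. f (mu i)) = (\<Sum>i<n. f (b i))" for f :: "nat \<Rightarrow> nat"
      using sum.permute[OF p, of "\<lambda>i. f (b i)"] by (simp add: mu_def comp_def)
    have sum_mu: "(\<Sum>i<n. mu i) = d" using perm[of "\<lambda>x. x"] inner.prems by simp
    have anti: "mu j \<le> mu i" if "i \<le> j" for i j using sorted[OF that] that by (auto simp: mu_def)
    have part: "is_partition mu"
      unfolding is_partition_def antimono_def using anti
      by (auto intro: finite_subset[of _ "{..<n}"] simp: mu_def split: if_splits)
    let ?s = "\<lambda>i r. pvar r - pconst (C mu i r)"
    let ?T = "\<lambda>\<pi>. signof \<pi> * (\<Prod>i = 0..<n. hsym_int pconst (?s i) (int (mu i) - int i + int (\<pi> i)))"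
    let ?P = "{\<pi>. \<pi> permutes {0..<n}}"
    have "jt pconst n mu ?s = (\<Sum>\<pi>\<in>?P. ?T \<pi>)"
      unfolding jt_def by (rule det_mat_leibniz)
    also have "\<dots> = ?T id + (\<Sum>\<pi>\<in>?P - {id}. ?T \<pi>)"
      by (rule sum.remove) (auto simp: permutes_id finite_permutations)
    also have "?T id = (\<Prod>i<n. hsym pconst (?s i) (mu i))"
      by (simp add: sign_id hsym_int_def atLeast0LessThan)
    finally have jt: "(\<Prod>i<n. hsym pconst (?s i) (mu i)) = jt pconst n mu ?s - (\<Sum>\<pi>\<in>?P - {id}. ?T \<pi>)"
      by (simp only: add_diff_cancel_right')
    have "(\<Sum>\<pi>\<in>?P - {id}. ?T \<pi>) \<in> W"
    proof (rule W_sum)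
      fix \<pi> assume \<pi>: "\<pi> \<in> ?P - {id}"
      have "(\<Prod>i = 0..<n. hsym_int pconst (?s i) (int (mu i) - int i + int (\<pi> i))) \<in> W"
      proof (cases "\<exists>i<n. int (mu i) - int i + int (\<pi> i) < 0")
        case True
        then have "(\<Prod>i = 0..<n. hsym_int pconst (?s i) (int (mu i) - int i + int (\<pi> i))) = 0"
          by (intro prod_zero) (auto simp: hsym_int_def)
        then show ?thesis by (simp only: W_0)
      next
        case False
        define e where "e = (\<lambda>i. nat (int (mu i) - int i + int (\<pi> i)))"
        have e: "int (e i) = int (mu i) - int i + int (\<pi> i)" if "i < n" for i
          using False that by (force simp: e_def)
        have "int (\<Sum>i<n. e i) = (\<Sum>i<n. int (mu i)) - (\<Sum>i<n. int i) + (\<Sum>i<n. int (\<pi> i))"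
          by (simp add: e sum.distrib sum_subtractf)
        also have "(\<Sum>i<n. int (\<pi> i)) = (\<Sum>i<n. int i)"
          using sum.permute[of \<pi> "{..<n}" int] \<pi> by (simp add: atLeast0LessThan comp_def)
        finally have "int (\<Sum>i<n. e i) = int (\<Sum>i<n. mu i)" by simp
        then have sum_e: "(\<Sum>i<n. e i) = d" using sum_mu by linarith
        have "(\<Sum>i<n. Suc n ^ mu i) < (\<Sum>i<n. Suc n ^ e i)"
          by (rule sum_power_permuted_less[of n mu \<pi>]) (use anti \<pi> e in auto)
        moreover have "(\<Sum>i<n. Suc n ^ e i) \<le> (\<Sum>i<n. Suc n ^ d)"
          by (intro sum_mono power_increasing)
            (auto simp: sum_e[symmetric] intro: member_le_sum)
        ultimately have "hprod n e \<in> W"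
          by (intro inner.hyps) (use sum_e perm[of "\<lambda>x. Suc n ^ x"] in auto)
        moreover have "(\<Prod>i<n. hsym pconst (?s i) (e i)) - hprod n e \<in> W"
          by (rule W_lower_terms) (use lower sum_e in auto)
        ultimately have "(\<Prod>i<n. hsym pconst (?s i) (e i)) \<in> W"
          using W_add by fastforce
        moreover have "(\<Prod>i<n. hsym pconst (?s i) (e i)) = (\<Prod>i = 0..<n. hsym_int pconst (?s i) (int (mu i) - int i + int (\<pi> i)))"
          unfolding atLeast0LessThan using False by (intro prod.cong) (auto simp: hsym_int_def e_def)
        ultimately show ?thesis by simp
      qed
      then show "?T \<pi> \<in> W" by (auto simp: sign_def intro: W_uminus)
    qed
    with jt W_jt[OF part, of n] have "(\<Prod>i<n. hsym pconst (?s i) (mu i)) \<in> W"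
      by (auto simp: mu_def intro: W_diff)
    moreover have "(\<Prod>i<n. hsym pconst (?s i) (mu i)) - hprod n mu \<in> W"
      by (rule W_lower_terms) (use lower sum_mu in auto)
    ultimately have "hprod n mu \<in> W" using W_diff by fastforce
    moreover have "hprod n mu = hprod n b"
      using prod.permute[OF p, of "\<lambda>i. hsym pconst pvar (b i)"] by (simp add: hprod_def mu_def comp_def)
    ultimately show ?case by simp
  qed
  then show ?case by (simp add: d_def)
qed

text \<open>Membership of the products \<open>hprod\<close> in \<open>W\<close> is not visibly
  stable under multiplication, so two sets are used: \<open>U\<close>, the polynomials that multiply
  all products into \<open>W\<close>, and its multipliers \<open>S\<close>. The latter form an
  algebra; multiplication by a complete function merely appends a factor to a product, so
  \<open>S\<close> contains all generators.\<close>

lemma straightening: "W = UNIV"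
proof -
  define U where "U = {P. \<forall>n a. P * hprod n a \<in> W}"
  define S where "S = {Q. \<forall>P\<in>U. Q * P \<in> U}"
  have U_add: "P + Q \<in> U" if "P \<in> U" "Q \<in> U" for P Q
    using that by (auto simp: U_def distrib_right intro: W_add)
  have U_scale: "pconst c * P \<in> U" if "P \<in> U" for c P
    using that by (auto simp: U_def mult.assoc intro: W_scale)
  have S_add: "P + Q \<in> S" if "P \<in> S" "Q \<in> S" for P Q
    using that by (auto simp: S_def distrib_right intro: U_add)
  have S_mult: "P * Q \<in> S" if "P \<in> S" "Q \<in> S" for P Q
    using that by (auto simp: S_def mult.assoc)
  have S_const: "pconst c \<in> S" for c by (auto simp: S_def intro: U_scale)
  have S_0: "0 \<in> S" and S_1: "1 \<in> S" using S_const[of 0] S_const[of 1] by (simp_all add: pconst_def)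
  have S_of_nat: "of_nat n \<in> S" for n by (induction n) (auto intro: S_add S_0 S_1)
  have S_uminus: "- P \<in> S" if "P \<in> S" for P
    using S_mult[OF S_const[of "- 1"] that] by (simp add: pconst_def single_uminus)
  have S_sum: "(\<Sum>i\<in>I. F i) \<in> S" if "\<And>i. i \<in> I \<Longrightarrow> F i \<in> S" for F :: "'i \<Rightarrow> cpoly" and I
    using that by (induction I rule: infinite_finite_induct) (auto intro: S_add S_0)
  have S_power: "P ^ k \<in> S" if "P \<in> S" for P k
    using that by (induction k) (auto intro: S_mult S_1)
  have S_prod: "(\<Prod>i\<in>I. F i) \<in> S" if "\<And>i. i \<in> I \<Longrightarrow> F i \<in> S" for F :: "'i \<Rightarrow> cpoly" and I
    using that by (induction I rule: infinite_finite_induct) (auto intro: S_mult S_1)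
  have S_hsym: "hsym pconst pvar r \<in> S" for r
  proof -
    have "hsym pconst pvar r * P * hprod n a \<in> W" if "P \<in> U" for P n a
    proof -
      have "hprod (Suc n) (a(n := r)) = hprod n a * hsym pconst pvar r"
        by (simp add: hprod_def)
      then have "hsym pconst pvar r * P * hprod n a = P * hprod (Suc n) (a(n := r))"
        by (simp only: ac_simps)
      moreover have "P * hprod (Suc n) (a(n := r)) \<in> W" using that by (simp add: U_def)
      ultimately show ?thesis by (simp only:)
    qed
    then show ?thesis by (simp add: S_def U_def)
  qed
  have S_pvar: "pvar r \<in> S" for r
  proof (induction r rule: less_induct)
    case (less r)
    have "of_nat (Suc r) * hsym pconst pvar (Suc r) + - (\<Sum>j<r. pvar j * hsym pconst pvar (r - j)) \<in> S"
      by (intro S_add S_mult S_of_nat S_hsym S_uminus S_sum less) simp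
    then show ?case by (subst pvar_eq_hsym) (simp only: diff_conv_add_uminus)
  qed
  have "Q \<in> W" for Q
  proof -
    have "poly_subst pconst pvar Q \<in> S"
      unfolding poly_subst_def by (intro S_sum S_mult S_const S_prod S_power S_pvar)
    then have "Q \<in> S" by (simp only: poly_subst_ident)
    moreover have "1 \<in> U" by (simp add: U_def hprod_in_W)
    ultimately have "Q \<in> U" by (auto simp: S_def)
    then have "Q * hprod 0 id \<in> W" by (simp add: U_def)
    then show ?thesis by (simp add: hprod_def)
  qed
  then show ?thesis by auto
qed

end

section \<open>Determinants of q-Racah polynomials\<close>

definition beta_set :: "nat \<Rightarrow> (nat \<Rightarrow> nat) \<Rightarrow> nat \<Rightarrow> nat" where
  "beta_set N mu k = mu k + (N - 1 - k)"

text \<open>Through their shifted parts these partitions correspond to the N-element subsets of the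
  numbers below \<open>M\<close>, which are the index sets of minors.\<close>

definition partition_box :: "nat \<Rightarrow> nat \<Rightarrow> (nat \<Rightarrow> nat) set" where
  "partition_box N M = {mu. is_partition mu \<and> (\<forall>i\<ge>N. mu i = 0) \<and> (\<forall>k<N. beta_set N mu k < M)}"

lemma beta_set_strict:
  assumes "is_partition mu" "i < j" "j < N"
  shows "beta_set N mu j < beta_set N mu i"
proof -
  have "mu j \<le> mu i" using assms by (auto simp: is_partition_def antimono_def)
  with assms show ?thesis by (auto simp: beta_set_def)
qed

lemma strict_decreasing_nat_gap:
  fixes h :: "nat \<Rightarrow> nat"
  assumes "\<And>i j. i < j \<Longrightarrow> j < N \<Longrightarrow> h j < h i" "k \<le> j" "j < N"
  shows "h j + (j - k) \<le> h k"
  using assms(2,3)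
proof (induction j rule: dec_induct)
  case (step j)
  then show ?case using assms(1)[of j "Suc j"] by (simp add: Suc_diff_le)
qed simp

lemma permutes_mono_eq_id:
  assumes p: "p permutes {0..<N::nat}" and mono: "\<And>i j. i < j \<Longrightarrow> j < N \<Longrightarrow> p i < p j"
  shows "p = id"
proof (rule ccontr)
  assume "p \<noteq> id"
  then obtain i0 where i0: "p i0 \<noteq> i0" by (auto simp: fun_eq_iff)
  define k where "k = (LEAST i. p i \<noteq> i)"
  have k: "p k \<noteq> k" unfolding k_def using i0 by (rule LeastI)
  have fix_less: "p i = i" if "i < k" for i
    using not_less_Least[of i "\<lambda>i. p i \<noteq> i"] that unfolding k_def by blast
  have kn: "k < N" using k permutes_not_in[OF p, of k] by (cases "k < N") auto
  obtain j where j: "p j = k" using permutes_surj[OF p] by (metis surjD)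
  have "j < N" using j kn permutes_in_image[OF p, of j] by simp
  have "k < j" using j k fix_less[of j] by (cases j k rule: linorder_cases) auto
  then have "p k < k" using mono[OF _ \<open>j < N\<close>, of k] j by simp
  with fix_less[OF this] have "p (p k) = p k" by simp
  with injD[OF permutes_inj[OF p], of "p k" k] k show False by blast
qed

text \<open>An injective choice of N indices is its set of values, encoded by a partition, together
  with the order in which they occur, a permutation.\<close>

lemma bij_betw_beta_sets:
  "bij_betw (\<lambda>(mu, \<pi>). \<lambda>i\<in>{0..<N}. beta_set N mu (\<pi> i)) (partition_box N M \<times> {\<pi>. \<pi> permutes {0..<N}})
     {f \<in> PiE {0..<N} (\<lambda>_. {..<M}). inj_on f {0..<N}}"
  unfolding bij_betw_def
proof
  let ?h = "\<lambda>(mu, \<pi>). \<lambda>i\<in>{0..<N}. beta_set N mu (\<pi> i)"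
  show "inj_on ?h (partition_box N M \<times> {\<pi>. \<pi> permutes {0..<N}})"
  proof (rule inj_onI, clarify)
    fix mu \<pi> nu \<rho>
    assume mu: "mu \<in> partition_box N M" and \<pi>: "\<pi> permutes {0..<N}"
      and nu: "nu \<in> partition_box N M" and \<rho>: "\<rho> permutes {0..<N}"
      and eq: "(\<lambda>i\<in>{0..<N}. beta_set N mu (\<pi> i)) = (\<lambda>i\<in>{0..<N}. beta_set N nu (\<rho> i))"
    have eq': "beta_set N mu (\<pi> i) = beta_set N nu (\<rho> i)" if "i < N" for i
      using fun_cong[OF eq, of i] that by simp
    define \<tau> where "\<tau> = \<pi> \<circ> inv_into UNIV \<rho>"
    have inv: "inv_into UNIV \<rho> permutes {0..<N}" by (rule permutes_inv[OF \<rho>])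
    have \<tau>: "\<tau> permutes {0..<N}" unfolding \<tau>_def by (rule permutes_compose[OF inv \<pi>])
    have \<tau>_eq: "beta_set N mu (\<tau> k) = beta_set N nu k" if "k < N" for k
      using eq'[of "inv_into UNIV \<rho> k"] permutes_lessThan_less[OF inv that]
      by (simp add: \<tau>_def permutes_inverses[OF \<rho>])
    have "\<tau> = id"
    proof (rule permutes_mono_eq_id[OF \<tau>])
      fix i j assume ij: "i < j" "j < N"
      then have "beta_set N mu (\<tau> j) < beta_set N mu (\<tau> i)"
        using beta_set_strict[of nu i j N] nu by (simp add: \<tau>_eq partition_box_def)
      then show "\<tau> i < \<tau> j"
        using beta_set_strict[of mu "\<tau> j" "\<tau> i" N] mu permutes_lessThan_less[OF \<tau>, of i] ij
        by (cases "\<tau> i" "\<tau> j" rule: linorder_cases) (auto simp: partition_box_def)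
    qed
    have "mu k = nu k" for k
    proof (cases "k < N")
      case True
      then show ?thesis using \<tau>_eq[OF True] \<open>\<tau> = id\<close> by (simp add: beta_set_def)
    qed (use mu nu in \<open>auto simp: partition_box_def\<close>)
    moreover have "\<pi> i = \<rho> i" for i
      using fun_cong[OF \<open>\<tau> = id\<close>, of "\<rho> i"] by (simp add: \<tau>_def permutes_inverses[OF \<rho>])
    ultimately show "mu = nu \<and> \<pi> = \<rho>" by auto
  qed
  show "?h ` (partition_box N M \<times> {\<pi>. \<pi> permutes {0..<N}}) = {f \<in> PiE {0..<N} (\<lambda>_. {..<M}). inj_on f {0..<N}}"
  proof (intro equalityI subsetI)
    fix f assume "f \<in> ?h ` (partition_box N M \<times> {\<pi>. \<pi> permutes {0..<N}})"
    then obtain mu \<pi> where mu: "mu \<in> partition_box N M" and \<pi>: "\<pi> permutes {0..<N}"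
      and f: "f = (\<lambda>i\<in>{0..<N}. beta_set N mu (\<pi> i))" by auto
    have "inj_on f {0..<N}"
    proof (rule inj_onI)
      fix i j assume ij: "i \<in> {0..<N}" "j \<in> {0..<N}" "f i = f j"
      then have "beta_set N mu (\<pi> i) = beta_set N mu (\<pi> j)" by (simp add: f)
      then have "\<pi> i = \<pi> j"
        using beta_set_strict[of mu "\<pi> i" "\<pi> j" N] beta_set_strict[of mu "\<pi> j" "\<pi> i" N] mu ij
          permutes_lessThan_less[OF \<pi>]
        by (cases "\<pi> i" "\<pi> j" rule: linorder_cases) (auto simp: partition_box_def)
      then show "i = j" using permutes_inj[OF \<pi>] by (auto dest: injD)
    qed
    then show "f \<in> {f \<in> PiE {0..<N} (\<lambda>_. {..<M}). inj_on f {0..<N}}"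
      using mu permutes_lessThan_less[OF \<pi>] by (auto simp: f partition_box_def)
  next
    fix f assume "f \<in> {f \<in> PiE {0..<N} (\<lambda>_. {..<M}). inj_on f {0..<N}}"
    then have f: "f \<in> PiE {0..<N} (\<lambda>_. {..<M})" "inj_on f {0..<N}" by auto
    obtain p where p: "p permutes {0..<N}" and le: "\<And>i j. i \<le> j \<Longrightarrow> j < N \<Longrightarrow> f (p j) \<le> f (p i)"
      using ex_sorting_permutation[of N f] unfolding atLeast0LessThan by blast
    have strict: "f (p j) < f (p i)" if "i < j" "j < N" for i j
    proof -
      have "p i \<noteq> p j" using permutes_inj[OF p] that by (auto dest: injD)
      then have "f (p i) \<noteq> f (p j)"
        using inj_onD[OF f(2), of "p i" "p j"] permutes_lessThan_less[OF p] that by auto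
      with le[of i j] that show ?thesis by simp
    qed
    define mu where "mu = (\<lambda>k. if k < N then f (p k) - (N - 1 - k) else 0)"
    have gap: "f (p j) + (j - k) \<le> f (p k)" if "k \<le> j" "j < N" for k j
      by (rule strict_decreasing_nat_gap[where h = "\<lambda>k. f (p k)"]) (use strict that in auto)
    have big: "N - 1 - k \<le> f (p k)" if "k < N" for k
    proof -
      have "k \<le> N - 1" "N - 1 < N" using that by auto
      from gap[OF this] show ?thesis by linarith
    qed
    have beta: "beta_set N mu k = f (p k)" if "k < N" for k
      using big[OF that] that by (simp add: beta_set_def mu_def)
    have "antimono mu"
    proof (rule antimonoI)
      fix x y :: nat assume xy: "x \<le> y"
      then show "mu y \<le> mu x" using gap[of x y] by (auto simp: mu_def)
    qed
    moreover have "finite {i. mu i \<noteq> 0}"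
      by (rule finite_subset[of _ "{..<N}"]) (auto simp: mu_def)
    moreover have "f (p k) < M" if "k < N" for k
      using PiE_mem[OF f(1), of "p k"] permutes_lessThan_less[OF p that] by simp
    ultimately have "mu \<in> partition_box N M"
      by (auto simp: partition_box_def is_partition_def beta mu_def[THEN fun_cong])
    moreover have "f = (\<lambda>i\<in>{0..<N}. beta_set N mu (inv_into UNIV p i))"
    proof (rule extensionalityI[of _ "{0..<N}"])
      fix i assume "i \<in> {0..<N}"
      then have "inv_into UNIV p i < N" using permutes_lessThan_less[OF permutes_inv[OF p]] by simp
      then show "f i = (\<lambda>i\<in>{0..<N}. beta_set N mu (inv_into UNIV p i)) i"
        using \<open>i \<in> {0..<N}\<close> by (simp add: beta permutes_inverses[OF p])
    qed (use f(1) in \<open>auto simp: PiE_def\<close>)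
    ultimately show "f \<in> ?h ` (partition_box N M \<times> {\<pi>. \<pi> permutes {0..<N}})"
      using permutes_inv[OF p] by (intro image_eqI[of _ _ "(mu, inv_into UNIV p)"]) auto
  qed
qed

lemma finite_partition_box: "finite (partition_box N M)"
proof -
  have "partition_box N M \<subseteq> {mu. \<forall>i. (i \<in> {..<N} \<longrightarrow> mu i \<in> {..M}) \<and> (i \<notin> {..<N} \<longrightarrow> mu i = 0)}"
  proof clarify
    fix mu i assume mu: "mu \<in> partition_box N M"
    show "(i \<in> {..<N} \<longrightarrow> mu i \<in> {..M}) \<and> (i \<notin> {..<N} \<longrightarrow> mu i = 0)"
    proof (cases "i < N")
      case True
      with mu have "beta_set N mu i < M" by (simp add: partition_box_def)
      with True show ?thesis by (simp add: beta_set_def)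
    qed (use mu in \<open>auto simp: partition_box_def\<close>)
  qed
  moreover have "finite \<dots>" by (rule finite_set_of_finite_funs) auto
  ultimately show ?thesis by (rule finite_subset)
qed

text \<open>Multilinear expansion in the rows; choices with a repetition give two equal rows, and
  the injective ones are grouped by their underlying index set, the permutations reassembling the
  determinant of the first factor.\<close>

theorem cauchy_binet_partitions:
  fixes A B :: "nat \<Rightarrow> nat \<Rightarrow> 'b::comm_ring_1"
  shows "Determinant.det (mat N N (\<lambda>(i, j). \<Sum>m<M. A i m * B m j))
    = (\<Sum>mu\<in>partition_box N M. Determinant.det (mat N N (\<lambda>(i, k). A i (beta_set N mu k)))
        * Determinant.det (mat N N (\<lambda>(k, j). B (beta_set N mu k) j)))"
proof -
  define D where "D = (\<lambda>f. Determinant.det (mat N N (\<lambda>(i, j). B (f i) j)))"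
  let ?X = "PiE {0..<N} (\<lambda>_. {..<M})" and ?P = "{\<pi>. \<pi> permutes {0..<N}}"
  let ?t = "\<lambda>f. (\<Prod>i=0..<N. A i (f i)) * D f"
  have "Determinant.det (mat N N (\<lambda>(i, j). \<Sum>m<M. A i m * B m j))
      = (\<Sum>\<pi>\<in>?P. signof \<pi> * (\<Sum>f\<in>?X. \<Prod>i=0..<N. A i (f i) * B (f i) (\<pi> i)))"
    unfolding det_mat_leibniz by (subst prod_sum_PiE) auto
  also have "\<dots> = (\<Sum>f\<in>?X. \<Sum>\<pi>\<in>?P. (\<Prod>i=0..<N. A i (f i)) * (signof \<pi> * (\<Prod>i=0..<N. B (f i) (\<pi> i))))"
    unfolding sum_distrib_left by (subst sum.swap) (simp add: prod.distrib ac_simps)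
  also have "\<dots> = (\<Sum>f\<in>?X. ?t f)"
    by (simp add: D_def det_mat_leibniz sum_distrib_left)
  also have "\<dots> = (\<Sum>f\<in>{f \<in> ?X. inj_on f {0..<N}}. ?t f)"
  proof (rule sum.mono_neutral_right)
    show "\<forall>f\<in>?X - {f \<in> ?X. inj_on f {0..<N}}. ?t f = 0"
    proof
      fix f assume "f \<in> ?X - {f \<in> ?X. inj_on f {0..<N}}"
      then obtain i j where ij: "i < N" "j < N" "i \<noteq> j" "f i = f j" by (auto simp: inj_on_def)
      have "D f = 0" unfolding D_def
        by (rule det_identical_rows[of _ N i j]) (use ij in \<open>auto intro!: eq_vecI\<close>)
      then show "?t f = 0" by simp
    qed
  qed (auto intro: finite_PiE)
  also have "\<dots> = (\<Sum>x\<in>partition_box N M \<times> ?P. ?t ((\<lambda>(mu, \<pi>). \<lambda>i\<in>{0..<N}. beta_set N mu (\<pi> i)) x))"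
    by (rule sum.reindex_bij_betw[OF bij_betw_beta_sets, symmetric])
  also have "\<dots> = (\<Sum>mu\<in>partition_box N M. \<Sum>\<pi>\<in>?P. ?t (\<lambda>i\<in>{0..<N}. beta_set N mu (\<pi> i)))"
    by (simp add: sum.cartesian_product split_def)
  also have "\<dots> = (\<Sum>mu\<in>partition_box N M. \<Sum>\<pi>\<in>?P. signof \<pi> * (\<Prod>i=0..<N. A i (beta_set N mu (\<pi> i))) * D (beta_set N mu))"
  proof (intro sum.cong refl)
    fix mu \<pi> assume "\<pi> \<in> ?P"
    then have \<pi>: "\<pi> permutes {0..<N}" by simp
    have "mat N N (\<lambda>(i, j). B ((\<lambda>i\<in>{0..<N}. beta_set N mu (\<pi> i)) i) j)
       = mat N N (\<lambda>(i, j). mat N N (\<lambda>(i, j). B (beta_set N mu i) j) $$ (\<pi> i, j))"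
      by (rule eq_matI) (auto simp: permutes_lessThan_less[OF \<pi>])
    then have "D (\<lambda>i\<in>{0..<N}. beta_set N mu (\<pi> i)) = signof \<pi> * D (beta_set N mu)"
      unfolding D_def by (simp only: det_permute_rows[OF _ \<pi>] mat_carrier)
    then show "?t (\<lambda>i\<in>{0..<N}. beta_set N mu (\<pi> i))
       = signof \<pi> * (\<Prod>i=0..<N. A i (beta_set N mu (\<pi> i))) * D (beta_set N mu)"
      by (simp add: ac_simps)
  qed
  finally show ?thesis
    unfolding D_def det_mat_leibniz[of N "\<lambda>i k. A i (beta_set N _ k)"] sum_distrib_right .
qed

lemma det_scale_rows_cols:
  fixes G :: "nat \<Rightarrow> nat \<Rightarrow> 'b::comm_ring_1"
  shows "Determinant.det (mat N N (\<lambda>(i, k). r i * c k * G i k))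
    = (\<Prod>i<N. r i) * (\<Prod>k<N. c k) * Determinant.det (mat N N (\<lambda>(i, k). G i k))"
proof -
  have "signof p * (\<Prod>i = 0..<N. r i * c (p i) * G i (p i))
     = (\<Prod>i<N. r i) * (\<Prod>k<N. c k) * (signof p * (\<Prod>i = 0..<N. G i (p i)))" if "p permutes {0..<N}" for p
    using prod.permute[OF that, of c] by (simp add: prod.distrib atLeast0LessThan comp_def ac_simps)
  then show ?thesis unfolding det_mat_leibniz sum_distrib_left by (intro sum.cong) auto
qed

section \<open>The coefficients sigma as determinants of univariate expansion coefficients\<close>

lemma sigma_entry_zero:
  "int (lam j) - int j - int (mu k) + int k < 0 \<Longrightarrow> sigma_qR_entry lam mu q s0 s1 s2 s3 j k = 0"
  by (simp add: sigma_qR_entry_def Let_def)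

lemma sigma_entry_one:
  "int (lam j) - int j - int (mu k) + int k = 0 \<Longrightarrow> sigma_qR_entry lam mu q s0 s1 s2 s3 j k = 1"
  by (simp add: sigma_qR_entry_def Let_def qpoch_def)

lemma sigma_det_stable:
  assumes lam: "is_partition lam" and mu: "mu \<le> lam" and N: "plen lam \<le> N"
  shows "Determinant.det (mat N N (\<lambda>(j, k). sigma_qR_entry lam mu q s0 s1 s2 s3 j k))
    = Determinant.det (mat (plen lam) (plen lam) (\<lambda>(j, k). sigma_qR_entry lam mu q s0 s1 s2 s3 j k))"
proof (rule det_unitriangular_tail[OF N])
  fix i assume i: "plen lam \<le> i"
  then have l: "lam i = 0" using partition_eq_0_iff[OF lam] by simp
  then have "mu i = 0" using le_funD[OF mu, of i] by simp
  with l show "sigma_qR_entry lam mu q s0 s1 s2 s3 i i = 1" by (intro sigma_entry_one) simp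
  show "sigma_qR_entry lam mu q s0 s1 s2 s3 i k = 0" if "k < i" for k
    using that l by (intro sigma_entry_zero) simp
qed

lemma sigma_qR_diag:
  assumes lam: "is_partition lam" and "s0 \<noteq> 0"
  shows "sigma_qR lam lam q s0 s1 s2 s3 = 1"
proof -
  have "Determinant.det (mat (plen lam) (plen lam) (\<lambda>(j, k). sigma_qR_entry lam lam q s0 s1 s2 s3 j k))
     = Determinant.det (mat 0 0 (\<lambda>(j, k). sigma_qR_entry lam lam q s0 s1 s2 s3 j k))"
  proof (rule det_unitriangular_tail)
    show "sigma_qR_entry lam lam q s0 s1 s2 s3 i k = 0" if "k < i" for i k
    proof (rule sigma_entry_zero)
      have "lam i \<le> lam k" using lam that by (auto simp: is_partition_def antimono_def)
      then show "int (lam i) - int i - int (lam k) + int k < 0" using that by simp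
    qed
  qed (auto intro: sigma_entry_one)
  then show ?thesis by (simp add: sigma_qR_def)
qed

text \<open>If lam_k < mu_k, no permutation sends all rows from k on to columns beyond k. Some row i
  \<ge> k therefore meets a column p i \<le> k, and there lam_i \<le> lam_k < mu_k \<le> mu_(p i)
  makes the index difference negative. This confines the Cauchy-Binet sum to diagrams inside
  \<open>lam\<close>.\<close>

lemma sigma_det_zero:
  assumes lam: "is_partition lam" and mu: "is_partition mu" "\<And>i. N \<le> i \<Longrightarrow> mu i = 0" "\<not> mu \<le> lam"
  shows "Determinant.det (mat N N (\<lambda>(j, k). sigma_qR_entry lam mu q s0 s1 s2 s3 j k)) = 0"
proof -
  obtain k where k: "lam k < mu k" using mu(3) by (auto simp: le_fun_def not_le)
  then have kN: "k < N" using mu(2)[of k] by (cases "k < N") auto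
  have "signof p * (\<Prod>i = 0..<N. sigma_qR_entry lam mu q s0 s1 s2 s3 i (p i)) = 0" if p: "p permutes {0..<N}" for p
  proof -
    have "\<exists>i\<in>{k..<N}. p i \<le> k"
    proof (rule ccontr)
      assume "\<not> ?thesis"
      then have "p ` {k..<N} \<subseteq> {Suc k..<N}" using permutes_lessThan_less[OF p] by (auto simp: not_le Suc_le_eq)
      moreover have "inj_on p {k..<N}" using permutes_inj[OF p] by (rule inj_on_subset) simp
      ultimately have "card {k..<N} \<le> card {Suc k..<N}" by (intro card_inj_on_le) auto
      then show False using kN by simp
    qed
    then obtain i where i: "k \<le> i" "i < N" "p i \<le> k" by auto
    have "lam i \<le> lam k" "mu k \<le> mu (p i)" using i lam mu(1) by (auto simp: is_partition_def antimono_def)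
    then have "sigma_qR_entry lam mu q s0 s1 s2 s3 i (p i) = 0" using i k by (intro sigma_entry_zero) simp
    then show ?thesis using i by (auto intro!: prod_zero)
  qed
  then show ?thesis unfolding det_mat_leibniz by (intro sum.neutral) auto
qed

text \<open>Coefficients of the monic q-Racah polynomial of degree \<open>n\<close> in the node
  products of \<open>s0\<close>. At shifted parts they are entries of the sigma matrix up to row and
  column factors. The final quotient of q-factorials completes a q-binomial coefficient, which
  orthogonality requires, and is the origin of \<open>qfact_ratio\<close>.\<close>

definition racah_coeff :: "complex \<Rightarrow> complex \<Rightarrow> complex \<Rightarrow> complex \<Rightarrow> complex \<Rightarrow> nat \<Rightarrow> nat \<Rightarrow> nat \<Rightarrow> complex" where
  "racah_coeff q s0 s1 s2 s3 N n m =
    (if n < m then 0 else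
      s0 powi (int m - int n) *
      ((qpoch (- s0 * s1 * q powi (int m - int N + 1)) q (n - m) * qpoch (- s0 * s2 * q powi (int m - int N + 1)) q (n - m)
          * qpoch (- s0 * s3 * q powi (int m - int N + 1)) q (n - m))
        / (q powi ((int m - int N + 1) * (int n - int m)) * (qpoch q q (n - m)
          * qpoch (s0 * s1 * s2 * s3 * q powi (int n + int m + 1 - 2 * int N)) q (n - m))))
      * (qpoch q q n / qpoch q q m))"

definition racah_poly :: "complex \<Rightarrow> complex \<Rightarrow> complex \<Rightarrow> complex \<Rightarrow> complex \<Rightarrow> nat \<Rightarrow> nat \<Rightarrow> complex \<Rightarrow> complex" where
  "racah_poly q s0 s1 s2 s3 N n x = (\<Sum>m\<le>n. racah_coeff q s0 s1 s2 s3 N n m * (\<Prod>l<m. x - qnode q s0 N l))"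

lemma racah_coeff_beta_set:
  assumes "s0 \<noteq> 0" "j < N" "k < N"
  shows "racah_coeff q s0 s1 s2 s3 N (beta_set N lam j) (beta_set N mu k)
    = (s0 powi (- int (beta_set N lam j)) * qpoch q q (beta_set N lam j))
      * (s0 powi (int (beta_set N mu k)) / qpoch q q (beta_set N mu k))
      * sigma_qR_entry lam mu q s0 s1 s2 s3 j k"
proof -
  let ?n = "beta_set N lam j" and ?m = "beta_set N mu k"
  have d: "int (lam j) - int j - int (mu k) + int k = int ?n - int ?m"
    and e: "int (mu k) - int k = int ?m - int N + 1"
    and f: "int (lam j) + int (mu k) - 1 - int j - int k = int ?n + int ?m + 1 - 2 * int N"
    using assms(2,3) by (auto simp: beta_set_def)
  show ?thesis
  proof (cases "?n < ?m")
    case True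
    then show ?thesis using d by (simp add: racah_coeff_def sigma_entry_zero)
  next
    case False
    then have n: "nat (int ?n - int ?m) = ?n - ?m" "\<not> int ?n - int ?m < 0" by auto
    have "s0 powi (int ?m - int ?n) = s0 powi (- int ?n) * s0 powi (int ?m)"
      unfolding power_int_add[OF disjI1[OF assms(1)], symmetric] by (rule arg_cong[where f = "power_int s0"]) simp
    with False show ?thesis
      unfolding racah_coeff_def sigma_qR_entry_def Let_def d e f n
      by (simp add: ac_simps)
  qed
qed

definition qfact_ratio :: "complex \<Rightarrow> nat \<Rightarrow> (nat \<Rightarrow> nat) \<Rightarrow> (nat \<Rightarrow> nat) \<Rightarrow> complex" where
  "qfact_ratio q N lam mu = (\<Prod>j<N. qpoch q q (beta_set N lam j)) / (\<Prod>j<N. qpoch q q (beta_set N mu j))"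

lemma psize_eq_sum:
  assumes "\<And>i. N \<le> i \<Longrightarrow> mu i = 0"
  shows "psize mu = (\<Sum>i<N. mu i)"
  unfolding psize_def
proof (rule sum.mono_neutral_left)
  show "{i. mu i \<noteq> 0} \<subseteq> {..<N}" using assms by (metis (mono_tags) lessThan_iff mem_Collect_eq not_le subsetI)
qed auto

lemma prod_powi: "s \<noteq> 0 \<Longrightarrow> (\<Prod>i\<in>I. s powi f i) = (s :: complex) powi (\<Sum>i\<in>I. f i)"
  by (induction I rule: infinite_finite_induct) (auto simp: power_int_add)

lemma det_racah_coeff:
  assumes lam: "is_partition lam" "plen lam \<le> N" and mu: "is_partition mu" "\<And>i. N \<le> i \<Longrightarrow> mu i = 0" and s0: "s0 \<noteq> 0"
  shows "Determinant.det (mat N N (\<lambda>(j, k). racah_coeff q s0 s1 s2 s3 N (beta_set N lam j) (beta_set N mu k)))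
    = (if mu \<le> lam then sigma_qR lam mu q s0 s1 s2 s3 * qfact_ratio q N lam mu else 0)"
proof -
  let ?r = "\<lambda>j. s0 powi (- int (beta_set N lam j)) * qpoch q q (beta_set N lam j)"
  let ?c = "\<lambda>k. s0 powi (int (beta_set N mu k)) / qpoch q q (beta_set N mu k)"
  let ?E = "sigma_qR_entry lam mu q s0 s1 s2 s3"
  have lam0: "lam i = 0" if "N \<le> i" for i using that lam(2) partition_eq_0_iff[OF lam(1), of i] by simp
  have "mat N N (\<lambda>(j, k). racah_coeff q s0 s1 s2 s3 N (beta_set N lam j) (beta_set N mu k))
      = mat N N (\<lambda>(j, k). ?r j * ?c k * ?E j k)"
    by (rule eq_matI) (auto simp: racah_coeff_beta_set[OF s0])
  then have det: "Determinant.det (mat N N (\<lambda>(j, k). racah_coeff q s0 s1 s2 s3 N (beta_set N lam j) (beta_set N mu k)))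
      = (\<Prod>i<N. ?r i) * (\<Prod>k<N. ?c k) * Determinant.det (mat N N (\<lambda>(j, k). ?E j k))"
    by (simp only: det_scale_rows_cols)
  show ?thesis
  proof (cases "mu \<le> lam")
    case False
    then show ?thesis unfolding det by (simp add: sigma_det_zero[OF lam(1) mu])
  next
    case True
    have "(\<Sum>i<N. int (beta_set N mu i)) - (\<Sum>i<N. int (beta_set N lam i)) = (\<Sum>i<N. int (mu i)) - (\<Sum>i<N. int (lam i))"
      by (simp only: beta_set_def of_nat_add sum.distrib)
    also have "\<dots> = int (psize mu) - int (psize lam)"
      by (simp add: psize_eq_sum[OF lam0] psize_eq_sum[OF mu(2)])
    finally have ex: "(\<Sum>i<N. int (beta_set N mu i)) - (\<Sum>i<N. int (beta_set N lam i)) = int (psize mu) - int (psize lam)" .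
    have "(\<Prod>i<N. ?r i) * (\<Prod>k<N. ?c k)
       = (s0 powi (- (\<Sum>i<N. int (beta_set N lam i))) * s0 powi (\<Sum>i<N. int (beta_set N mu i))) * qfact_ratio q N lam mu"
      by (simp only: prod.distrib prod_dividef prod_powi[OF s0] qfact_ratio_def sum_negf) (simp only: times_divide_eq_left times_divide_eq_right ac_simps)
    also have "s0 powi (- (\<Sum>i<N. int (beta_set N lam i))) * s0 powi (\<Sum>i<N. int (beta_set N mu i)) = s0 powi (int (psize mu) - int (psize lam))"
      unfolding power_int_add[OF disjI1[OF s0], symmetric] ex[symmetric] by simp
    finally show ?thesis unfolding det using True
      by (simp add: sigma_det_stable[OF lam(1) True lam(2)] sigma_qR_def)
  qed
qed

theorem det_racah_poly:
  fixes x :: "nat \<Rightarrow> complex"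
  assumes lam: "is_partition lam" "plen lam \<le> N" and s0: "s0 \<noteq> 0"
  shows "Determinant.det (mat N N (\<lambda>(i, j). racah_poly q s0 s1 s2 s3 N (beta_set N lam i) (x j)))
    = (\<Sum>mu | is_partition mu \<and> mu \<le> lam. sigma_qR lam mu q s0 s1 s2 s3 * qfact_ratio q N lam mu
        * Determinant.det (mat N N (\<lambda>(k, j). \<Prod>l<beta_set N mu k. x j - qnode q s0 N l)))"
proof -
  \<comment> \<open>Larger than every shifted part of \<open>lam\<close>, so no term of the
    expansions is cut off.\<close>
  let ?M = "lam 0 + N"
  let ?f = "\<lambda>m j. \<Prod>l<m. x j - qnode q s0 N l"
  let ?A = "\<lambda>i m. racah_coeff q s0 s1 s2 s3 N (beta_set N lam i) m"
  have lam0: "lam i = 0" if "N \<le> i" for i using that lam(2) partition_eq_0_iff[OF lam(1), of i] by simp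
  have lam_le: "lam i \<le> lam 0" for i using lam(1) by (auto simp: is_partition_def antimono_def)
  have "racah_poly q s0 s1 s2 s3 N (beta_set N lam i) (x j) = (\<Sum>m<?M. ?A i m * ?f m j)" if "i < N" for i j
    unfolding racah_poly_def
  proof (rule sum.mono_neutral_left)
    show "{..beta_set N lam i} \<subseteq> {..<?M}" using lam_le[of i] that by (auto simp: beta_set_def)
  qed (auto simp: racah_coeff_def)
  then have "mat N N (\<lambda>(i, j). racah_poly q s0 s1 s2 s3 N (beta_set N lam i) (x j)) = mat N N (\<lambda>(i, j). \<Sum>m<?M. ?A i m * ?f m j)"
    by (intro eq_matI) auto
  then have "Determinant.det (mat N N (\<lambda>(i, j). racah_poly q s0 s1 s2 s3 N (beta_set N lam i) (x j)))
     = (\<Sum>mu\<in>partition_box N ?M. Determinant.det (mat N N (\<lambda>(i, k). ?A i (beta_set N mu k)))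
         * Determinant.det (mat N N (\<lambda>(k, j). ?f (beta_set N mu k) j)))"
    by (simp only: cauchy_binet_partitions)
  also have "\<dots> = (\<Sum>mu\<in>partition_box N ?M. (if mu \<le> lam then sigma_qR lam mu q s0 s1 s2 s3 * qfact_ratio q N lam mu else 0)
         * Determinant.det (mat N N (\<lambda>(k, j). ?f (beta_set N mu k) j)))"
    by (intro sum.cong refl arg_cong2[of _ _ _ _ "(*)"] det_racah_coeff[OF lam _ _ s0]) (auto simp: partition_box_def)
  also have "\<dots> = (\<Sum>mu | is_partition mu \<and> mu \<le> lam. sigma_qR lam mu q s0 s1 s2 s3 * qfact_ratio q N lam mu
        * Determinant.det (mat N N (\<lambda>(k, j). ?f (beta_set N mu k) j)))"
  proof (rule sum.mono_neutral_cong_right)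
    show "{mu. is_partition mu \<and> mu \<le> lam} \<subseteq> partition_box N ?M"
    proof clarify
      fix mu assume mu: "is_partition mu" "mu \<le> lam"
      have le: "mu i \<le> lam i" for i using mu(2) by (rule le_funD)
      have "mu i = 0" if "N \<le> i" for i using le[of i] lam0[OF that] by simp
      moreover have "beta_set N mu k < ?M" if "k < N" for k
        using le[of k] lam_le[of k] that by (auto simp: beta_set_def)
      ultimately show "mu \<in> partition_box N ?M" using mu by (simp add: partition_box_def)
    qed
  qed (simp add: finite_partition_box, auto simp: partition_box_def)
  finally show ?thesis .
qed

lemma qpoch_self_nonzero:
  assumes "0 < q" "q < 1"
  shows "qpoch (complex_of_real q) (of_real q) n \<noteq> 0"
proof -
  have "1 - complex_of_real q * of_real q ^ k \<noteq> 0" for k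
  proof -
    have "q * q ^ k < 1" using assms power_Suc_less_one[of q k] by simp
    then have "complex_of_real (1 - q * q ^ k) \<noteq> 0" by (subst of_real_eq_0_iff) simp
    then show ?thesis by simp
  qed
  then show ?thesis by (simp add: qpoch_def)
qed

lemma qpoch_add: "qpoch x q (m + n) = qpoch x q m * qpoch (x * q ^ m) q n"
  by (induction n) (simp_all add: qpoch_def power_add ac_simps)

text \<open>Only rows below the length of \<open>lam\<close> contribute, each by lam_j - mu_j
  factors 1 - q^e whose exponents e grow with N.\<close>

lemma qfact_ratio_tendsto:
  assumes q: "0 < q" "q < 1" and lam: "is_partition lam" and mu: "mu \<le> lam"
  shows "(\<lambda>N. qfact_ratio (of_real q) N lam mu) \<longlonglongrightarrow> 1"
proof -
  let ?q = "complex_of_real q" and ?n = "plen lam"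
  let ?g = "\<lambda>N j. qpoch (?q * ?q ^ beta_set N mu j) ?q (lam j - mu j)"
  have le: "mu j \<le> lam j" for j using mu by (rule le_funD)
  have ratio: "qpoch ?q ?q (beta_set N lam j) / qpoch ?q ?q (beta_set N mu j) = ?g N j" for N j
  proof -
    have "beta_set N lam j = beta_set N mu j + (lam j - mu j)" using le[of j] by (simp add: beta_set_def)
    then show ?thesis using qpoch_self_nonzero[OF q] by (simp add: qpoch_add)
  qed
  have "\<forall>\<^sub>F N in sequentially. qfact_ratio ?q N lam mu = (\<Prod>j<?n. ?g N j)"
    using eventually_ge_at_top[of ?n]
  proof eventually_elim
    case (elim N)
    have "qfact_ratio ?q N lam mu = (\<Prod>j<N. ?g N j)"
      by (simp add: qfact_ratio_def prod_dividef[symmetric] ratio)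
    also have "\<dots> = (\<Prod>j<?n. ?g N j)"
    proof (rule prod.mono_neutral_right)
      show "\<forall>j\<in>{..<N} - {..<?n}. ?g N j = 1"
        using partition_eq_0_iff[OF lam, THEN iffD2] by (auto simp: qpoch_def)
    qed (use elim in auto)
    finally show ?case .
  qed
  moreover have "(\<lambda>N. \<Prod>j<?n. ?g N j) \<longlonglongrightarrow> (\<Prod>j<?n. \<Prod>k<lam j - mu j. 1 - ?q * 0 * ?q ^ k)"
    unfolding qpoch_def
  proof (intro tendsto_prod tendsto_diff tendsto_mult tendsto_const)
    fix j
    have "filterlim (\<lambda>N. beta_set N mu j) sequentially sequentially"
    proof (rule filterlim_at_top_mono)
      show "filterlim (\<lambda>N. N - (1 + j)) sequentially sequentially" by (rule filterlim_minus_const_nat_at_top)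
    qed (auto simp: beta_set_def)
    moreover have "(\<lambda>m. ?q ^ m) \<longlonglongrightarrow> 0" using q by (intro LIMSEQ_power_zero) simp
    ultimately show "(\<lambda>N. ?q ^ beta_set N mu j) \<longlonglongrightarrow> 0" by (rule filterlim_compose[rotated])
  qed
  ultimately show ?thesis by (simp add: tendsto_cong)
qed

section \<open>Orthogonality of the q-Racah polynomials\<close>

text \<open>The signed Gaussian binomial coefficient, that is, the coefficient of z^m in (z;
  q)_n.\<close>

definition gauss_coeff :: "complex \<Rightarrow> nat \<Rightarrow> nat \<Rightarrow> complex" where
  "gauss_coeff q n m = (if m \<le> n then (- 1) ^ m * q ^ (m choose 2) * qpoch q q n / (qpoch q q m * qpoch q q (n - m)) else 0)"

lemma qpoch_0 [simp]: "qpoch x q 0 = 1"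
  by (simp add: qpoch_def)

lemma qpoch_Suc: "qpoch x q (Suc n) = qpoch x q n * (1 - x * q ^ n)"
  by (simp add: qpoch_def)

lemma gauss_coeff_pascal:
  assumes nz: "\<And>n. qpoch q q n \<noteq> 0"
  shows "gauss_coeff q (Suc n) (Suc m) = gauss_coeff q n (Suc m) - q ^ n * gauss_coeff q n m"
proof -
  have choose: "Suc m choose 2 = (m choose 2) + m" by (simp add: numeral_2_eq_2)
  have nz1: "1 - q * q ^ n \<noteq> 0" for n using nz[of "Suc n"] by (simp add: qpoch_Suc)
  consider "m < n" | "m = n" | "n < m" by linarith
  then show ?thesis
  proof cases
    case 1
    then obtain d where d: "n = Suc (m + d)" by (metis less_iff_Suc_add)
    have "gauss_coeff q (Suc n) (Suc m) = (- 1) ^ Suc m * q ^ (m choose 2) * q ^ m * qpoch q q n * (1 - q * q ^ n)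
        / (qpoch q q m * (1 - q * q ^ m) * (qpoch q q d * (1 - q * q ^ d)))"
      by (simp add: gauss_coeff_def d choose power_add qpoch_Suc ac_simps)
    moreover have "gauss_coeff q n (Suc m) = (- 1) ^ Suc m * q ^ (m choose 2) * q ^ m * qpoch q q n
        / (qpoch q q m * (1 - q * q ^ m) * qpoch q q d)"
      by (simp add: gauss_coeff_def d choose power_add qpoch_Suc ac_simps)
    moreover have "q ^ n * gauss_coeff q n m = (- 1) ^ m * q ^ (m choose 2) * q ^ n * qpoch q q n
        / (qpoch q q m * (qpoch q q d * (1 - q * q ^ d)))"
      by (simp add: gauss_coeff_def d qpoch_Suc ac_simps)
    moreover have "q ^ n = q * q ^ m * q ^ d" by (simp add: d power_add)
    ultimately show ?thesis
      using nz[of m] nz[of d] nz1[of m] nz1[of d]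
      by (simp only:) (simp add: divide_simps, simp add: algebra_simps)
  next
    case 2
    then have "Suc n choose 2 = (n choose 2) + n" using choose by simp
    then show ?thesis using 2 nz[of n] nz[of "Suc n"]
      by (simp add: gauss_coeff_def power_add)
  qed (simp add: gauss_coeff_def)
qed

lemma gauss_binomial_theorem:
  assumes nz: "\<And>n. qpoch q q n \<noteq> 0"
  shows "(\<Sum>m\<le>n. gauss_coeff q n m * z ^ m) = (\<Prod>i<n. 1 - z * q ^ i)"
proof (induction n)
  case 0
  then show ?case by (simp add: gauss_coeff_def numeral_2_eq_2)
next
  case (Suc n)
  have 0: "gauss_coeff q n 0 = 1" for n using nz[of n] by (simp add: gauss_coeff_def numeral_2_eq_2)
  have "(\<Sum>m\<le>Suc n. gauss_coeff q (Suc n) m * z ^ m)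
     = 1 + (\<Sum>m\<le>n. (gauss_coeff q n (Suc m) - q ^ n * gauss_coeff q n m) * z ^ Suc m)"
    unfolding sum.atMost_Suc_shift 0 gauss_coeff_pascal[OF nz] by simp
  also have "\<dots> = (gauss_coeff q n 0 * z ^ 0 + (\<Sum>m\<le>n. gauss_coeff q n (Suc m) * z ^ Suc m)) - z * q ^ n * (\<Sum>m\<le>n. gauss_coeff q n m * z ^ m)"
    by (simp add: 0 sum_distrib_left sum_subtractf algebra_simps)
  also have "gauss_coeff q n 0 * z ^ 0 + (\<Sum>m\<le>n. gauss_coeff q n (Suc m) * z ^ Suc m) = (\<Sum>m\<le>Suc n. gauss_coeff q n m * z ^ m)"
    by (rule sum.atMost_Suc_shift[symmetric])
  also have "\<dots> = (\<Sum>m\<le>n. gauss_coeff q n m * z ^ m)"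
    by (simp add: gauss_coeff_def)
  finally have step: "(\<Sum>m\<le>Suc n. gauss_coeff q (Suc n) m * z ^ m)
     = (\<Sum>m\<le>n. gauss_coeff q n m * z ^ m) - z * q ^ n * (\<Sum>m\<le>n. gauss_coeff q n m * z ^ m)" .
  show ?case unfolding step Suc.IH prod.lessThan_Suc by (simp add: algebra_simps)
qed

text \<open>A q-analogue of the fact that n-th differences annihilate polynomials of degree below n:
  on the monomial of degree j the sum is (q^(j-n+1); q)_n, which contains the factor 1 -
  q^0.\<close>

lemma gauss_sum_poly_zero:
  assumes nz: "\<And>n. qpoch q q n \<noteq> 0" and q: "q \<noteq> 0" and p: "degree p < n"
  shows "(\<Sum>m\<le>n. gauss_coeff q n m / (q ^ (n - 1)) ^ m * poly p (q ^ m)) = 0"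
proof -
  have "(\<Sum>m\<le>n. gauss_coeff q n m / (q ^ (n - 1)) ^ m * poly p (q ^ m))
     = (\<Sum>j\<le>degree p. coeff p j * (\<Sum>m\<le>n. gauss_coeff q n m * (q ^ j / q ^ (n - 1)) ^ m))"
    unfolding poly_altdef sum_distrib_left
    by (subst sum.swap) (simp add: power_divide power_mult[symmetric] ac_simps)
  also have "\<dots> = 0"
  proof (intro sum.neutral ballI)
    fix j assume "j \<in> {..degree p}"
    with p have j: "j < n" by simp
    have "(\<Prod>i<n. 1 - q ^ j / q ^ (n - 1) * q ^ i) = 0"
    proof (rule prod_zero)
      have "q ^ (n - 1) = q ^ j * q ^ (n - 1 - j)" using j by (simp add: power_add[symmetric])
      then show "\<exists>i\<in>{..<n}. 1 - q ^ j / q ^ (n - 1) * q ^ i = 0"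
        using j q by (intro bexI[of _ "n - 1 - j"]) auto
    qed simp
    then show "coeff p j * (\<Sum>m\<le>n. gauss_coeff q n m * (q ^ j / q ^ (n - 1)) ^ m) = 0"
      by (simp add: gauss_binomial_theorem[OF nz])
  qed
  finally show ?thesis .
qed

definition qpoch_poly :: "complex \<Rightarrow> complex \<Rightarrow> nat \<Rightarrow> complex poly" where
  "qpoch_poly a q n = (\<Prod>k<n. [:1, - (a * q ^ k):])"

lemma poly_qpoch_poly: "poly (qpoch_poly a q n) x = qpoch (a * x) q n"
  by (simp add: qpoch_poly_def qpoch_def poly_prod ac_simps)

lemma degree_qpoch_poly: "degree (qpoch_poly a q n) \<le> n"
proof -
  have "degree (qpoch_poly a q n) \<le> (\<Sum>k<n. degree [:1, - (a * q ^ k):])"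
    unfolding qpoch_poly_def using degree_prod_sum_le[of "{..<n}" "\<lambda>k. [:1, - (a * q ^ k):]"]
    by (simp add: comp_def)
  also have "\<dots> \<le> (\<Sum>k<n. 1)" by (intro sum_mono) (simp add: degree_pCons_le)
  finally show ?thesis by simp
qed

text \<open>The first-order recursion of the q-Racah weight on nodes y - T/y with y(k+1) = q y(k),
  cleared of denominators. It is symmetric in the four parameters, which lets any of them be shifted
  by the same argument.\<close>

definition pearson :: "nat \<Rightarrow> complex \<Rightarrow> complex \<Rightarrow> (nat \<Rightarrow> complex) \<Rightarrow> complex \<Rightarrow> complex \<Rightarrow> complex \<Rightarrow> complex \<Rightarrow> (nat \<Rightarrow> complex) \<Rightarrow> bool" where
  "pearson K q T y s0 s1 s2 s3 w \<longleftrightarrow> (\<forall>k<K.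
     w (Suc k) * (T + y k ^ 2) * T ^ 2 * ((s0 + q * y k) * (s1 + q * y k) * (s2 + q * y k) * (s3 + q * y k))
     = w k * q * (T + q ^ 2 * y k ^ 2) * ((T - s0 * y k) * (T - s1 * y k) * (T - s2 * y k) * (T - s3 * y k)))"

lemma pearson_swap: "pearson K q T y s0 s1 s2 s3 w \<longleftrightarrow> pearson K q T y s1 s0 s2 s3 w"
  unfolding pearson_def by (simp only: ac_simps)

text \<open>The algebra behind the telescoping: the right side is a difference of an outgoing and an
  incoming boundary term. The elementary symmetric functions of s1, s2, s3 are treated as
  independent unknowns to keep the expansion small.\<close>

lemma telescoping_identity:
  fixes s0 s1 s2 s3 T y :: complex
  shows "((s0 * (y * y - T) + (s0 * s0 - T) * y) * (T * T - s0 * s1 * s2 * s3) + y * ((T + s0 * s1) * (T + s0 * s2) * (T + s0 * s3))) * (T + y * y)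
    = - s0 * ((T - s0 * y) * (T - s1 * y) * (T - s2 * y) * (T - s3 * y) - T * T * ((s0 + y) * (s1 + y) * (s2 + y) * (s3 + y)))"
proof -
  let ?a = "s1 + s2 + s3" and ?b = "s1 * s2 + s1 * s3 + s2 * s3" and ?c = "s1 * s2 * s3"
  have 1: "(T - s0 * y) * (T - s1 * y) * (T - s2 * y) * (T - s3 * y) = (T - s0 * y) * (T * T * T - ?a * (T * T * y) + ?b * (T * y * y) - ?c * (y * y * y))"
    by (simp add: algebra_simps)
  have 2: "(s0 + y) * (s1 + y) * (s2 + y) * (s3 + y) = (s0 + y) * (?c + ?b * y + ?a * (y * y) + y * y * y)"
    by (simp add: algebra_simps)
  have 3: "(T + s0 * s1) * (T + s0 * s2) * (T + s0 * s3) = T * T * T + ?a * (s0 * T * T) + ?b * (s0 * s0 * T) + ?c * (s0 * s0 * s0)"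
    by (simp add: algebra_simps)
  have 4: "s0 * s1 * s2 * s3 = s0 * ?c" by (simp add: algebra_simps)
  have "((s0 * (y * y - T) + (s0 * s0 - T) * y) * (T * T - s0 * c) + y * (T * T * T + a * (s0 * T * T) + b * (s0 * s0 * T) + c * (s0 * s0 * s0))) * (T + y * y)
    = - s0 * ((T - s0 * y) * (T * T * T - a * (T * T * y) + b * (T * y * y) - c * (y * y * y)) - T * T * ((s0 + y) * (c + b * y + a * (y * y) + y * y * y)))"
    for a b c :: complex
    by (simp add: algebra_simps)
  then show ?thesis unfolding 1 2 3 4 .
qed

lemma add_frac_aux: "y \<noteq> 0 \<Longrightarrow> D \<noteq> 0 \<Longrightarrow> X / y * E + F = (X * E + y * F) * D / (y * D)" for y :: complex
  by (simp add: add_divide_distrib)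

lemma mult_frac_aux: "w * (- s * (n - t * d) / E) = - s * (w * n / E - t * w * d / E)" for w :: complex
  by (simp add: algebra_simps diff_divide_distrib)

lemma moment_step_aux:
  fixes a p t X M T R m :: complex
  assumes "a * p * t * X * M = - (T * t * R) * m" "t \<noteq> 0" "a \<noteq> 0" "p \<noteq> 0"
  shows "M * X = (- T / a) / p * R * m"
proof -
  have "t * (a * p * (X * M)) = t * (- T * R * m)" using assms(1) by (simp add: ac_simps)
  then have "a * p * (X * M) = - T * R * m" using assms(2) unfolding mult_cancel_left by blast
  then have "X * M = (- T * R * m) / (a * p)" using assms(3,4) by (subst eq_divide_eq) (simp add: ac_simps)
  then show ?thesis by (simp add: ac_simps)
qed

context
  fixes K :: nat and q T :: complex and y :: "nat \<Rightarrow> complex"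
  assumes q: "q \<noteq> 0" and T: "T \<noteq> 0" and y: "\<And>k. y k \<noteq> 0" "\<And>k. y (Suc k) = q * y k" "\<And>k. T + y k ^ 2 \<noteq> 0"
begin

text \<open>Multiplying the weight by the linear factor with root at the node of \<open>s0\<close> amounts to the shift of \<open>s0\<close> to
  \<open>s0 * q\<close>; this reduces all mixed moments to \<open>pearson_sum_zero\<close>, whose sum telescopes.\<close>

lemma pearson_shift:
  assumes P: "pearson K q T y s0 s1 s2 s3 w" and s0: "s0 \<noteq> 0"
  shows "pearson K q T y (s0 * q) s1 s2 s3 (\<lambda>k. w k * (y k - T / y k + s0 - T / s0))"
  unfolding pearson_def
proof (intro allI impI)
  fix k assume "k < K"
  let ?y = "y k"
  define A where "A = (T + ?y ^ 2) * T ^ 2 * ((s1 + q * ?y) * (s2 + q * ?y) * (s3 + q * ?y))"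
  define B where "B = q * (T + q ^ 2 * ?y ^ 2) * ((T - s1 * ?y) * (T - s2 * ?y) * (T - s3 * ?y))"
  have rec: "w (Suc k) * A * (s0 + q * ?y) = w k * B * (T - s0 * ?y)"
    using P \<open>k < K\<close> by (simp add: pearson_def A_def B_def ac_simps)
  have e1: "y (Suc k) - T / y (Suc k) + s0 - T / s0 = (q * ?y + s0) * (s0 * (q * ?y) - T) / (s0 * (q * ?y))"
    using y(1)[of k] q s0 by (simp add: y(2) field_simps)
  have e2: "?y - T / ?y + s0 - T / s0 = (?y + s0) * (s0 * ?y - T) / (s0 * ?y)"
    using y(1)[of k] s0 by (simp add: field_simps)
  have "w (Suc k) * (y (Suc k) - T / y (Suc k) + s0 - T / s0) * A * (s0 * q + q * ?y)
      = (w (Suc k) * A * (s0 + q * ?y)) * ((s0 * (q * ?y) - T) / (s0 * ?y)) * (s0 + ?y)"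
    unfolding e1 using q y(1)[of k] s0 by (simp add: field_simps)
  also have "\<dots> = w k * (?y - T / ?y + s0 - T / s0) * B * (T - s0 * q * ?y)"
    unfolding e2 rec using y(1)[of k] s0 by (simp add: field_simps)
  finally show "w (Suc k) * (y (Suc k) - T / y (Suc k) + s0 - T / s0) * (T + ?y ^ 2) * T ^ 2 *
      ((s0 * q + q * ?y) * (s1 + q * ?y) * (s2 + q * ?y) * (s3 + q * ?y))
      = w k * (?y - T / ?y + s0 - T / s0) * q * (T + q ^ 2 * ?y ^ 2) *
      ((T - s0 * q * ?y) * (T - s1 * ?y) * (T - s2 * ?y) * (T - s3 * ?y))"
    unfolding A_def B_def by (simp only: ac_simps)
qed

text \<open>The summand is a multiple of H k - G k, and the Pearson equation says G (k+1) = H k. The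
  two ends vanish separately: G 0 through the factor s2 + y_0, and H K through T - s3 y_K.\<close>

lemma pearson_sum_zero:
  assumes P: "pearson K q T y s0 s1 s2 s3 w" and s0: "s0 \<noteq> 0" and s2: "s2 = - y 0" and s3: "s3 * y K = T"
  shows "s0 * (T ^ 2 - s0 * s1 * s2 * s3) * (\<Sum>k\<le>K. w k * (y k - T / y k + s0 - T / s0))
    = - ((T + s0 * s1) * (T + s0 * s2) * (T + s0 * s3)) * (\<Sum>k\<le>K. w k)"
proof -
  let ?n = "\<lambda>k. (T - s0 * y k) * (T - s1 * y k) * (T - s2 * y k) * (T - s3 * y k)"
  let ?d = "\<lambda>k. (s0 + y k) * (s1 + y k) * (s2 + y k) * (s3 + y k)"
  define H where "H = (\<lambda>k. w k * ?n k / (y k * (T + y k ^ 2)))"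
  define G where "G = (\<lambda>k. T ^ 2 * w k * ?d k / (y k * (T + y k ^ 2)))"
  have c: "w k * (s0 * (y k - T / y k + s0 - T / s0) * (T ^ 2 - s0 * s1 * s2 * s3) + (T + s0 * s1) * (T + s0 * s2) * (T + s0 * s3))
      = - s0 * (H k - G k)" for k
  proof -
    have e: "s0 * (y k - T / y k + s0 - T / s0) = (s0 * (y k * y k - T) + (s0 * s0 - T) * y k) / y k"
      using y(1)[of k] s0 by (simp add: field_simps)
    have "s0 * (y k - T / y k + s0 - T / s0) * (T ^ 2 - s0 * s1 * s2 * s3) + (T + s0 * s1) * (T + s0 * s2) * (T + s0 * s3)
       = ((s0 * (y k * y k - T) + (s0 * s0 - T) * y k) * (T * T - s0 * s1 * s2 * s3) + y k * ((T + s0 * s1) * (T + s0 * s2) * (T + s0 * s3))) * (T + y k * y k)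
           / (y k * (T + y k * y k))"
      unfolding e using y(1)[of k] y(3)[of k] unfolding power2_eq_square by (rule add_frac_aux)
    also have "\<dots> = - s0 * (?n k - T * T * ?d k) / (y k * (T + y k * y k))"
      by (simp only: telescoping_identity)
    finally show ?thesis
      unfolding H_def G_def power2_eq_square by (simp only: mult_frac_aux)
  qed
  have GH: "G (Suc k) = H k" if "k < K" for k
  proof -
    have "T + q ^ 2 * y k ^ 2 \<noteq> 0" using y(3)[of "Suc k"] by (simp add: y(2) power_mult_distrib)
    moreover have "w (Suc k) * (T + y k ^ 2) * T ^ 2 * ((s0 + q * y k) * (s1 + q * y k) * (s2 + q * y k) * (s3 + q * y k))
       = w k * q * (T + q ^ 2 * y k ^ 2) * ?n k"
      using P that by (simp add: pearson_def)
    ultimately show ?thesis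
      using y(1)[of k] y(3)[of k] q
      unfolding G_def H_def y(2) by (simp add: frac_eq_eq power_mult_distrib ac_simps)
  qed
  have "(\<Sum>k\<le>K. H k - G k) = 0"
  proof -
    have "G 0 = 0" by (simp add: G_def s2)
    moreover have "H K = 0" by (simp add: H_def s3)
    moreover have "(\<Sum>k<K. G (Suc k)) = (\<Sum>k<K. H k)" using GH by simp
    moreover have "(\<Sum>k\<le>K. G k) = G 0 + (\<Sum>k<K. G (Suc k))"
      by (simp add: sum.atMost_shift)
    moreover have "(\<Sum>k\<le>K. H k) = (\<Sum>k<K. H k) + H K"
      by (simp add: lessThan_Suc_atMost[symmetric])
    ultimately show ?thesis by (simp add: sum_subtractf)
  qed
  then have "(\<Sum>k\<le>K. w k * (s0 * (y k - T / y k + s0 - T / s0) * (T ^ 2 - s0 * s1 * s2 * s3) + (T + s0 * s1) * (T + s0 * s2) * (T + s0 * s3))) = 0"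
    unfolding c sum_distrib_left[symmetric] by simp
  moreover have "(\<Sum>k\<le>K. w k * (s0 * (y k - T / y k + s0 - T / s0) * (T ^ 2 - s0 * s1 * s2 * s3) + (T + s0 * s1) * (T + s0 * s2) * (T + s0 * s3)))
     = s0 * (T ^ 2 - s0 * s1 * s2 * s3) * (\<Sum>k\<le>K. w k * (y k - T / y k + s0 - T / s0)) + (T + s0 * s1) * (T + s0 * s2) * (T + s0 * s3) * (\<Sum>k\<le>K. w k)"
    unfolding sum_distrib_left sum.distrib[symmetric] by (intro sum.cong) (simp_all only: algebra_simps)
  ultimately show ?thesis by (simp add: add_eq_0_iff)
qed

definition xnode :: "nat \<Rightarrow> complex" where "xnode k = y k - T / y k"

definition node_prod :: "complex \<Rightarrow> nat \<Rightarrow> nat \<Rightarrow> complex" where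
  "node_prod s m k = (\<Prod>l<m. xnode k + s * q ^ l - T / (s * q ^ l))"

text \<open>Repeated shifts of \<open>s0\<close> and \<open>s1\<close>; the parameters
  \<open>s2\<close> and \<open>s3\<close>, which carry the boundary conditions, stay fixed.\<close>

lemma pearson_node_prod:
  assumes P: "pearson K q T y s0 s1 s2 s3 w" and s: "s0 \<noteq> 0" "s1 \<noteq> 0"
  shows "pearson K q T y (s0 * q ^ m) (s1 * q ^ l) s2 s3 (\<lambda>k. w k * node_prod s0 m k * node_prod s1 l k)"
proof -
  have l: "pearson K q T y s0 (s1 * q ^ l) s2 s3 (\<lambda>k. w k * node_prod s1 l k)"
  proof (induction l)
    case 0 then show ?case using P by (simp add: node_prod_def)
  next
    case (Suc l)
    have "pearson K q T y (s1 * q ^ l * q) s0 s2 s3 (\<lambda>k. w k * node_prod s1 l k * (y k - T / y k + s1 * q ^ l - T / (s1 * q ^ l)))"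
      by (rule pearson_shift) (use Suc pearson_swap s q in auto)
    moreover have "(\<lambda>k. w k * node_prod s1 l k * (y k - T / y k + s1 * q ^ l - T / (s1 * q ^ l))) = (\<lambda>k. w k * node_prod s1 (Suc l) k)"
      by (simp add: node_prod_def xnode_def ac_simps)
    ultimately show ?case by (subst pearson_swap) (simp add: ac_simps)
  qed
  show ?thesis
  proof (induction m)
    case 0 then show ?case using l by (simp add: node_prod_def)
  next
    case (Suc m)
    have "pearson K q T y (s0 * q ^ m * q) (s1 * q ^ l) s2 s3 (\<lambda>k. w k * node_prod s0 m k * node_prod s1 l k * (y k - T / y k + s0 * q ^ m - T / (s0 * q ^ m)))"
      by (rule pearson_shift) (use Suc s q in auto)
    moreover have "(\<lambda>k. w k * node_prod s0 m k * node_prod s1 l k * (y k - T / y k + s0 * q ^ m - T / (s0 * q ^ m))) = (\<lambda>k. w k * node_prod s0 (Suc m) k * node_prod s1 l k)"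
      by (simp add: node_prod_def xnode_def ac_simps)
    ultimately show ?case by (simp add: ac_simps)
  qed
qed

context
  fixes s0 s1 s2 s3 :: complex and w :: "nat \<Rightarrow> complex"
  assumes P: "pearson K q T y s0 s1 s2 s3 w" and s: "s0 \<noteq> 0" "s1 \<noteq> 0"
    and s2: "s2 = - y 0" and s3: "s3 * y K = T"
    and \<delta>: "\<And>i. s0 * s1 * s2 * s3 / T ^ 2 * q ^ i \<noteq> 1" and nz: "\<And>n. qpoch q q n \<noteq> 0"
begin

definition racah_moment :: "nat \<Rightarrow> nat \<Rightarrow> complex" where
  "racah_moment m l = (\<Sum>k\<le>K. w k * node_prod s0 m k * node_prod s1 l k)"

text \<open>This is \<open>pearson_sum_zero\<close> for the weight multiplied by both node products,
  whose parameters are s0 q^m and s1 q^l: the extra linear factor there is exactly the next factor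
  of the node product.\<close>

lemma racah_moment_Suc:
  "racah_moment (Suc m) l * (1 - s0 * s1 * s2 * s3 / T ^ 2 * q ^ (m + l))
   = (- T / s0) / q ^ m * ((1 - - s0 * s1 / T * q ^ (m + l)) * (1 - - s0 * s2 / T * q ^ m) * (1 - - s0 * s3 / T * q ^ m)) * racah_moment m l"
proof -
  let ?s0 = "s0 * q ^ m" and ?s1 = "s1 * q ^ l"
  have "?s0 * (T ^ 2 - ?s0 * ?s1 * s2 * s3) * (\<Sum>k\<le>K. w k * node_prod s0 m k * node_prod s1 l k * (y k - T / y k + ?s0 - T / ?s0))
    = - ((T + ?s0 * ?s1) * (T + ?s0 * s2) * (T + ?s0 * s3)) * (\<Sum>k\<le>K. w k * node_prod s0 m k * node_prod s1 l k)"
    by (rule pearson_sum_zero[OF pearson_node_prod[OF P s]]) (use s q s2 s3 in auto)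
  moreover have "(\<Sum>k\<le>K. w k * node_prod s0 m k * node_prod s1 l k * (y k - T / y k + ?s0 - T / ?s0)) = racah_moment (Suc m) l"
    unfolding racah_moment_def by (intro sum.cong refl) (simp add: node_prod_def xnode_def ac_simps)
  ultimately have "?s0 * (T ^ 2 - ?s0 * ?s1 * s2 * s3) * racah_moment (Suc m) l
     = - ((T + ?s0 * ?s1) * (T + ?s0 * s2) * (T + ?s0 * s3)) * racah_moment m l"
    by (simp only: racah_moment_def)
  moreover have "?s0 * (T ^ 2 - ?s0 * ?s1 * s2 * s3) = s0 * q ^ m * T ^ 2 * (1 - s0 * s1 * s2 * s3 / T ^ 2 * q ^ (m + l))"
    using T by (simp add: field_simps power_add)
  moreover have "(T + ?s0 * ?s1) * (T + ?s0 * s2) * (T + ?s0 * s3)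
      = T * T ^ 2 * ((1 - - s0 * s1 / T * q ^ (m + l)) * (1 - - s0 * s2 / T * q ^ m) * (1 - - s0 * s3 / T * q ^ m))"
  proof -
    have "T + ?s0 * ?s1 = T * (1 - - s0 * s1 / T * q ^ (m + l))" "T + ?s0 * s2 = T * (1 - - s0 * s2 / T * q ^ m)"
      "T + ?s0 * s3 = T * (1 - - s0 * s3 / T * q ^ m)"
      using T by (simp_all add: field_simps power_add)
    then show ?thesis by (simp only: power2_eq_square ac_simps)
  qed
  ultimately have "s0 * q ^ m * T ^ 2 * (1 - s0 * s1 * s2 * s3 / T ^ 2 * q ^ (m + l)) * racah_moment (Suc m) l
     = - (T * T ^ 2 * ((1 - - s0 * s1 / T * q ^ (m + l)) * (1 - - s0 * s2 / T * q ^ m) * (1 - - s0 * s3 / T * q ^ m))) * racah_moment m l"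
    by (simp only:)
  then show ?thesis by (rule moment_step_aux) (use s q T in auto)
qed

lemma racah_moment_eq:
  "racah_moment m l * (q ^ (m choose 2) * qpoch (s0 * s1 * s2 * s3 / T ^ 2 * q ^ l) q m)
   = (- T / s0) ^ m * (qpoch (- s0 * s1 / T * q ^ l) q m * qpoch (- s0 * s2 / T) q m * qpoch (- s0 * s3 / T) q m) * racah_moment 0 l"
proof (induction m)
  case 0 then show ?case by (simp add: numeral_2_eq_2)
next
  case (Suc m)
  let ?e = "s0 * s1 * s2 * s3 / T ^ 2" and ?a = "- s0 * s1 / T" and ?b = "- s0 * s2 / T" and ?c = "- s0 * s3 / T"
  have choose: "Suc m choose 2 = (m choose 2) + m" by (simp add: numeral_2_eq_2)
  have "racah_moment (Suc m) l * (q ^ (Suc m choose 2) * qpoch (?e * q ^ l) q (Suc m))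
     = (racah_moment (Suc m) l * (1 - ?e * q ^ (m + l))) * q ^ m * (q ^ (m choose 2) * qpoch (?e * q ^ l) q m)"
    unfolding choose qpoch_Suc power_add by (simp only: ac_simps)
  also have "\<dots> = ((- T / s0) / q ^ m * q ^ m) * ((1 - ?a * q ^ (m + l)) * (1 - ?b * q ^ m) * (1 - ?c * q ^ m))
      * (racah_moment m l * (q ^ (m choose 2) * qpoch (?e * q ^ l) q m))"
    unfolding racah_moment_Suc by (simp only: ac_simps)
  also have "(- T / s0) / q ^ m * q ^ m = - T / s0" using q by simp
  also have "(- T / s0) * ((1 - ?a * q ^ (m + l)) * (1 - ?b * q ^ m) * (1 - ?c * q ^ m)) * (racah_moment m l * (q ^ (m choose 2) * qpoch (?e * q ^ l) q m))
      = (- T / s0) ^ Suc m * (qpoch (?a * q ^ l) q (Suc m) * qpoch ?b q (Suc m) * qpoch ?c q (Suc m)) * racah_moment 0 l"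
    unfolding Suc.IH qpoch_Suc power_Suc power_add by (simp only: ac_simps)
  finally show ?case .
qed

text \<open>Replaces two factors whose lengths vary with \<open>m\<close> by one free of
  \<open>m\<close> and one of fixed length \<open>l\<close>, so that the dependence on
  \<open>m\<close> becomes polynomial in q^m.\<close>

lemma qpoch_exchange:
  assumes "m \<le> n" "l \<le> n"
  shows "qpoch (a * q ^ l) q m * qpoch (a * q ^ m) q (n - m) = qpoch (a * q ^ l) q (n - l) * qpoch (a * q ^ m) q l"
proof -
  have *: "qpoch (a * q ^ i) q (n - i) * qpoch (a * q ^ j) q i = qpoch (a * q ^ j) q (n - j) * qpoch (a * q ^ i) q j"
    if ij: "i \<le> j" "j \<le> n" for i j
  proof -
    obtain d where d1: "j = i + d" using le_Suc_ex[OF ij(1)] by blast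
    obtain e where "n = j + e" using le_Suc_ex[OF ij(2)] by blast
    with d1 have d: "j = i + d" "n = i + d + e" by simp_all
    have 1: "qpoch (a * q ^ i) q (n - i) = qpoch (a * q ^ i) q d * qpoch (a * q ^ j) q e"
      using qpoch_add[of "a * q ^ i" q d e] by (simp add: d power_add ac_simps)
    have 2: "qpoch (a * q ^ i) q j = qpoch (a * q ^ i) q d * qpoch (a * q ^ j) q i"
      using qpoch_add[of "a * q ^ i" q d i] by (simp add: d power_add ac_simps)
    show ?thesis unfolding 1 2 using d by (simp add: ac_simps)
  qed
  show ?thesis using *[of m l] *[of l m] assms by (cases "m \<le> l") (simp_all add: ac_simps)
qed

lemma qpoch_\<delta>_nonzero: "qpoch (s0 * s1 * s2 * s3 / T ^ 2 * q ^ i) q n \<noteq> 0"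
  using \<delta>[of "i + _"] by (auto simp: qpoch_def power_add mult.assoc)

text \<open>All dependence on \<open>m\<close> is collected in a signed q-binomial over q^((n-1)m)
  and a polynomial in q^m of degree at most n - 1: degree \<open>l\<close> comes from the numerator,
  n - 1 - l from the denominators. This is the shape that \<open>gauss_sum_poly_zero\<close>
  annihilates.\<close>

lemma racah_coeff_moment:
  assumes N: "T = q ^ (N - 1)" "0 < N" and m: "m \<le> n" and l: "l < n"
  shows "racah_coeff q s0 s1 s2 s3 N n m * racah_moment m l
    = racah_moment 0 l * (T / s0) ^ n * qpoch (- s0 * s2 / T) q n * qpoch (- s0 * s3 / T) q n * qpoch (- s0 * s1 / T * q ^ l) q (n - l)
       / qpoch (s0 * s1 * s2 * s3 / T ^ 2 * q ^ l) q (2 * n - 1 - l)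
       * (gauss_coeff q n m / (q ^ (n - 1)) ^ m
          * poly (qpoch_poly (- s0 * s1 / T) q l * qpoch_poly (s0 * s1 * s2 * s3 / T ^ 2 * q ^ l) q (n - 1 - l)) (q ^ m))"
proof -
  let ?e = "s0 * s1 * s2 * s3 / T ^ 2" and ?a = "- s0 * s1 / T" and ?b = "- s0 * s2 / T" and ?c = "- s0 * s3 / T"
  have p1: "q powi (int m - int N + 1) = q ^ m / T"
  proof -
    have "int m - int N + 1 = int m - int (N - 1)" using N by simp
    then show ?thesis unfolding N(1) by (simp only: power_int_diff[OF disjI1[OF q]] power_int_of_nat)
  qed
  have p2: "s0 * s1 * s2 * s3 * q powi (int n + int m + 1 - 2 * int N) = ?e * q ^ (n + m - 1)"
  proof -
    have "int n + int m + 1 - 2 * int N = int (n + m - 1) - int ((N - 1) * 2)" using N l by simp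
    then have "q powi (int n + int m + 1 - 2 * int N) = q ^ (n + m - 1) / T ^ 2"
      unfolding N(1) by (simp only: power_int_diff[OF disjI1[OF q]] power_int_of_nat power_mult[symmetric])
    then show ?thesis by simp
  qed
  have p3: "q powi ((int m - int N + 1) * (int n - int m)) = (q ^ m / T) ^ (n - m)"
  proof -
    have "int n - int m = int (n - m)" using m by simp
    then show ?thesis by (simp only: power_int_mult power_int_of_nat p1)
  qed
  have p4: "s0 powi (int m - int n) = 1 / s0 ^ (n - m)"
  proof -
    have "int m - int n = - int (n - m)" using m by simp
    then show ?thesis by (simp only: power_int_minus power_int_of_nat inverse_eq_divide)
  qed
  have coeff: "racah_coeff q s0 s1 s2 s3 N n m
     = 1 / s0 ^ (n - m) * ((qpoch (?a * q ^ m) q (n - m) * qpoch (?b * q ^ m) q (n - m) * qpoch (?c * q ^ m) q (n - m))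
        / ((q ^ m / T) ^ (n - m) * (qpoch q q (n - m) * qpoch (?e * q ^ (n + m - 1)) q (n - m))))
      * (qpoch q q n / qpoch q q m)"
    using m unfolding racah_coeff_def p1 p2 p3 p4 by simp
  have racah_moment: "racah_moment m l = (- T / s0) ^ m * (qpoch (?a * q ^ l) q m * qpoch ?b q m * qpoch ?c q m) * racah_moment 0 l
      / (q ^ (m choose 2) * qpoch (?e * q ^ l) q m)"
    using racah_moment_eq[of m l] qpoch_\<delta>_nonzero[of l m] q by (simp add: eq_divide_eq)
  have ab: "qpoch (?a * q ^ l) q m * qpoch (?a * q ^ m) q (n - m) = qpoch (?a * q ^ l) q (n - l) * qpoch (?a * q ^ m) q l"
    using m l by (intro qpoch_exchange) auto
  have bb: "qpoch ?b q m * qpoch (?b * q ^ m) q (n - m) = qpoch ?b q n" "qpoch ?c q m * qpoch (?c * q ^ m) q (n - m) = qpoch ?c q n"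
    using m qpoch_add[of _ q m "n - m"] by simp_all
  \<comment> \<open>A product whose length is free of \<open>m\<close> is cut into blocks of lengths
    m, n - 1 - l and n - m. The outer blocks are the denominators of the moment and of the
    coefficient; the middle one supplies the polynomial in q^m.\<close>
  have grid_enum: "qpoch (?e * q ^ l) q (2 * n - 1 - l) = qpoch (?e * q ^ l) q m * qpoch (?e * q ^ l * q ^ m) q (n - 1 - l) * qpoch (?e * q ^ (n + m - 1)) q (n - m)"
  proof -
    have "2 * n - 1 - l = m + (n - 1 - l) + (n - m)" "l + (m + (n - 1 - l)) = n + m - 1" using m l by auto
    then show ?thesis by (simp only: qpoch_add mult.assoc power_add[symmetric])
  qed
  \<comment> \<open>One power with exponent \<open>m choose 2\<close> comes from the moment, the
    other from the numerator of \<open>gauss_coeff\<close>; with the factor of the expansion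
    coefficient they amount to q^((n-1)m).\<close>
  have ex: "q ^ (m choose 2) * (q ^ m) ^ (n - m) * q ^ (m choose 2) = (q ^ (n - 1)) ^ m"
  proof -
    have "(m choose 2) + m * (n - m) + (m choose 2) = (n - 1) * m"
    proof -
      have "even (m * (m - 1))" by (cases m) simp_all
      then have "2 * (m choose 2) = m * (m - 1)" by (simp add: choose_two)
      moreover have "m * (m - 1) + m * (n - m) = (n - 1) * m"
      proof (cases m)
        case (Suc m')
        then have "m - 1 + (n - m) = n - 1" using m by simp
        then show ?thesis by (simp only: add_mult_distrib2[symmetric] mult.commute)
      qed simp
      ultimately show ?thesis by simp
    qed
    then show ?thesis by (simp only: power_mult[symmetric] power_add[symmetric])
  qed
  have sT: "(- T / s0) ^ m * (1 / s0 ^ (n - m)) * T ^ (n - m) = (- 1) ^ m * (T / s0) ^ n"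
  proof -
    have "T ^ n = T ^ m * T ^ (n - m)" "s0 ^ n = s0 ^ m * s0 ^ (n - m)"
      using m by (simp_all add: power_add[symmetric])
    then show ?thesis by (simp add: power_divide power_minus[of "T / s0"])
  qed
  have g: "gauss_coeff q n m / (q ^ (n - 1)) ^ m = (- 1) ^ m * qpoch q q n / (qpoch q q m * qpoch q q (n - m) * (q ^ (m choose 2) * (q ^ m) ^ (n - m)))"
    using m q unfolding ex[symmetric] by (simp add: gauss_coeff_def)
  define Ea where "Ea = qpoch (?e * q ^ l) q m"
  define Eb where "Eb = qpoch (?e * q ^ l * q ^ m) q (n - 1 - l)"
  define Ec where "Ec = qpoch (?e * q ^ (n + m - 1)) q (n - m)"
  have nz': "Ea \<noteq> 0" "Eb \<noteq> 0" "Ec \<noteq> 0"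
    using qpoch_\<delta>_nonzero[of "l + m" "n - 1 - l"] qpoch_\<delta>_nonzero[of l m] qpoch_\<delta>_nonzero[of "n + m - 1"]
    by (simp_all add: Ea_def Eb_def Ec_def power_add mult.assoc)
  have "racah_coeff q s0 s1 s2 s3 N n m * racah_moment m l
    = racah_moment 0 l * ((- T / s0) ^ m * (1 / s0 ^ (n - m)) * T ^ (n - m)) * (qpoch ?b q m * qpoch (?b * q ^ m) q (n - m)) * (qpoch ?c q m * qpoch (?c * q ^ m) q (n - m))
      * (qpoch (?a * q ^ l) q m * qpoch (?a * q ^ m) q (n - m)) * qpoch q q n
      / (qpoch q q m * qpoch q q (n - m) * (q ^ (m choose 2) * (q ^ m) ^ (n - m)) * (Ea * Ec))"
    unfolding coeff racah_moment Ea_def[symmetric] Ec_def[symmetric]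
    using T by (simp add: power_divide ac_simps)
  also have "\<dots> = racah_moment 0 l * (T / s0) ^ n * qpoch ?b q n * qpoch ?c q n * qpoch (?a * q ^ l) q (n - l) / (Ea * Eb * Ec)
       * ((- 1) ^ m * qpoch q q n / (qpoch q q m * qpoch q q (n - m) * (q ^ (m choose 2) * (q ^ m) ^ (n - m))) * (qpoch (?a * q ^ m) q l * Eb))"
    unfolding sT bb ab using nz' by (simp add: ac_simps)
  finally show ?thesis
    unfolding g[symmetric] grid_enum Ea_def[symmetric] Eb_def[symmetric] Ec_def[symmetric]
    by (simp add: poly_qpoch_poly Eb_def)
qed

text \<open>Expanding in the node products of \<open>s0\<close> and testing with those of
  \<open>s1\<close> turns the sum into mixed moments, all known explicitly. The tests with l < n
  span the polynomials of degree below n.\<close>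

theorem racah_orthogonal:
  assumes N: "T = q ^ (N - 1)" "0 < N" and l: "l < n"
  shows "(\<Sum>k\<le>K. w k * racah_poly q s0 s1 s2 s3 N n (xnode k) * (\<Prod>i<l. xnode k - qnode q s1 N i)) = 0"
proof -
  have node: "qnode q t N i = - (t * q ^ i) + T / (t * q ^ i)" if "t \<noteq> 0" for t i
  proof -
    have "int N - int i - 1 = int (N - 1) - int i" using N by simp
    then have "q powi (int N - int i - 1) = T / q ^ i"
      unfolding N(1) by (simp only: power_int_diff[OF disjI1[OF q]] power_int_of_nat)
    then show ?thesis using that q by (simp add: qnode_def field_simps)
  qed
  have node_prod: "(\<Prod>i<m. xnode k - qnode q t N i) = node_prod t m k" if "t \<noteq> 0" for t m k
    unfolding node_prod_def by (intro prod.cong refl) (simp add: node[OF that] algebra_simps)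
  let ?p = "qpoch_poly (- s0 * s1 / T) q l * qpoch_poly (s0 * s1 * s2 * s3 / T ^ 2 * q ^ l) q (n - 1 - l)"
  have "degree ?p \<le> l + (n - 1 - l)"
    by (rule order_trans[OF degree_mult_le add_mono[OF degree_qpoch_poly degree_qpoch_poly]])
  then have deg: "degree ?p < n" using l by simp
  have "(\<Sum>k\<le>K. w k * racah_poly q s0 s1 s2 s3 N n (xnode k) * (\<Prod>i<l. xnode k - qnode q s1 N i))
     = (\<Sum>k\<le>K. \<Sum>m\<le>n. racah_coeff q s0 s1 s2 s3 N n m * (w k * node_prod s0 m k * node_prod s1 l k))"
    by (simp add: racah_poly_def node_prod[OF s(1)] node_prod[OF s(2)] sum_distrib_left sum_distrib_right ac_simps)
  also have "\<dots> = (\<Sum>m\<le>n. racah_coeff q s0 s1 s2 s3 N n m * racah_moment m l)"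
    by (subst sum.swap) (simp add: racah_moment_def sum_distrib_left)
  also have "\<dots> = (\<Sum>m\<le>n. racah_moment 0 l * (T / s0) ^ n * qpoch (- s0 * s2 / T) q n * qpoch (- s0 * s3 / T) q n * qpoch (- s0 * s1 / T * q ^ l) q (n - l)
       / qpoch (s0 * s1 * s2 * s3 / T ^ 2 * q ^ l) q (2 * n - 1 - l) * (gauss_coeff q n m / (q ^ (n - 1)) ^ m * poly ?p (q ^ m)))"
    by (intro sum.cong refl racah_coeff_moment[OF N _ l]) simp
  also have "\<dots> = 0"
    unfolding sum_distrib_left[symmetric] gauss_sum_poly_zero[OF nz q deg] by (rule mult_zero_right)
  finally show ?thesis .
qed

end

end

section \<open>The configuration space as a Cantor set\<close>

text \<open>Restores \<open>suminf\<close> as the meaning of an unbounded sum.\<close>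

no_syntax
  "_Sum_any" :: "pttrn \<Rightarrow> 'a \<Rightarrow> 'a::comm_monoid_add"    (\<open>(\<open>indent=2 notation=\<open>binder \<Sum>\<close>\<close>\<Sum>_. _)\<close> [0, 10] 10)

context
  fixes e :: "nat \<Rightarrow> real"
  assumes inj: "inj e"
begin

definition bsum :: "(nat \<Rightarrow> real) \<Rightarrow> real set \<Rightarrow> real" where
  "bsum v X = (\<Sum>j. if e j \<in> X then v j else 0)"

definition agree :: "nat \<Rightarrow> real set \<Rightarrow> real set \<Rightarrow> bool" where
  "agree n X Y \<longleftrightarrow> (\<forall>j<n. e j \<in> X \<longleftrightarrow> e j \<in> Y)"

text \<open>Uniform continuity for the product topology, measured by the number of initial grid
  points on which two configurations agree.\<close>

definition cfg_cont :: "(real set \<Rightarrow> 'b::metric_space) \<Rightarrow> bool" where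
  "cfg_cont F \<longleftrightarrow> (\<forall>\<epsilon>>0. \<exists>n. \<forall>X\<subseteq>range e. \<forall>Y\<subseteq>range e. agree n X Y \<longrightarrow> dist (F X) (F Y) < \<epsilon>)"

lemma summable_bsum:
  fixes v :: "nat \<Rightarrow> real"
  assumes "summable (\<lambda>j. \<bar>v j\<bar>)"
  shows "summable (\<lambda>j. \<bar>if e j \<in> X then v j else 0\<bar>)" and "summable (\<lambda>j. if e j \<in> X then v j else 0)"
proof -
  show 1: "summable (\<lambda>j. \<bar>if e j \<in> X then v j else 0\<bar>)"
    by (rule summable_comparison_test'[OF assms, of 0]) auto
  show "summable (\<lambda>j. if e j \<in> X then v j else 0)"
    by (rule summable_rabs_cancel[OF 1])
qed

lemma bsum_agree:
  assumes v: "summable (\<lambda>j. \<bar>v j\<bar>)" and a: "agree n X Y"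
  shows "\<bar>bsum v X - bsum v Y\<bar> \<le> (\<Sum>i. \<bar>v (i + n)\<bar>)"
proof -
  let ?d = "\<lambda>j. (if e j \<in> X then v j else 0) - (if e j \<in> Y then v j else 0)"
  have sd: "summable ?d" by (intro summable_diff summable_bsum v)
  have "bsum v X - bsum v Y = (\<Sum>j. ?d j)"
    unfolding bsum_def by (rule suminf_diff) (intro summable_bsum v)+
  also have "\<dots> = (\<Sum>i. ?d (i + n)) + (\<Sum>j<n. ?d j)"
    by (rule suminf_split_initial_segment[OF sd])
  also have "(\<Sum>j<n. ?d j) = 0" using a by (intro sum.neutral) (auto simp: agree_def)
  finally have "\<bar>bsum v X - bsum v Y\<bar> = \<bar>\<Sum>i. ?d (i + n)\<bar>" by simp
  also have vn: "summable (\<lambda>i. \<bar>v (i + n)\<bar>)" using v by (subst summable_iff_shift)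
  have dn: "summable (\<lambda>i. \<bar>?d (i + n)\<bar>)"
    by (rule summable_comparison_test'[OF vn, of 0]) auto
  have "\<bar>\<Sum>i. ?d (i + n)\<bar> \<le> (\<Sum>i. \<bar>?d (i + n)\<bar>)"
    by (rule summable_rabs[OF dn])
  also have "\<dots> \<le> (\<Sum>i. \<bar>v (i + n)\<bar>)"
    by (rule suminf_le[OF _ dn vn]) auto
  finally show ?thesis .
qed

lemma cfg_cont_bsum:
  assumes v: "summable (\<lambda>j. \<bar>v j\<bar>)"
  shows "cfg_cont (bsum v)"
  unfolding cfg_cont_def
proof (intro allI impI)
  fix \<epsilon> :: real assume "0 < \<epsilon>"
  then obtain n where "norm (\<Sum>i. \<bar>v (i + n)\<bar>) < \<epsilon>" using suminf_exist_split[OF _ v] by blast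
  then have "\<bar>bsum v X - bsum v Y\<bar> < \<epsilon>" if "agree n X Y" for X Y
    using bsum_agree[OF v that] by simp
  then show "\<exists>n. \<forall>X\<subseteq>range e. \<forall>Y\<subseteq>range e. agree n X Y \<longrightarrow> dist (bsum v X) (bsum v Y) < \<epsilon>"
    by (intro exI[of _ n]) (auto simp: dist_real_def)
qed

text \<open>Base 3 with digits 0 and 1 keeps the encoding injective and its inverse continuous.\<close>

definition encode :: "real set \<Rightarrow> real" where
  "encode = bsum (\<lambda>j. (1/3) ^ j)"

lemma summable_third: "summable (\<lambda>j. \<bar>(1/3 :: real) ^ j\<bar>)"
  by (simp add: power_abs summable_geometric)

lemma suminf_third: "(\<Sum>i. \<bar>(1/3 :: real) ^ (i + n)\<bar>) = 3/2 * (1/3) ^ n"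
proof -
  have "(\<Sum>i. (1/3 :: real) ^ (i + n)) = (\<Sum>i. (1/3) ^ n * (1/3) ^ i)" by (simp add: power_add mult.commute)
  also have "\<dots> = (1/3) ^ n * (\<Sum>i. (1/3) ^ i)" by (rule suminf_mult) (simp add: summable_geometric)
  also have "(\<Sum>i. (1/3 :: real) ^ i) = 3/2" by (subst suminf_geometric) auto
  finally show ?thesis by (simp add: power_abs)
qed

lemma encode_agree: "agree n X Y \<Longrightarrow> \<bar>encode X - encode Y\<bar> \<le> 3/2 * (1/3) ^ n"
  unfolding encode_def using bsum_agree[OF summable_third] suminf_third by metis

text \<open>A first disagreement at index k contributes 3^(-k), while all later digits together can
  compensate at most half of this.\<close>

lemma encode_close:
  assumes "\<bar>encode X - encode Y\<bar> < 1/2 * (1/3) ^ n"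
  shows "agree n X Y"
proof (rule ccontr)
  assume "\<not> agree n X Y"
  then obtain i where i: "i < n" "(e i \<in> X) \<noteq> (e i \<in> Y)" by (auto simp: agree_def)
  define k where "k = (LEAST i. (e i \<in> X) \<noteq> (e i \<in> Y))"
  have k: "(e k \<in> X) \<noteq> (e k \<in> Y)" unfolding k_def by (rule LeastI[of "\<lambda>i. (e i \<in> X) \<noteq> (e i \<in> Y)", OF i(2)])
  have kn: "k < n" using Least_le[of "\<lambda>i. (e i \<in> X) \<noteq> (e i \<in> Y)", OF i(2)] i(1) unfolding k_def by simp
  have below: "(e j \<in> X) = (e j \<in> Y)" if "j < k" for j
    using not_less_Least[of j "\<lambda>i. (e i \<in> X) \<noteq> (e i \<in> Y)"] that unfolding k_def by blast
  \<comment> \<open>The configuration X with its k-th membership flipped: it agrees with Y one step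
    further, which isolates the contribution of the digit k.\<close>
  let ?Z = "if e k \<in> X then X - {e k} else X \<union> {e k}"
  have Zk: "agree (Suc k) ?Z Y"
    unfolding agree_def using k below inj_eq[OF inj] by (auto simp: less_Suc_eq)
  have XZ: "\<bar>encode X - encode ?Z\<bar> = (1/3) ^ k"
  proof -
    let ?f = "\<lambda>X j. if e j \<in> X then (1/3 :: real) ^ j else 0"
    have "encode X - encode ?Z = (\<Sum>j. ?f X j - ?f ?Z j)"
      unfolding encode_def bsum_def by (rule suminf_diff) (intro summable_bsum summable_third)+
    also have "(\<lambda>j. ?f X j - ?f ?Z j) = (\<lambda>j. if j = k then (if e k \<in> X then (1/3) ^ k else - ((1/3) ^ k)) else 0)"
      using inj_eq[OF inj] by (auto simp: fun_eq_iff)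
    also have "(\<Sum>j. if j = k then (if e k \<in> X then (1/3) ^ k else - ((1/3) ^ k)) else 0) = (if e k \<in> X then (1/3) ^ k else - ((1/3 :: real) ^ k))"
      using sums_single[of k "\<lambda>_. if e k \<in> X then (1/3) ^ k else - ((1/3 :: real) ^ k)"] by (simp add: sums_iff)
    finally show ?thesis by simp
  qed
  have "\<bar>encode ?Z - encode Y\<bar> \<le> 1/2 * (1/3) ^ k" using encode_agree[OF Zk] by simp
  with XZ have "1/2 * (1/3) ^ k \<le> \<bar>encode X - encode Y\<bar>" by linarith
  moreover have "(1/3 :: real) ^ n \<le> (1/3) ^ k" using kn by (intro power_decreasing) auto
  ultimately show False using assms by simp
qed

lemma agree_all: "(\<And>n. agree n X Y) \<Longrightarrow> X \<subseteq> range e \<Longrightarrow> Y \<subseteq> range e \<Longrightarrow> X = Y"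
  unfolding agree_def by blast

lemma inj_on_encode: "inj_on encode (Pow (range e))"
proof (rule inj_onI)
  fix X Y assume XY: "X \<in> Pow (range e)" "Y \<in> Pow (range e)" "encode X = encode Y"
  have "agree n X Y" for n by (rule encode_close) (use XY in simp)
  then show "X = Y" using XY by (intro agree_all) auto
qed

definition cantor :: "real set" where "cantor = encode ` Pow (range e)"

text \<open>The default empty set makes the map total with values in configurations, so that it can
  push forward measures on the whole line.\<close>

definition decode :: "real \<Rightarrow> real set" where
  "decode t = (if t \<in> cantor then inv_into (Pow (range e)) encode t else {})"

lemma decode_encode: "X \<subseteq> range e \<Longrightarrow> decode (encode X) = X"
  by (simp add: decode_def cantor_def inv_into_f_f[OF inj_on_encode])

lemma encode_decode: "t \<in> cantor \<Longrightarrow> encode (decode t) = t"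
  by (simp add: decode_def cantor_def f_inv_into_f)

lemma decode_subset: "decode t \<subseteq> range e"
  using inv_into_into[of t encode "Pow (range e)"] by (auto simp: decode_def cantor_def)

lemma continuous_on_decode:
  assumes "cfg_cont F"
  shows "continuous_on cantor (\<lambda>t. F (decode t))"
  unfolding continuous_on_iff
proof (intro ballI allI impI)
  fix t \<epsilon> :: real assume t: "t \<in> cantor" and "0 < \<epsilon>"
  with assms have "\<exists>n. \<forall>X\<subseteq>range e. \<forall>Y\<subseteq>range e. agree n X Y \<longrightarrow> dist (F X) (F Y) < \<epsilon>"
    by (simp add: cfg_cont_def)
  then obtain n where n: "\<forall>X\<subseteq>range e. \<forall>Y\<subseteq>range e. agree n X Y \<longrightarrow> dist (F X) (F Y) < \<epsilon>"
    by (rule exE)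
  have "dist (F (decode t')) (F (decode t)) < \<epsilon>" if t': "t' \<in> cantor" "dist t' t < 1/2 * (1/3) ^ n" for t'
    by (rule n[rule_format, OF decode_subset decode_subset encode_close]) (use t t' in \<open>simp add: encode_decode dist_real_def\<close>)
  then show "\<exists>d>0. \<forall>t'\<in>cantor. dist t' t < d \<longrightarrow> dist (F (decode t')) (F (decode t)) < \<epsilon>"
    by (intro exI[of _ "1/2 * (1/3) ^ n"]) auto
qed

text \<open>A convergent sequence of codes is Cauchy, and by \<open>encode_close\<close> its
  configurations eventually agree on every initial segment; only closedness needs this, boundedness
  being a geometric series.\<close>

lemma compact_cantor: "compact cantor"
proof -
  have "\<bar>encode X\<bar> \<le> 3/2" for X
  proof -
    have "agree 0 X {}" by (simp add: agree_def)
    moreover have "encode {} = 0" by (simp add: encode_def bsum_def)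
    ultimately show ?thesis using encode_agree[of 0 X "{}"] by simp
  qed
  then have "bounded cantor" by (intro boundedI[of _ "3/2"]) (auto simp: cantor_def)
  moreover have "closed cantor"
    unfolding closed_sequential_limits
  proof (intro allI impI, elim conjE)
    fix s t assume s: "\<forall>n. s n \<in> cantor" and t: "s \<longlonglongrightarrow> t"
    \<comment> \<open>The limit configuration consists of the grid points that eventually belong to
      all decoded configurations.\<close>
    define X where "X = {e j | j. \<forall>\<^sub>F m in sequentially. e j \<in> decode (s m)}"
    have XD: "X \<subseteq> range e" by (auto simp: X_def)
    have "\<forall>\<^sub>F m in sequentially. agree n (decode (s m)) X" for n
    proof -
      have "Cauchy s" using t by (auto intro: convergent_Cauchy convergentI)
      then obtain M where M: "\<And>m m'. m \<ge> M \<Longrightarrow> m' \<ge> M \<Longrightarrow> dist (s m) (s m') < 1/2 * (1/3) ^ n"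
        unfolding Cauchy_def by (metis half_gt_zero_iff mult.commute mult_pos_pos zero_less_divide_1_iff zero_less_numeral zero_less_power)
      have ag: "agree n (decode (s m)) (decode (s m'))" if "m \<ge> M" "m' \<ge> M" for m m'
        by (rule encode_close) (use M[OF that] s in \<open>simp add: encode_decode dist_real_def\<close>)
      have "agree n (decode (s m)) X" if m: "m \<ge> M" for m
        unfolding agree_def
      proof (intro allI impI)
        fix j assume j: "j < n"
        have iff: "e j \<in> decode (s m') \<longleftrightarrow> e j \<in> decode (s m)" if "m' \<ge> M" for m'
          using ag[OF m that] j by (auto simp: agree_def)
        have "e j \<in> X \<longleftrightarrow> (\<forall>\<^sub>F m in sequentially. e j \<in> decode (s m))"
          using inj_eq[OF inj] by (auto simp: X_def)
        also have "\<dots> \<longleftrightarrow> (\<forall>\<^sub>F m' in sequentially. e j \<in> decode (s m))"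
          by (intro eventually_cong[OF eventually_ge_at_top[of M]]) (use iff in auto)
        finally show "e j \<in> decode (s m) \<longleftrightarrow> e j \<in> X" by simp
      qed
      then show ?thesis by (auto simp: eventually_at_top_linorder)
    qed
    note ev = this
    have "s \<longlonglongrightarrow> encode X"
    proof (rule LIMSEQ_I)
      fix r :: real assume "0 < r"
      then obtain n where n: "(1/3 :: real) ^ n < r / 2" using real_arch_pow_inv[of "r/2" "1/3"] by auto
      obtain M where M: "\<And>m. m \<ge> M \<Longrightarrow> agree n (decode (s m)) X" using ev[of n] by (auto simp: eventually_at_top_linorder)
      have "norm (s m - encode X) < r" if "m \<ge> M" for m
      proof -
        have "\<bar>s m - encode X\<bar> \<le> 3/2 * (1/3) ^ n" using encode_agree[OF M[OF that]] s by (simp add: encode_decode)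
        then show ?thesis unfolding real_norm_def using n \<open>0 < r\<close> by linarith
      qed
      then show "\<exists>M. \<forall>m\<ge>M. norm (s m - encode X) < r" by blast
    qed
    with t have "t = encode X" by (rule LIMSEQ_unique)
    with XD show "t \<in> cantor" by (auto simp: cantor_def)
  qed
  ultimately show ?thesis by (simp add: compact_eq_bounded_closed)
qed

section \<open>Topology and Borel structure of the configuration space\<close>

definition cylinder :: "real set \<Rightarrow> real set set" where
  "cylinder F = {X. F \<subseteq> X \<and> X \<subseteq> range e}"

text \<open>Prescribing presence only, never absence, keeps this generator closed under
  intersection; absence is recovered by complements in the sigma-algebra.\<close>

definition cylinders :: "real set set set" where
  "cylinders = {cylinder F | F. finite F \<and> F \<subseteq> range e}"

lemma cylinder_agree:
  assumes "finite F" "F \<subseteq> range e"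
  obtains n where "\<And>X Y. Y \<subseteq> range e \<Longrightarrow> agree n X Y \<Longrightarrow> X \<in> cylinder F \<Longrightarrow> Y \<in> cylinder F"
proof -
  have "finite (e -` F)" by (rule finite_vimageI[OF assms(1) inj])
  then obtain n where "\<forall>j\<in>e -` F. j < n" unfolding finite_nat_set_iff_bounded by (rule exE)
  then have n: "\<And>j. e j \<in> F \<Longrightarrow> j < n" by simp
  have "Y \<in> cylinder F" if Y: "Y \<subseteq> range e" "agree n X Y" "X \<in> cylinder F" for X Y
  proof -
    have "x \<in> Y" if "x \<in> F" for x
    proof -
      obtain j where j: "x = e j" using assms(2) \<open>x \<in> F\<close> by blast
      with \<open>x \<in> F\<close> have "j < n" by (intro n) simp
      with Y(2,3) j \<open>x \<in> F\<close> show ?thesis by (auto simp: agree_def cylinder_def)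
    qed
    with Y(1) show ?thesis by (auto simp: cylinder_def)
  qed
  then show thesis by (rule that)
qed

text \<open>A basic open set of the product constrains finitely many coordinates, and these lie
  among the first n of the enumeration for some n.\<close>

lemma openin_config_iff:
  "openin (config_topology (range e)) U \<longleftrightarrow>
    U \<subseteq> Pow (range e) \<and> (\<forall>X\<in>U. \<exists>n. \<forall>Y\<subseteq>range e. agree n X Y \<longrightarrow> Y \<in> U)"
proof
  let ?i = "\<lambda>X. \<lambda>x\<in>range e. x \<in> X"
  assume "openin (config_topology (range e)) U"
  then obtain V where V: "openin (product_topology (\<lambda>_. discrete_topology (UNIV :: bool set)) (range e)) V"
    and U: "U = ?i -` V \<inter> Pow (range e)"
    by (auto simp: config_topology_def openin_pullback_topology)
  have "\<exists>n. \<forall>Y\<subseteq>range e. agree n X Y \<longrightarrow> Y \<in> U" if X: "X \<in> U" for X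
  proof -
    have "?i X \<in> V" using X U by auto
    with V obtain B where B: "finite {x \<in> range e. B x \<noteq> UNIV}" "?i X \<in> PiE (range e) B" "PiE (range e) B \<subseteq> V"
      unfolding openin_product_topology_alt by fastforce
    have "finite (e -` {x \<in> range e. B x \<noteq> UNIV})" by (rule finite_vimageI[OF B(1) inj])
    then obtain n where n: "e -` {x \<in> range e. B x \<noteq> UNIV} \<subseteq> {..<n}"
      using finite_nat_set_iff_bounded by (auto simp: subset_eq)
    have "Y \<in> U" if Y: "Y \<subseteq> range e" "agree n X Y" for Y
    proof -
      have "?i Y \<in> PiE (range e) B"
      proof (rule PiE_I)
        fix x assume "x \<in> range e"
        then obtain j where j: "x = e j" by auto
        show "?i Y x \<in> B x"
        proof (cases "B x = UNIV")
          case False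
          then have "j < n" using n j by auto
          then have "x \<in> Y \<longleftrightarrow> x \<in> X" using Y(2) j by (auto simp: agree_def)
          moreover have "?i X x \<in> B x" using PiE_mem[OF B(2), of x] j by auto
          ultimately show ?thesis using j by simp
        qed simp
      qed simp
      then have "?i Y \<in> V" by (rule subsetD[OF B(3)])
      then show ?thesis unfolding U using Y(1) by (simp only: Int_iff vimage_eq Pow_iff simp_thms)
    qed
    then show ?thesis by blast
  qed
  then show "U \<subseteq> Pow (range e) \<and> (\<forall>X\<in>U. \<exists>n. \<forall>Y\<subseteq>range e. agree n X Y \<longrightarrow> Y \<in> U)"
    using U by auto
next
  let ?i = "\<lambda>X. \<lambda>x\<in>range e. x \<in> X"
  let ?T = "product_topology (\<lambda>_. discrete_topology (UNIV :: bool set)) (range e)"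
  assume U: "U \<subseteq> Pow (range e) \<and> (\<forall>X\<in>U. \<exists>n. \<forall>Y\<subseteq>range e. agree n X Y \<longrightarrow> Y \<in> U)"
  define V where "V = {g \<in> topspace ?T. {x \<in> range e. g x} \<in> U}"
  have "openin ?T V"
    unfolding openin_product_topology_alt
  proof
    fix g assume g: "g \<in> V"
    let ?X = "{x \<in> range e. g x}"
    have "?X \<in> U" using g by (simp add: V_def)
    with U have "\<exists>n. \<forall>Y\<subseteq>range e. agree n ?X Y \<longrightarrow> Y \<in> U" by blast
    then obtain n where n: "\<forall>Y\<subseteq>range e. agree n ?X Y \<longrightarrow> Y \<in> U" by (rule exE)
    define B where "B = (\<lambda>x. if x \<in> e ` {..<n} then {g x} else UNIV)"
    have "finite {x \<in> range e. B x \<noteq> topspace (discrete_topology UNIV)}"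
      by (rule finite_subset[of _ "e ` {..<n}"]) (auto simp: B_def)
    moreover have "g \<in> PiE (range e) B" using g by (auto simp: V_def B_def)
    moreover have "PiE (range e) B \<subseteq> V"
    proof
      fix f assume f: "f \<in> PiE (range e) B"
      have "f (e j) = g (e j)" if "j < n" for j
        using PiE_mem[OF f, of "e j"] that by (auto simp: B_def)
      then have "agree n ?X {x \<in> range e. f x}" by (auto simp: agree_def)
      then have "{x \<in> range e. f x} \<in> U" by (intro n[rule_format]) auto
      then show "f \<in> V" using f by (auto simp: V_def PiE_def)
    qed
    ultimately show "\<exists>B. finite {x \<in> range e. B x \<noteq> topspace (discrete_topology UNIV)} \<and>
        (\<forall>x\<in>range e. openin (discrete_topology UNIV) (B x)) \<and> g \<in> PiE (range e) B \<and> PiE (range e) B \<subseteq> V"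
      by (intro exI[of _ B]) auto
  qed
  moreover have "U = ?i -` V \<inter> Pow (range e)"
  proof -
    have inv: "{x \<in> range e. ?i X x} = X" if "X \<subseteq> range e" for X using that by auto
    have mem: "?i X \<in> V \<longleftrightarrow> X \<in> U" if "X \<subseteq> range e" for X
      unfolding V_def mem_Collect_eq inv[OF that] by simp
    show ?thesis
    proof (rule Set.set_eqI)
      fix X
      have "X \<in> U \<Longrightarrow> X \<subseteq> range e" using subsetD[OF conjunct1[OF U], of X] by simp
      then show "X \<in> U \<longleftrightarrow> X \<in> ?i -` V \<inter> Pow (range e)"
        unfolding Int_iff vimage_eq Pow_iff using mem[of X] by blast
    qed
  qed
  ultimately show "openin (config_topology (range e)) U"
    unfolding config_topology_def openin_pullback_topology by (intro exI[of _ V] conjI)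
qed

lemma space_config_borel [simp]: "space (config_borel (range e)) = Pow (range e)"
proof -
  have "{U. openin (config_topology (range e)) U} \<subseteq> Pow (Pow (range e))"
    by (auto simp: openin_config_iff)
  then show ?thesis unfolding config_borel_def by (rule space_measure_of)
qed

lemma cylinders_sub: "cylinders \<subseteq> Pow (Pow (range e))"
  by (auto simp: cylinders_def cylinder_def)

text \<open>Each open set is a union of boxes prescribing the first n memberships, and there are
  only countably many pairs of a number n and a subset of {0, ..., n-1}.\<close>

lemma sets_config_borel: "sets (config_borel (range e)) = sigma_sets (Pow (range e)) cylinders"
proof -
  have sub: "{U. openin (config_topology (range e)) U} \<subseteq> Pow (Pow (range e))"
    by (auto simp: openin_config_iff)
  have eq: "sets (config_borel (range e)) = sigma_sets (Pow (range e)) {U. openin (config_topology (range e)) U}"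
    unfolding config_borel_def by (rule sets_measure_of[OF sub])
  let ?M = "sigma (Pow (range e)) cylinders"
  have sM: "sets ?M = sigma_sets (Pow (range e)) cylinders" "space ?M = Pow (range e)"
    using cylinders_sub by (simp_all add: space_measure_of_conv)
  have pt: "{X \<in> space ?M. e j \<in> X} \<in> sets ?M" for j
  proof -
    have "{X \<in> space ?M. e j \<in> X} = cylinder {e j}" unfolding sM by (auto simp: cylinder_def)
    also have "\<dots> \<in> sets ?M" unfolding sM by (intro sigma_sets.Basic) (auto simp: cylinders_def)
    finally show ?thesis .
  qed
  have box: "{X \<in> space ?M. \<forall>j\<in>{..<n}. e j \<in> X \<longleftrightarrow> j \<in> S} \<in> sets ?M" for n S
  proof (rule sets.sets_Collect_finite_All)
    fix j
    show "{X \<in> space ?M. e j \<in> X \<longleftrightarrow> j \<in> S} \<in> sets ?M"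
      using pt[of j] sets.sets_Collect_neg[OF pt[of j]] by (cases "j \<in> S") simp_all
  qed simp
  have open_sets: "U \<in> sets ?M" if U: "openin (config_topology (range e)) U" for U
  proof -
    let ?A = "\<lambda>(n, S). {X \<in> space ?M. \<forall>j\<in>{..<n}. e j \<in> X \<longleftrightarrow> j \<in> S}"
    define I where "I = {p \<in> Sigma UNIV (\<lambda>n. Pow {..<n}). ?A p \<subseteq> U}"
    have "countable (Sigma (UNIV :: nat set) (\<lambda>n. Pow {..<n}))" by (rule countable_SIGMA) (simp_all add: countable_finite)
    then have "countable I" by (rule countable_subset[rotated]) (auto simp: I_def)
    moreover have "U = (\<Union>p\<in>I. ?A p)"
    proof
      show "U \<subseteq> (\<Union>p\<in>I. ?A p)"
      proof
        fix X assume X: "X \<in> U"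
        with U have XD: "X \<subseteq> range e" unfolding openin_config_iff by auto
        obtain n where n: "\<And>Y. Y \<subseteq> range e \<Longrightarrow> agree n X Y \<Longrightarrow> Y \<in> U"
          using U X unfolding openin_config_iff by blast
        let ?S = "{j. j < n \<and> e j \<in> X}"
        have "?A (n, ?S) \<subseteq> U" using n by (auto simp: sM agree_def)
        then have "(n, ?S) \<in> I" by (auto simp: I_def)
        moreover have "X \<in> ?A (n, ?S)" using XD by (auto simp: sM)
        ultimately show "X \<in> (\<Union>p\<in>I. ?A p)" by blast
      qed
    qed (auto simp: I_def)
    moreover have "?A p \<in> sets ?M" for p using box by (cases p) auto
    ultimately show ?thesis using sets.countable_UN''[of I ?A ?M] by simp
  qed
  have cyl_open: "openin (config_topology (range e)) U" if "U \<in> cylinders" for U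
  proof -
    from \<open>U \<in> cylinders\<close> obtain F where F: "U = cylinder F" "finite F" "F \<subseteq> range e" unfolding cylinders_def by blast
    obtain n where "\<And>X Y. Y \<subseteq> range e \<Longrightarrow> agree n X Y \<Longrightarrow> X \<in> cylinder F \<Longrightarrow> Y \<in> cylinder F"
      using cylinder_agree[OF F(2,3)] by blast
    moreover have "U \<subseteq> Pow (range e)" using F by (auto simp: cylinder_def)
    ultimately show ?thesis unfolding openin_config_iff F(1) by blast
  qed
  show ?thesis unfolding eq
  proof
    show "sigma_sets (Pow (range e)) {U. openin (config_topology (range e)) U} \<subseteq> sigma_sets (Pow (range e)) cylinders"
      using open_sets unfolding sM(1)[symmetric] by (intro sets.sigma_sets_subset[of _ ?M, unfolded sM(2)]) auto
    show "sigma_sets (Pow (range e)) cylinders \<subseteq> sigma_sets (Pow (range e)) {U. openin (config_topology (range e)) U}"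
      using cyl_open by (intro sigma_sets_mono') auto
  qed
qed

lemma measurable_bsum: "bsum v \<in> borel_measurable (config_borel (range e))"
  unfolding bsum_def
proof (rule borel_measurable_suminf)
  fix j
  have "{X \<in> space (config_borel (range e)). e j \<in> X} = cylinder {e j}" by (auto simp: cylinder_def)
  also have "\<dots> \<in> sets (config_borel (range e))"
    unfolding sets_config_borel by (intro sigma_sets.Basic) (auto simp: cylinders_def)
  finally show "(\<lambda>X. if e j \<in> X then v j else 0) \<in> borel_measurable (config_borel (range e))"
    by (intro measurable_If) auto
qed

lemma cfg_cont_indicator:
  assumes "finite F" "F \<subseteq> range e"
  shows "cfg_cont (indicator (cylinder F) :: real set \<Rightarrow> real)"
proof -
  obtain n where n: "\<And>X Y. Y \<subseteq> range e \<Longrightarrow> agree n X Y \<Longrightarrow> X \<in> cylinder F \<Longrightarrow> Y \<in> cylinder F"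
    using cylinder_agree[OF assms] by blast
  have "X \<in> cylinder F \<longleftrightarrow> Y \<in> cylinder F" if "X \<subseteq> range e" "Y \<subseteq> range e" "agree n X Y" for X Y
    using n[of Y X] n[of X Y] that by (auto simp: agree_def)
  then have "indicator (cylinder F) X = (indicator (cylinder F) Y :: real)" if "X \<subseteq> range e" "Y \<subseteq> range e" "agree n X Y" for X Y
    using that by (simp add: indicator_def)
  then show ?thesis unfolding cfg_cont_def by (metis dist_self)
qed

lemma borel_cantor: "cantor \<in> sets borel"
  by (intro borel_closed compact_imp_closed compact_cantor)

lemma measurable_decode: "decode \<in> measurable borel (config_borel (range e))"
proof (rule measurableI)
  fix t :: real show "decode t \<in> space (config_borel (range e))" using decode_subset by simp
next
  fix A assume A: "A \<in> sets (config_borel (range e))"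
  have "decode \<in> measurable borel (sigma (Pow (range e)) cylinders)"
  proof (rule measurable_measure_of[OF cylinders_sub])
    show "decode \<in> space borel \<rightarrow> Pow (range e)" using decode_subset by auto
    fix U assume "U \<in> cylinders"
    then obtain F where F: "U = cylinder F" "finite F" "F \<subseteq> range e" by (auto simp: cylinders_def)
    have "continuous_on cantor (\<lambda>t. indicator (cylinder F) (decode t) :: real)"
      by (rule continuous_on_decode[OF cfg_cont_indicator[OF F(2,3)]])
    then have "closed (cantor \<inter> (\<lambda>t. indicator (cylinder F) (decode t) :: real) -` {1..})"
      by (rule continuous_closed_preimage[OF _ compact_imp_closed[OF compact_cantor] closed_atLeast])
    moreover have "cantor \<inter> (\<lambda>t. indicator (cylinder F) (decode t) :: real) -` {1..} = cantor \<inter> decode -` U"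
      by (auto simp: F indicator_def of_bool_def split: if_splits)
    ultimately have "cantor \<inter> decode -` U \<in> sets borel" by (simp add: borel_closed)
    \<comment> \<open>Off the Cantor set the decoded configuration is empty, so the preimage gains
      either the whole complement or nothing.\<close>
    moreover have "decode -` U \<inter> space borel = (cantor \<inter> decode -` U) \<union> (if {} \<in> U then - cantor else {})"
      by (auto simp: decode_def split: if_splits)
    ultimately show "decode -` U \<inter> space borel \<in> sets borel"
      using borel_cantor by (auto simp del: space_borel)
  qed
  then show "decode -` A \<inter> space borel \<in> sets borel"
    using A by (intro measurable_sets[of decode borel "sigma (Pow (range e)) cylinders"]) (simp_all add: sets_config_borel cylinders_sub)
qed

text \<open>The encoded ensembles are probability measures on one bounded interval, so selection of
  a weak limit applies on the real line. The subsequence and the measure are chosen before the test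
  function, hence serve all test functions at once.\<close>

theorem limit_measure:
  fixes G :: "nat \<Rightarrow> 'g set" and w :: "nat \<Rightarrow> 'g \<Rightarrow> real" and Z :: "nat \<Rightarrow> 'g \<Rightarrow> real set"
  assumes fin: "\<And>n. finite (G n)" and w: "\<And>n g. g \<in> G n \<Longrightarrow> 0 \<le> w n g" "\<And>n. (\<Sum>g\<in>G n. w n g) = 1"
    and Z: "\<And>n g. g \<in> G n \<Longrightarrow> Z n g \<subseteq> range e"
  obtains r M where "strict_mono (r :: nat \<Rightarrow> nat)" "prob_space M" "sets M = sets (config_borel (range e))"
    "\<And>F :: real set \<Rightarrow> complex. continuous_on cantor (\<lambda>t. F (decode t)) \<Longrightarrow> F \<in> borel_measurable (config_borel (range e)) \<Longrightarrow>
       integrable M F \<and> (\<lambda>n. \<Sum>g\<in>G (r n). of_real (w (r n) g) * F (Z (r n) g)) \<longlonglongrightarrow> (LINT X|M. F X)"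
proof -
  define \<mu> where "\<mu> = (\<lambda>n. distr (point_measure (G n) (\<lambda>g. ennreal (w n g))) borel (\<lambda>g. encode (Z n g)))"
  have pm: "prob_space (point_measure (G n) (\<lambda>g. ennreal (w n g)))" for n
    by (rule prob_space_point_measure) (use fin w in \<open>auto simp: sum_ennreal\<close>)
  have rd: "real_distribution (\<mu> n)" for n
    unfolding \<mu>_def by (rule prob_space.real_distribution_distr[OF pm]) simp
  have int_\<mu>: "integral\<^sup>L (\<mu> n) f = (\<Sum>g\<in>G n. w n g *\<^sub>R f (encode (Z n g)))" if "f \<in> borel_measurable borel" for n and f :: "real \<Rightarrow> 'b::{banach, second_countable_topology}"
    unfolding \<mu>_def by (subst integral_distr) (use that fin w in \<open>auto intro: lebesgue_integral_point_measure_finite\<close>)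
  have "tight \<mu>"
    unfolding tight_def
  proof (intro conjI allI impI rd)
    fix \<epsilon> :: real assume "0 < \<epsilon>"
    obtain B where B: "\<And>t. t \<in> cantor \<Longrightarrow> \<bar>t\<bar> \<le> B" "0 < B"
      using compact_imp_bounded[OF compact_cantor] by (auto simp: bounded_pos)
    \<comment> \<open>Tightness is stated with intervals open on the left; the extra unit keeps a
      possible code at -B inside.\<close>
    have "measure (\<mu> n) {- B - 1<..B} = 1" for n
    proof -
      interpret real_distribution "\<mu> n" by (rule rd)
      have "measure (\<mu> n) {- B - 1<..B} = integral\<^sup>L (\<mu> n) (indicator {- B - 1<..B})" by simp
      also have "\<dots> = (\<Sum>g\<in>G n. w n g *\<^sub>R indicator {- B - 1<..B} (encode (Z n g)))" by (rule int_\<mu>) simp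
      also have "\<dots> = (\<Sum>g\<in>G n. w n g)"
      proof (intro sum.cong refl)
        fix g assume "g \<in> G n"
        then have "\<bar>encode (Z n g)\<bar> \<le> B" using Z by (intro B) (auto simp: cantor_def)
        then show "w n g *\<^sub>R indicator {- B - 1<..B} (encode (Z n g)) = w n g" by (auto simp: indicator_def)
      qed
      finally show ?thesis using w by simp
    qed
    then show "\<exists>a b. a < b \<and> (\<forall>n. 1 - \<epsilon> < measure (\<mu> n) {a<..b})"
      using \<open>0 < \<epsilon>\<close> B(2) by (intro exI[of _ "- B - 1"] exI[of _ B]) auto
  qed
  from tight_imp_convergent_subsubsequence[OF this strict_mono_id] obtain r M0
    where r: "strict_mono r" and M0: "real_distribution M0" and wc: "weak_conv_m (\<mu> \<circ> id \<circ> r) M0" by auto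
  interpret M0: real_distribution M0 by (rule M0)
  have wc': "weak_conv_m (\<lambda>n. \<mu> (r n)) M0" using wc by (simp add: comp_def)
  have conv: "(\<lambda>n. integral\<^sup>L (\<mu> (r n)) f) \<longlonglongrightarrow> integral\<^sup>L M0 f"
    if "\<And>x. isCont f x" "\<And>x. norm (f x) \<le> B" for f :: "real \<Rightarrow> 'b::{banach, second_countable_topology}" and B
    by (rule weak_conv_imp_integral_bdd_continuous_conv[OF rd M0 wc' that])
  have ne: "cantor \<noteq> {}" by (auto simp: cantor_def)
  have AEc: "AE t in M0. t \<in> cantor"
  proof -
    \<comment> \<open>The truncated distance to the Cantor set is bounded and continuous and has
      integral 0 for every approximant, so the limit is carried by the Cantor set.\<close>
    let ?f = "\<lambda>t. min 1 (infdist t cantor)"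
    have cont: "isCont ?f x" for x by (intro continuous_intros)
    have meas: "?f \<in> borel_measurable borel"
      by (intro borel_measurable_continuous_onI continuous_at_imp_continuous_on ballI cont)
    have "(\<lambda>n. integral\<^sup>L (\<mu> (r n)) ?f) \<longlonglongrightarrow> integral\<^sup>L M0 ?f"
      by (rule conv[of ?f 1]) (use cont in \<open>auto simp: infdist_nonneg\<close>)
    moreover have "integral\<^sup>L (\<mu> (r n)) ?f = 0" for n
      unfolding int_\<mu>[OF meas] using Z by (intro sum.neutral) (auto simp: cantor_def)
    ultimately have "integral\<^sup>L M0 ?f = 0" by (simp add: LIMSEQ_const_iff)
    moreover have "integrable M0 ?f"
      by (rule M0.integrable_const_bound[where B = 1]) (use meas in \<open>auto simp: infdist_nonneg\<close>)
    ultimately have "AE t in M0. ?f t = 0"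
      by (subst integral_nonneg_eq_0_iff_AE[symmetric]) (auto simp: infdist_nonneg)
    then show ?thesis
    proof eventually_elim
      case (elim t)
      then have "infdist t cantor = 0" by (simp add: min_def split: if_splits)
      then show ?case using in_closed_iff_infdist_zero[OF compact_imp_closed[OF compact_cantor] ne] by simp
    qed
  qed
  have md: "decode \<in> measurable M0 (config_borel (range e))" using measurable_decode by simp
  define M where "M = distr M0 (config_borel (range e)) decode"
  show thesis
  proof (rule that[OF r, of M])
    show "prob_space M" unfolding M_def by (rule M0.prob_space_distr[OF md])
    show "sets M = sets (config_borel (range e))" by (simp add: M_def)
    fix F :: "real set \<Rightarrow> complex"
    assume F: "continuous_on cantor (\<lambda>t. F (decode t))" and mF: "F \<in> borel_measurable (config_borel (range e))"
    obtain B where B: "\<And>t. t \<in> cantor \<Longrightarrow> norm (F (decode t)) \<le> B" "0 < B"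
      using compact_imp_bounded[OF compact_continuous_image[OF F compact_cantor]] by (auto simp: bounded_pos)
    \<comment> \<open>Weak convergence needs a bounded continuous function on the line, whereas F is
      controlled only on the Cantor set; Tietze's theorem extends it without enlarging the
      bound.\<close>
    obtain f where f: "continuous_on UNIV f" "\<And>t. t \<in> cantor \<Longrightarrow> f t = F (decode t)" "\<And>t. norm (f t) \<le> B"
      by (rule Tietze[OF F, of UNIV B]) (use B compact_imp_closed[OF compact_cantor] in auto)
    have mf: "f \<in> borel_measurable borel" using f(1) by (rule borel_measurable_continuous_onI)
    have "(\<lambda>n. integral\<^sup>L (\<mu> (r n)) f) \<longlonglongrightarrow> integral\<^sup>L M0 f"
      by (rule conv[of f B]) (use f in \<open>auto simp: continuous_on_eq_continuous_at\<close>)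
    moreover have "integral\<^sup>L (\<mu> (r n)) f = (\<Sum>g\<in>G (r n). of_real (w (r n) g) * F (Z (r n) g))" for n
    proof -
      have "f (encode (Z (r n) g)) = F (Z (r n) g)" if "g \<in> G (r n)" for g
        using f(2)[of "encode (Z (r n) g)"] Z[OF that] by (auto simp: cantor_def decode_encode)
      then show ?thesis unfolding int_\<mu>[OF mf] by (simp add: scaleR_conv_of_real)
    qed
    moreover have "integral\<^sup>L M0 f = integral\<^sup>L M F"
    proof -
      have "integral\<^sup>L M F = integral\<^sup>L M0 (\<lambda>t. F (decode t))" unfolding M_def by (rule integral_distr[OF md mF])
      also have "\<dots> = integral\<^sup>L M0 f"
        by (rule integral_cong_AE) (use AEc f(2) mf md mF in \<open>auto elim: eventually_mono\<close>)
      finally show ?thesis by simp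
    qed
    moreover have "integrable M F"
    proof -
      have "integrable M0 (\<lambda>t. F (decode t))"
      proof (rule M0.integrable_const_bound[where B = B])
        show "AE t in M0. norm (F (decode t)) \<le> B" using AEc by eventually_elim (rule B)
      qed (use md mF in auto)
      then show ?thesis unfolding M_def using integrable_distr_eq[OF md mF] by simp
    qed
    ultimately show "integrable M F \<and> (\<lambda>n. \<Sum>g\<in>G (r n). of_real (w (r n) g) * F (Z (r n) g)) \<longlonglongrightarrow> (LINT X|M. F X)"
      by simp
  qed
qed

end

lemma frac_aux: "c * (x * E) / (z * D) + c * (x * (x * E)) / (z * (z * D)) = c * (x / z + x / z * (x / z)) * (E / D)"
  for c :: real
  by (simp add: algebra_simps)

section \<open>Power sums as functions of the configuration\<close>

lemma has_sum_real_summable_abs: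
  fixes f :: "nat \<Rightarrow> real"
  assumes "summable (\<lambda>j. \<bar>f j\<bar>)"
  shows "(f has_sum suminf f) UNIV"
  by (rule norm_summable_imp_has_sum) (use assms summable_rabs_cancel in \<open>auto simp: summable_sums\<close>)

context
  fixes e :: "nat \<Rightarrow> real"
  assumes inj: "inj e" and nonzero: "\<And>j. e j \<noteq> 0" and summable_e: "summable (\<lambda>j. \<bar>e j\<bar>)"
begin

lemma summable_e_power: "summable (\<lambda>j. \<bar>e j ^ Suc k\<bar>)"
proof (rule summable_comparison_test_ev)
  have "(\<lambda>j. \<bar>e j\<bar>) \<longlonglongrightarrow> 0" by (rule summable_LIMSEQ_zero[OF summable_e])
  then have "\<forall>\<^sub>F j in sequentially. \<bar>e j\<bar> < 1" by (rule order_tendstoD) simp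
  then show "\<forall>\<^sub>F j in sequentially. norm \<bar>e j ^ Suc k\<bar> \<le> \<bar>e j\<bar>"
    by eventually_elim (simp add: power_abs abs_mult mult_left_le power_le_one)
qed (rule summable_e)

lemma power_sum_at_eq:
  assumes "X \<subseteq> range e"
  shows "power_sum_at X (Suc k) = bsum e (\<lambda>j. e j ^ Suc k) X"
proof -
  let ?f = "\<lambda>j. if e j \<in> X then e j ^ Suc k else 0"
  have "X = e ` {j. e j \<in> X}" using assms by auto
  then have "power_sum_at X (Suc k) = infsum (\<lambda>x. x ^ Suc k) (e ` {j. e j \<in> X})" by (simp add: power_sum_at_def)
  also have "\<dots> = infsum ((\<lambda>x. x ^ Suc k) \<circ> e) {j. e j \<in> X}"
    by (rule infsum_reindex[OF inj_on_subset[OF inj]]) simp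
  also have "\<dots> = infsum ?f UNIV" by (rule infsum_cong_neutral) auto
  also have "\<dots> = suminf ?f"
    by (intro infsumI has_sum_real_summable_abs summable_bsum[OF inj] summable_e_power)
  finally show ?thesis by (simp only: bsum_def[OF inj])
qed

lemma power_sum_at_LIMSEQ:
  assumes "X \<subseteq> range e"
  shows "(\<lambda>N. \<Sum>j<N. (if e j \<in> X then e j else 0) ^ Suc k) \<longlonglongrightarrow> power_sum_at X (Suc k)"
proof -
  let ?f = "\<lambda>j. if e j \<in> X then e j ^ Suc k else 0"
  have "?f sums suminf ?f" by (intro summable_sums summable_bsum[OF inj] summable_e_power)
  moreover have "(\<lambda>j. (if e j \<in> X then e j else 0) ^ Suc k) = ?f" by auto
  ultimately show ?thesis by (simp only: sums_def power_sum_at_eq[OF assms] bsum_def[OF inj])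
qed

lemma Sym_eval_config:
  assumes "X \<subseteq> range e"
  shows "Sym_eval (ps_series P) X = pval (psums X) P"
  by (rule Sym_eval_ps_series[OF power_sum_at_LIMSEQ[OF assms]])

lemma measurable_pval: "(\<lambda>X. pval (psums X) P) \<in> borel_measurable (config_borel (range e))"
proof -
  have "(\<lambda>X. psums X k) \<in> borel_measurable (config_borel (range e))" for k
  proof -
    have "(\<lambda>X. complex_of_real (bsum e (\<lambda>j. e j ^ Suc k) X)) \<in> borel_measurable (config_borel (range e))"
      using measurable_bsum[OF inj, of "\<lambda>j. e j ^ Suc k"] by measurable
    moreover have "complex_of_real (bsum e (\<lambda>j. e j ^ Suc k) X) = psums X k" if "X \<in> space (config_borel (range e))" for X
      using that power_sum_at_eq[of X k] by (simp add: psums_def space_config_borel[OF inj])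
    ultimately show ?thesis by (simp cong: measurable_cong)
  qed
  then show ?thesis unfolding pval_def poly_subst_def by measurable
qed

lemma continuous_pval: "continuous_on (cantor e) (\<lambda>t. pval (psums (decode e t)) P)"
proof -
  have "continuous_on (cantor e) (\<lambda>t. psums (decode e t) k)" for k
    unfolding psums_def power_sum_at_eq[OF decode_subset[OF inj]]
    by (intro continuous_on_of_real continuous_on_decode[OF inj] cfg_cont_bsum[OF inj] summable_e_power)
  then show ?thesis unfolding pval_def poly_subst_def by (intro continuous_intros) auto
qed

lemma pval_bounded: "\<exists>B. \<forall>X\<subseteq>range e. norm (pval (psums X) P) \<le> B"
proof -
  have "bounded ((\<lambda>t. pval (psums (decode e t)) P) ` cantor e)"
    by (intro compact_imp_bounded compact_continuous_image continuous_pval compact_cantor[OF inj])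
  then obtain B where B: "\<forall>z\<in>(\<lambda>t. pval (psums (decode e t)) P) ` cantor e. norm z \<le> B"
    unfolding bounded_iff by (rule exE)
  have "norm (pval (psums X) P) \<le> B" if "X \<subseteq> range e" for X
  proof -
    have "encode e X \<in> cantor e" using that by (simp add: cantor_def[OF inj])
    then have "pval (psums (decode e (encode e X))) P \<in> (\<lambda>t. pval (psums (decode e t)) P) ` cantor e" by (rule imageI)
    with B have "norm (pval (psums (decode e (encode e X))) P) \<le> B" by (rule bspec)
    then show ?thesis by (simp only: decode_encode[OF inj that])
  qed
  then show ?thesis by blast
qed

lemma integrable_pval:
  assumes "prob_space M" "sets M = sets (config_borel (range e))"
  shows "integrable M (\<lambda>X. pval (psums X) P)"
proof -
  interpret prob_space M by fact
  obtain B where B: "\<And>X. X \<subseteq> range e \<Longrightarrow> norm (pval (psums X) P) \<le> B" using pval_bounded by blast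
  have sp: "space M = Pow (range e)" using sets_eq_imp_space_eq[OF assms(2)] by (simp add: space_config_borel[OF inj])
  show ?thesis
  proof (rule integrable_const_bound[where B = B])
    show "AE X in M. norm (pval (psums X) P) \<le> B" using B by (intro AE_I2) (simp add: sp)
    show "(\<lambda>X. pval (psums X) P) \<in> borel_measurable M"
      using measurable_pval assms(2) by (simp cong: measurable_cong_sets)
  qed
qed

text \<open>High powers are dominated by the points of largest modulus at which X and Y differ.
  There may be two such points, of opposite signs, so an odd and the next even power sum are
  combined; dominated convergence then leaves twice the coefficient of one of them, which must be
  0.\<close>

lemma power_sums_separate:
  assumes X: "X \<subseteq> range e" and Y: "Y \<subseteq> range e"
    and eq: "\<And>k. power_sum_at X (Suc k) = power_sum_at Y (Suc k)"
  shows "X = Y"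
proof (rule ccontr)
  assume "X \<noteq> Y"
  define c :: "nat \<Rightarrow> real" where "c = (\<lambda>j. of_bool (e j \<in> X) - of_bool (e j \<in> Y))"
  obtain x where x: "x \<in> X \<longleftrightarrow> x \<notin> Y" using \<open>X \<noteq> Y\<close> by blast
  then obtain i where "x = e i" using X Y by blast
  with x have i: "c i \<noteq> 0" by (auto simp: c_def)
  let ?T = "{j. c j \<noteq> 0 \<and> \<bar>e i\<bar> \<le> \<bar>e j\<bar>}"
  have "(\<lambda>j. \<bar>e j\<bar>) \<longlonglongrightarrow> 0" by (rule summable_LIMSEQ_zero[OF summable_e])
  then have "\<forall>\<^sub>F j in sequentially. \<bar>e j\<bar> < \<bar>e i\<bar>" by (rule order_tendstoD) (simp add: nonzero)
  then obtain N where "\<And>j. j \<ge> N \<Longrightarrow> \<bar>e j\<bar> < \<bar>e i\<bar>" by (auto simp: eventually_at_top_linorder)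
  then have "?T \<subseteq> {..<N}" by (auto simp: not_le[symmetric])
  then have fin: "finite ?T" by (rule finite_subset) simp
  have "Max ((\<lambda>j. \<bar>e j\<bar>) ` ?T) \<in> (\<lambda>j. \<bar>e j\<bar>) ` ?T" using fin i by (intro Max_in) auto
  then obtain j0 where j0: "j0 \<in> ?T" "\<bar>e j0\<bar> = Max ((\<lambda>j. \<bar>e j\<bar>) ` ?T)" by auto
  have max: "\<bar>e j\<bar> \<le> \<bar>e j0\<bar>" if "c j \<noteq> 0" for j
  proof (cases "\<bar>e i\<bar> \<le> \<bar>e j\<bar>")
    case True
    then show ?thesis unfolding j0(2) using that fin by (intro Max_ge) auto
  next
    case False
    then show ?thesis using j0(1) by auto
  qed
  define r where "r = (\<lambda>j. e j / e j0)"
  \<comment> \<open>The factor vanishes at \<open>r j = - 1\<close>, so only \<open>e j0\<close> survives in the limit among the points of largest modulus.\<close>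
  define a where "a = (\<lambda>j n. c j * (r j + r j ^ 2) * (r j ^ 2) ^ n)"
  have c1: "\<bar>c j\<bar> \<le> 1" for j by (simp add: c_def)
  have r1: "\<bar>r j\<bar> \<le> 1" if "c j \<noteq> 0" for j
    using max[OF that] nonzero[of j0] by (simp add: r_def abs_divide divide_le_eq_1)
  have zero: "(\<Sum>j. a j n) = 0" for n
  proof -
    have s: "(\<lambda>j. c j * e j ^ Suc k) sums 0" for k
    proof -
      let ?f = "\<lambda>X j. if e j \<in> X then e j ^ Suc k else 0"
      have "?f X sums bsum e (\<lambda>j. e j ^ Suc k) X" "?f Y sums bsum e (\<lambda>j. e j ^ Suc k) Y"
        unfolding bsum_def[OF inj] by (intro summable_sums summable_bsum[OF inj] summable_e_power)+
      from sums_diff[OF this] have "(\<lambda>j. ?f X j - ?f Y j) sums 0"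
        using eq[of k] by (simp add: power_sum_at_eq[OF X] power_sum_at_eq[OF Y])
      moreover have "(\<lambda>j. ?f X j - ?f Y j) = (\<lambda>j. c j * e j ^ Suc k)" by (auto simp: c_def fun_eq_iff)
      ultimately show ?thesis by simp
    qed
    have "(\<lambda>j. c j * e j ^ Suc (2 * n) / e j0 ^ Suc (2 * n) + c j * e j ^ Suc (Suc (2 * n)) / e j0 ^ Suc (Suc (2 * n))) sums (0 / e j0 ^ Suc (2 * n) + 0 / e j0 ^ Suc (Suc (2 * n)))"
      by (intro sums_add sums_divide s)
    moreover have "c j * e j ^ Suc (2 * n) / e j0 ^ Suc (2 * n) + c j * e j ^ Suc (Suc (2 * n)) / e j0 ^ Suc (Suc (2 * n)) = a j n" for j
    proof -
      have "(r j ^ 2) ^ n = e j ^ (2 * n) / e j0 ^ (2 * n)" by (simp add: r_def power_mult[symmetric] power_divide)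
      then show ?thesis unfolding a_def power_Suc by (simp only: r_def frac_aux power2_eq_square)
    qed
    ultimately show ?thesis by (simp add: sums_iff)
  qed
  define b where "b = (\<lambda>j. if j = j0 then 2 * c j0 else 0)"
  have lim: "(\<lambda>n. a j n) \<longlonglongrightarrow> b j" for j
  proof -
    consider "j = j0" | "j \<noteq> j0" "c j = 0" | "j \<noteq> j0" "c j \<noteq> 0" "r j = -1" | "j \<noteq> j0" "c j \<noteq> 0" "r j \<noteq> -1" by blast
    then show ?thesis
    proof cases
      case 1
      then show ?thesis using nonzero[of j0] by (simp add: a_def b_def r_def mult.commute)
    next
      case 4
      have "r j \<noteq> 1" using 4(1) nonzero[of j0] inj_eq[OF inj, of j j0] by (auto simp: r_def)
      with 4 r1[of j] have "\<bar>r j\<bar> < 1" by linarith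
      then have "norm (r j ^ 2) < 1" by (simp add: power_less_one_iff abs_square_less_1)
      then have "(\<lambda>n. c j * (r j + r j ^ 2) * (r j ^ 2) ^ n) \<longlonglongrightarrow> c j * (r j + r j ^ 2) * 0"
        by (intro tendsto_mult tendsto_const LIMSEQ_power_zero)
      with 4 show ?thesis by (simp add: a_def b_def)
    qed (simp_all add: a_def b_def)
  qed
  have bound: "norm (a j n) \<le> 2 / \<bar>e j0\<bar> * \<bar>e j\<bar>" for j n
  proof (cases "c j = 0")
    case False
    note r = r1[OF False]
    have "\<bar>r j + r j ^ 2\<bar> \<le> \<bar>r j\<bar> + \<bar>r j\<bar> * \<bar>r j\<bar>"
      by (rule order_trans[OF abs_triangle_ineq]) (simp add: power2_eq_square abs_mult)
    also have "\<dots> \<le> 2 * \<bar>r j\<bar>" using mult_left_mono[OF r abs_ge_zero[of "r j"]] by simp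
    finally have 1: "\<bar>r j + r j ^ 2\<bar> \<le> 2 * \<bar>r j\<bar>" .
    have "r j ^ 2 \<le> 1" using r by (simp add: abs_square_le_1)
    then have 2: "\<bar>(r j ^ 2) ^ n\<bar> \<le> 1" by (simp add: power_le_one)
    have "norm (a j n) \<le> 1 * (2 * \<bar>r j\<bar>) * 1"
      unfolding a_def real_norm_def abs_mult by (intro mult_mono c1 1 2) auto
    then show ?thesis by (simp add: r_def abs_divide)
  qed (simp add: a_def)
  have ev: "\<forall>\<^sub>F (k, n) in sequentially \<times>\<^sub>F sequentially. norm (a k n) \<le> 2 / \<bar>e j0\<bar> * \<bar>e k\<bar>"
    by (rule always_eventually) (simp only: split_paired_All case_prod_conv bound simp_thms)
  have "(\<lambda>n. \<Sum>j. a j n) \<longlonglongrightarrow> suminf b"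
    using tannerys_theorem[OF lim ev summable_mult[OF summable_e]] by simp
  moreover have "suminf b = 2 * c j0"
    using sums_single[of j0 "\<lambda>_. 2 * c j0"] unfolding b_def by (simp add: sums_iff eq_commute[of j0])
  ultimately have "c j0 = 0" using zero by (simp add: LIMSEQ_const_iff)
  then show False using j0(1) by simp
qed

text \<open>Cylinders form an intersection-stable generator, and their indicators are continuous on
  the Cantor set, so they are uniform limits of functions whose integrals the two measures
  share.\<close>

theorem config_measure_unique:
  assumes M1: "prob_space M1" "sets M1 = sets (config_borel (range e))"
    and M2: "prob_space M2" "sets M2 = sets (config_borel (range e))"
    and eq: "\<And>P. (LINT X|M1. pval (psums X) P) = (LINT X|M2. pval (psums X) P)"
  shows "M1 = M2"
proof -
  interpret M1: prob_space M1 by (rule M1(1))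
  interpret M2: prob_space M2 by (rule M2(1))
  let ?C = "cantor e" and ?d = "decode e"
  \<comment> \<open>Real functions represented by polynomials with complex coefficients: closed
    under sums and products directly, and within the scope of the real Stone-Weierstrass
    theorem.\<close>
  define R where "R = {f :: real \<Rightarrow> real. continuous_on ?C f \<and> (\<exists>P. \<forall>t\<in>?C. complex_of_real (f t) = pval (psums (?d t)) P)}"
  interpret v: comm_ring_hom "pval p" for p by (rule pval_hom)
  have RI: "f \<in> R" if "\<And>t. t \<in> ?C \<Longrightarrow> complex_of_real (f t) = pval (psums (?d t)) P" for f P
  proof -
    have "continuous_on ?C (\<lambda>t. Re (pval (psums (?d t)) P))"
      by (intro continuous_on_Re continuous_pval)
    moreover have "Re (pval (psums (?d t)) P) = f t" if "t \<in> ?C" for t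
      using \<open>\<And>t. t \<in> ?C \<Longrightarrow> complex_of_real (f t) = pval (psums (?d t)) P\<close>[OF that, symmetric] by simp
    ultimately have "continuous_on ?C f" by (simp cong: continuous_on_cong)
    with that show ?thesis unfolding R_def by blast
  qed
  interpret R: function_ring_on R ?C
  proof
    show "compact ?C" by (rule compact_cantor[OF inj])
    show "continuous_on ?C f" if "f \<in> R" for f using that by (simp add: R_def)
    show "(\<lambda>x. f x + g x) \<in> R" "(\<lambda>x. f x * g x) \<in> R" if fg: "f \<in> R" "g \<in> R" for f g
    proof -
      obtain P Q where "\<And>t. t \<in> ?C \<Longrightarrow> complex_of_real (f t) = pval (psums (?d t)) P"
        "\<And>t. t \<in> ?C \<Longrightarrow> complex_of_real (g t) = pval (psums (?d t)) Q"
        using fg by (auto simp: R_def)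
      then show "(\<lambda>x. f x + g x) \<in> R" "(\<lambda>x. f x * g x) \<in> R"
        using RI[of "\<lambda>x. f x + g x" "P + Q"] RI[of "\<lambda>x. f x * g x" "P * Q"]
        by (simp_all add: v.hom_add v.hom_mult)
    qed
    show "(\<lambda>_. c) \<in> R" for c by (rule RI[of _ "pconst (of_real c)"]) simp
    fix x y assume xy: "x \<in> ?C" "y \<in> ?C" "x \<noteq> y"
    then have "?d x \<noteq> ?d y" using encode_decode[OF inj] by metis
    then obtain k where k: "power_sum_at (?d x) (Suc k) \<noteq> power_sum_at (?d y) (Suc k)"
      using power_sums_separate[OF decode_subset[OF inj] decode_subset[OF inj]] by blast
    have kR: "(\<lambda>t. power_sum_at (?d t) (Suc k)) \<in> R"
      by (rule RI[of _ "pvar k"]) (simp add: psums_def)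
    show "\<exists>f\<in>R. f x \<noteq> f y" by (rule bexI[OF _ kR]) (rule k)
  qed
  have close: "\<bar>measure M (cylinder e F) - Re (LINT X|M. pval (psums X) P)\<bar> \<le> \<epsilon>"
    if M: "prob_space M" "sets M = sets (config_borel (range e))" and F: "cylinder e F \<in> sets M"
      and g: "\<And>t. t \<in> ?C \<Longrightarrow> complex_of_real (g t) = pval (psums (?d t)) P"
        "\<And>t. t \<in> ?C \<Longrightarrow> \<bar>indicator (cylinder e F) (?d t) - g t\<bar> < \<epsilon>" for M F P g \<epsilon>
  proof -
    interpret prob_space M by (rule M(1))
    have sp: "space M = Pow (range e)" using sets_eq_imp_space_eq[OF M(2)] by (simp add: space_config_borel[OF inj])
    have iP: "integrable M (\<lambda>X. pval (psums X) P)" by (rule integrable_pval[OF M])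
    then have iR: "integrable M (\<lambda>X. Re (pval (psums X) P))" by simp
    have iI: "integrable M (indicator (cylinder e F) :: _ \<Rightarrow> real)"
      by (intro integrable_real_indicator F) (simp add: emeasure_eq_measure)
    have pt: "\<bar>indicator (cylinder e F) X - Re (pval (psums X) P)\<bar> \<le> \<epsilon>" if "X \<in> space M" for X
    proof -
      have X: "X \<subseteq> range e" using that sp by simp
      then have "encode e X \<in> ?C" "?d (encode e X) = X" by (auto simp: cantor_def[OF inj] decode_encode[OF inj])
      with g[of "encode e X"] show ?thesis by (metis Re_complex_of_real less_imp_le)
    qed
    have "measure M (cylinder e F) - Re (LINT X|M. pval (psums X) P) = (LINT X|M. indicator (cylinder e F) X - Re (pval (psums X) P))"
      using iR iI iP F by simp
    moreover have "(LINT X|M. indicator (cylinder e F) X - Re (pval (psums X) P)) \<le> (LINT X|M. \<epsilon>)"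
      by (rule integral_mono) (use iR iI pt in \<open>auto simp: abs_le_iff\<close>)
    moreover have "(LINT X|M. - \<epsilon>) \<le> (LINT X|M. indicator (cylinder e F) X - Re (pval (psums X) P))"
      by (rule integral_mono) (use iR iI pt in \<open>force simp: abs_le_iff\<close>)+
    ultimately show ?thesis by (simp add: prob_space)
  qed
  have cyls_eq: "emeasure M1 U = emeasure M2 U" if U: "U \<in> cylinders e" for U
  proof -
    obtain F where F: "U = cylinder e F" "finite F" "F \<subseteq> range e" using U unfolding cylinders_def[OF inj] by blast
    have Us: "U \<in> sets (config_borel (range e))" unfolding sets_config_borel[OF inj] using U by (rule sigma_sets.Basic)
    have "\<bar>measure M1 U - measure M2 U\<bar> \<le> \<epsilon>" if "0 < \<epsilon>" for \<epsilon>
    proof -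
      have "continuous_on ?C (\<lambda>t. indicator (cylinder e F) (?d t) :: real)"
        by (rule continuous_on_decode[OF inj cfg_cont_indicator[OF inj F(2,3)]])
      moreover have "0 < \<epsilon> / 2" using that by simp
      ultimately obtain g where g: "g \<in> R" "\<forall>t\<in>?C. \<bar>indicator (cylinder e F) (?d t) - g t\<bar> < \<epsilon> / 2"
        using R.Stone_Weierstrass_basic by blast
      then obtain P where P: "\<And>t. t \<in> ?C \<Longrightarrow> complex_of_real (g t) = pval (psums (?d t)) P" by (auto simp: R_def)
      have "\<bar>measure M1 U - Re (LINT X|M1. pval (psums X) P)\<bar> \<le> \<epsilon> / 2"
        unfolding F(1) by (rule close[OF M1 _ P]) (use Us F M1(2) g in auto)
      moreover have "\<bar>measure M2 U - Re (LINT X|M2. pval (psums X) P)\<bar> \<le> \<epsilon> / 2"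
        unfolding F(1) by (rule close[OF M2 _ P]) (use Us F M2(2) g in auto)
      ultimately show ?thesis unfolding eq[of P] by linarith
    qed
    then have "measure M1 U = measure M2 U" by (metis abs_le_zero_iff field_le_epsilon add_0 eq_iff_diff_eq_0)
    then show ?thesis by (simp add: M1.emeasure_eq_measure M2.emeasure_eq_measure)
  qed
  show ?thesis
  proof (rule measure_eqI_generator_eq[where E = "cylinders e" and \<Omega> = "Pow (range e)" and A = "\<lambda>_. Pow (range e)"])
    show "Int_stable (cylinders e)"
    proof (rule Int_stableI)
      fix A B assume "A \<in> cylinders e" "B \<in> cylinders e"
      then obtain F G where "A = cylinder e F" "finite F" "F \<subseteq> range e" "B = cylinder e G" "finite G" "G \<subseteq> range e"
        unfolding cylinders_def[OF inj] by blast
      moreover have "cylinder e F \<inter> cylinder e G = cylinder e (F \<union> G)" by (auto simp: cylinder_def[OF inj])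
      ultimately show "A \<inter> B \<in> cylinders e" unfolding cylinders_def[OF inj] by blast
    qed
    show "range (\<lambda>_. Pow (range e)) \<subseteq> cylinders e"
      unfolding cylinders_def[OF inj] by (auto intro!: exI[of _ "{}"] simp: cylinder_def[OF inj])
    show "emeasure M1 (Pow (range e)) \<noteq> \<infinity>" for i :: nat
      by simp
  qed (use cylinders_sub[OF inj] cyls_eq M1(2) M2(2) sets_config_borel[OF inj] in auto)
qed

end

section \<open>Asymptotic comparison of expectations\<close>

text \<open>Asymptotic equality uniform over the ensemble, so that weighted averages inherit it. The
  common bound makes the relation stable under products, and thus under determinants.\<close>

definition near :: "(nat \<Rightarrow> 'g set) \<Rightarrow> (nat \<Rightarrow> 'g \<Rightarrow> complex) \<Rightarrow> (nat \<Rightarrow> 'g \<Rightarrow> complex) \<Rightarrow> bool" where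
  "near G u v \<longleftrightarrow> (\<exists>B \<delta>. 0 \<le> B \<and> \<delta> \<longlonglongrightarrow> (0::real) \<and> (\<forall>\<^sub>F n in sequentially. \<forall>g\<in>G n.
     norm (u n g) \<le> B \<and> norm (v n g) \<le> B \<and> norm (u n g - v n g) \<le> \<delta> n))"

lemma nearI:
  assumes "0 \<le> B" "\<delta> \<longlonglongrightarrow> 0"
    "\<forall>\<^sub>F n in sequentially. \<forall>g\<in>G n. norm (u n g) \<le> B \<and> norm (v n g) \<le> B \<and> norm (u n g - v n g) \<le> \<delta> n"
  shows "near G u v"
  using assms unfolding near_def by blast

lemma near_const:
  assumes "c \<longlonglongrightarrow> l"
  shows "near G (\<lambda>n _. c n) (\<lambda>_ _. l)"
proof (rule nearI)
  show "0 \<le> norm l + 1" by simp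
  show "(\<lambda>n. norm (c n - l)) \<longlonglongrightarrow> 0" using tendsto_norm_zero[OF LIM_zero[OF assms]] .
  have "\<forall>\<^sub>F n in sequentially. norm (c n) < norm l + 1"
    by (rule order_tendstoD(2)[OF tendsto_norm[OF assms]]) simp
  then show "\<forall>\<^sub>F n in sequentially. \<forall>g\<in>G n. norm (c n) \<le> norm l + 1 \<and> norm l \<le> norm l + 1 \<and> norm (c n - l) \<le> norm (c n - l)"
    by eventually_elim simp
qed

lemma near_add:
  assumes "near G u v" "near G u' v'"
  shows "near G (\<lambda>n g. u n g + u' n g) (\<lambda>n g. v n g + v' n g)"
proof -
  obtain B \<delta> where 1: "0 \<le> B" "\<delta> \<longlonglongrightarrow> 0"
    "\<forall>\<^sub>F n in sequentially. \<forall>g\<in>G n. norm (u n g) \<le> B \<and> norm (v n g) \<le> B \<and> norm (u n g - v n g) \<le> \<delta> n"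
    using assms(1) unfolding near_def by blast
  obtain B' \<delta>' where 2: "0 \<le> B'" "\<delta>' \<longlonglongrightarrow> 0"
    "\<forall>\<^sub>F n in sequentially. \<forall>g\<in>G n. norm (u' n g) \<le> B' \<and> norm (v' n g) \<le> B' \<and> norm (u' n g - v' n g) \<le> \<delta>' n"
    using assms(2) unfolding near_def by blast
  show ?thesis
  proof (rule nearI)
    show "0 \<le> B + B'" using 1 2 by simp
    show "(\<lambda>n. \<delta> n + \<delta>' n) \<longlonglongrightarrow> 0" using tendsto_add[OF 1(2) 2(2)] by simp
    show "\<forall>\<^sub>F n in sequentially. \<forall>g\<in>G n. norm (u n g + u' n g) \<le> B + B' \<and> norm (v n g + v' n g) \<le> B + B' \<and>
        norm (u n g + u' n g - (v n g + v' n g)) \<le> \<delta> n + \<delta>' n"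
      using 1(3) 2(3)
    proof eventually_elim
      case (elim n)
      show ?case
      proof
        fix g assume "g \<in> G n"
        with elim have b: "norm (u n g) \<le> B" "norm (v n g) \<le> B" "norm (u n g - v n g) \<le> \<delta> n"
          "norm (u' n g) \<le> B'" "norm (v' n g) \<le> B'" "norm (u' n g - v' n g) \<le> \<delta>' n" by auto
        show "norm (u n g + u' n g) \<le> B + B' \<and> norm (v n g + v' n g) \<le> B + B' \<and>
            norm (u n g + u' n g - (v n g + v' n g)) \<le> \<delta> n + \<delta>' n"
          unfolding add_diff_add by (intro conjI norm_triangle_mono b)
      qed
    qed
  qed
qed

lemma near_mult:
  assumes "near G u v" "near G u' v'"
  shows "near G (\<lambda>n g. u n g * u' n g) (\<lambda>n g. v n g * v' n g)"
proof -
  obtain B \<delta> where 1: "0 \<le> B" "\<delta> \<longlonglongrightarrow> 0"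
    "\<forall>\<^sub>F n in sequentially. \<forall>g\<in>G n. norm (u n g) \<le> B \<and> norm (v n g) \<le> B \<and> norm (u n g - v n g) \<le> \<delta> n"
    using assms(1) unfolding near_def by blast
  obtain B' \<delta>' where 2: "0 \<le> B'" "\<delta>' \<longlonglongrightarrow> 0"
    "\<forall>\<^sub>F n in sequentially. \<forall>g\<in>G n. norm (u' n g) \<le> B' \<and> norm (v' n g) \<le> B' \<and> norm (u' n g - v' n g) \<le> \<delta>' n"
    using assms(2) unfolding near_def by blast
  show ?thesis
  proof (rule nearI)
    show "0 \<le> B * B'" using 1 2 by simp
    have "(\<lambda>n. B * \<delta>' n + \<delta> n * B') \<longlonglongrightarrow> B * 0 + 0 * B'" by (intro tendsto_intros 1(2) 2(2))
    then show "(\<lambda>n. B * \<delta>' n + \<delta> n * B') \<longlonglongrightarrow> 0" by simp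
    show "\<forall>\<^sub>F n in sequentially. \<forall>g\<in>G n. norm (u n g * u' n g) \<le> B * B' \<and> norm (v n g * v' n g) \<le> B * B' \<and>
        norm (u n g * u' n g - v n g * v' n g) \<le> B * \<delta>' n + \<delta> n * B'"
      using 1(3) 2(3)
    proof eventually_elim
      case (elim n)
      show ?case
      proof
        fix g assume "g \<in> G n"
        with elim have b: "norm (u n g) \<le> B" "norm (v n g) \<le> B" "norm (u n g - v n g) \<le> \<delta> n"
          "norm (u' n g) \<le> B'" "norm (v' n g) \<le> B'" "norm (u' n g - v' n g) \<le> \<delta>' n" by auto
        have "u n g * u' n g - v n g * v' n g = u n g * (u' n g - v' n g) + (u n g - v n g) * v' n g"
          by (simp add: algebra_simps)
        moreover have "norm (u n g * (u' n g - v' n g)) \<le> B * \<delta>' n" "norm ((u n g - v n g) * v' n g) \<le> \<delta> n * B'"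
          "norm (u n g * u' n g) \<le> B * B'" "norm (v n g * v' n g) \<le> B * B'"
          unfolding norm_mult using b 1(1) 2(1) order_trans[OF norm_ge_zero b(3)] by (auto intro!: mult_mono)
        ultimately show "norm (u n g * u' n g) \<le> B * B' \<and> norm (v n g * v' n g) \<le> B * B' \<and>
            norm (u n g * u' n g - v n g * v' n g) \<le> B * \<delta>' n + \<delta> n * B'"
          by (simp add: norm_triangle_mono)
      qed
    qed
  qed
qed

lemma near_diff:
  assumes "near G u v" "near G u' v'"
  shows "near G (\<lambda>n g. u n g - u' n g) (\<lambda>n g. v n g - v' n g)"
  using near_add[OF assms(1) near_mult[OF near_const[OF tendsto_const[of "- 1"]] assms(2)]] by simp

lemma near_sum: "(\<And>i. i \<in> I \<Longrightarrow> near G (\<lambda>n g. u i n g) (\<lambda>n g. v i n g)) \<Longrightarrow>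
    near G (\<lambda>n g. \<Sum>i\<in>I. u i n g) (\<lambda>n g. \<Sum>i\<in>I. v i n g)"
  by (induction I rule: infinite_finite_induct) (simp_all add: near_const near_add)

lemma near_prod: "(\<And>i. i \<in> I \<Longrightarrow> near G (\<lambda>n g. u i n g) (\<lambda>n g. v i n g)) \<Longrightarrow>
    near G (\<lambda>n g. \<Prod>i\<in>I. u i n g) (\<lambda>n g. \<Prod>i\<in>I. v i n g)"
  by (induction I rule: infinite_finite_induct) (simp_all add: near_const near_mult)

lemma near_hsym:
  assumes "\<And>r. near G (\<lambda>n g. p n g r) (\<lambda>n g. P n g r)"
  shows "near G (\<lambda>n g. hsym (\<lambda>a. a) (p n g) m) (\<lambda>n g. hsym (\<lambda>a. a) (P n g) m)"
proof (induction m rule: less_induct)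
  case (less m)
  show ?case
  proof (cases m)
    case 0 then show ?thesis by (simp add: near_const)
  next
    case (Suc k)
    show ?thesis unfolding Suc hsym.simps
      by (intro near_mult near_sum near_const tendsto_const assms less) (simp add: Suc)
  qed
qed

lemma near_jt:
  assumes "\<And>i r. i < m \<Longrightarrow> near G (\<lambda>n g. p n g i r) (\<lambda>n g. P n g i r)"
  shows "near G (\<lambda>n g. jt (\<lambda>a. a) m mu (p n g)) (\<lambda>n g. jt (\<lambda>a. a) m mu (P n g))"
  unfolding jt_def det_mat_leibniz hsym_int_def
proof (intro near_sum near_mult near_prod near_const tendsto_const, goal_cases)
  case (1 \<pi> i)
  then show ?case
    by (cases "int (mu i) - int i + int (\<pi> i) < 0") (simp_all add: near_const near_hsym assms)
qed

lemma near_weighted: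
  assumes uv: "near G u v" and fin: "\<And>n. finite (G n)"
    and w: "\<And>n g. g \<in> G n \<Longrightarrow> 0 \<le> w n g" "\<And>n. (\<Sum>g\<in>G n. w n g) = 1"
  shows "(\<lambda>n. (\<Sum>g\<in>G n. complex_of_real (w n g) * u n g) - (\<Sum>g\<in>G n. of_real (w n g) * v n g)) \<longlonglongrightarrow> 0"
proof -
  obtain B \<delta> where 1: "\<delta> \<longlonglongrightarrow> 0"
    "\<forall>\<^sub>F n in sequentially. \<forall>g\<in>G n. norm (u n g) \<le> B \<and> norm (v n g) \<le> B \<and> norm (u n g - v n g) \<le> \<delta> n"
    using uv unfolding near_def by blast
  show ?thesis
  proof (rule Lim_null_comparison[OF _ 1(1)])
    show "\<forall>\<^sub>F n in sequentially. norm ((\<Sum>g\<in>G n. complex_of_real (w n g) * u n g) - (\<Sum>g\<in>G n. of_real (w n g) * v n g)) \<le> \<delta> n"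
      using 1(2)
    proof eventually_elim
      case (elim n)
      have "norm ((\<Sum>g\<in>G n. complex_of_real (w n g) * u n g) - (\<Sum>g\<in>G n. of_real (w n g) * v n g))
         = norm (\<Sum>g\<in>G n. complex_of_real (w n g) * (u n g - v n g))"
        by (simp add: sum_subtractf right_diff_distrib)
      also have "\<dots> \<le> (\<Sum>g\<in>G n. w n g * \<delta> n)"
        by (rule sum_norm_le) (use elim w(1) in \<open>auto simp: norm_mult intro!: mult_left_mono\<close>)
      also have "\<dots> = \<delta> n" using w(2)[of n] by (simp add: sum_distrib_right[symmetric])
      finally show ?case .
    qed
  qed
qed

lemma det_mat_leibniz_transpose:
  "Determinant.det (mat n n (\<lambda>(i, j). G i j))
     = (\<Sum>p\<in>{p. p permutes {0..<n}}. signof p * (\<Prod>j = 0..<n. G (p j) j))" for G :: "nat \<Rightarrow> nat \<Rightarrow> 'a::comm_ring_1"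
proof -
  have "transpose_mat (mat n n (\<lambda>(i, j). G i j)) = mat n n (\<lambda>(j, i). G i j)" by (rule eq_matI) auto
  then have "Determinant.det (mat n n (\<lambda>(i, j). G i j)) = Determinant.det (mat n n (\<lambda>(j, i). G i j))"
    using det_transpose[of "mat n n (\<lambda>(i, j). G i j)" n] by simp
  then show ?thesis by (simp only: det_mat_leibniz)
qed

text \<open>As in Andreief's identity, expanding both determinants makes the sum over all tuples
  factor into univariate sums; in every term one factor pairs the row \<open>i0\<close> with some
  row of the other determinant.\<close>

lemma andreief_zero:
  fixes a b :: "nat \<Rightarrow> nat \<Rightarrow> 'a::comm_ring_1"
  assumes i0: "i0 < N" and orth: "\<And>i. i < N \<Longrightarrow> (\<Sum>k\<le>K. w k * a i0 k * b i k) = 0"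
  shows "(\<Sum>g\<in>PiE {0..<N} (\<lambda>_. {..K}). (\<Prod>j=0..<N. w (g j)) * Determinant.det (mat N N (\<lambda>(i, j). a i (g j)))
      * Determinant.det (mat N N (\<lambda>(i, j). b i (g j)))) = 0"
proof -
  let ?P = "{p. p permutes {0..<N}}" and ?X = "PiE {0..<N} (\<lambda>_. {..K})"
  have "(\<Sum>g\<in>?X. (\<Prod>j=0..<N. w (g j)) * Determinant.det (mat N N (\<lambda>(i, j). a i (g j))) * Determinant.det (mat N N (\<lambda>(i, j). b i (g j))))
    = (\<Sum>g\<in>?X. \<Sum>p\<in>?P. \<Sum>t\<in>?P. signof p * signof t * (\<Prod>j=0..<N. w (g j) * a (p j) (g j) * b (t j) (g j)))"
    unfolding det_mat_leibniz_transpose mult.assoc[of "prod _ _"] sum_product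
    unfolding sum_distrib_left by (simp add: prod.distrib ac_simps)
  also have "\<dots> = (\<Sum>p\<in>?P. \<Sum>t\<in>?P. signof p * signof t * (\<Sum>g\<in>?X. \<Prod>j=0..<N. w (g j) * a (p j) (g j) * b (t j) (g j)))"
    unfolding sum_distrib_left by (subst sum.swap, rule sum.cong[OF refl], subst sum.swap, rule refl)
  also have "\<dots> = (\<Sum>p\<in>?P. \<Sum>t\<in>?P. signof p * signof t * (\<Prod>j=0..<N. \<Sum>k\<le>K. w k * a (p j) k * b (t j) k))"
    by (subst prod_sum_PiE) auto
  also have "\<dots> = 0"
  proof (intro sum.neutral ballI)
    fix p t assume p: "p \<in> ?P" and t: "t \<in> ?P"
    then have pp: "p permutes {0..<N}" and tp: "t permutes {0..<N}" by auto
    have "inv_into UNIV p i0 < N" by (rule permutes_lessThan_less[OF permutes_inv[OF pp] i0])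
    moreover have "(\<Sum>k\<le>K. w k * a (p (inv_into UNIV p i0)) k * b (t (inv_into UNIV p i0)) k) = 0"
      unfolding permutes_inverses(1)[OF pp]
      by (rule orth) (rule permutes_lessThan_less[OF tp \<open>inv_into UNIV p i0 < N\<close>])
    ultimately have "(\<Prod>j=0..<N. \<Sum>k\<le>K. w k * a (p j) k * b (t j) k) = 0"
      by (intro prod_zero) auto
    then show "signof p * signof t * (\<Prod>j=0..<N. \<Sum>k\<le>K. w k * a (p j) k * b (t j) k) = 0" by simp
  qed
  finally show ?thesis .
qed

lemma abs_power_diff_le:
  fixes a b B :: real
  assumes "\<bar>a\<bar> \<le> B" "\<bar>b\<bar> \<le> B"
  shows "\<bar>a ^ Suc k - b ^ Suc k\<bar> \<le> real (Suc k) * B ^ k * \<bar>a - b\<bar>"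
proof (induction k)
  case (Suc k)
  have B: "0 \<le> B" using assms(1) by simp
  have "a ^ Suc (Suc k) - b ^ Suc (Suc k) = a * (a ^ Suc k - b ^ Suc k) + (a - b) * b ^ Suc k"
    by (simp add: algebra_simps)
  then have "\<bar>a ^ Suc (Suc k) - b ^ Suc (Suc k)\<bar> \<le> \<bar>a\<bar> * \<bar>a ^ Suc k - b ^ Suc k\<bar> + \<bar>a - b\<bar> * \<bar>b\<bar> ^ Suc k"
    by (metis abs_mult abs_triangle_ineq power_abs)
  also have "\<dots> \<le> B * (real (Suc k) * B ^ k * \<bar>a - b\<bar>) + \<bar>a - b\<bar> * B ^ Suc k"
    using assms B Suc by (intro add_mono mult_mono power_mono) auto
  also have "\<dots> = real (Suc (Suc k)) * B ^ Suc k * \<bar>a - b\<bar>" by (simp add: algebra_simps)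
  finally show ?case .
qed simp

section \<open>The finite ensembles\<close>

locale q_racah =
  fixes q \<zeta> :: real and L R :: int and s0 s1 s2 s3 :: complex
  assumes q: "0 < q" "q < 1" and adm: "admissible q \<zeta> L R s0 s1 s2 s3"
begin

lemma zeta_pos: "0 < \<zeta>" and LR: "R \<le> L"
  and s2: "s2 = complex_of_real (- \<zeta> * q powi R)" and s3: "s3 = complex_of_real (inverse \<zeta> * q powi (- L))"
  using adm by (auto simp: admissible_def)

lemma adm_cases:
  obtains (conj) "s0 = cnj s1" "s0 \<notin> \<real>"
  | (pos) a b m where "s0 = complex_of_real a" "s1 = complex_of_real b"
      "inverse \<zeta> * q powi (m + 1) < a" "a < inverse \<zeta> * q powi m" "inverse \<zeta> * q powi (m + 1) < b" "b < inverse \<zeta> * q powi m"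
  | (neg) a b m where "s0 = complex_of_real a" "s1 = complex_of_real b"
      "- \<zeta> * q powi m < a" "a < - \<zeta> * q powi (m + 1)" "- \<zeta> * q powi m < b" "b < - \<zeta> * q powi (m + 1)"
  using adm unfolding admissible_def greaterThanLessThan_iff by metis

lemma powi_pos: "0 < q powi i"
  using q by simp

lemma powi_le: "i \<le> j \<Longrightarrow> q powi j \<le> q powi i"
  using q by (intro power_int_decreasing) auto

lemma powi_less: "i < j \<Longrightarrow> q powi j < q powi i"
  using q by (intro power_int_strict_decreasing) auto

lemma powi_add: "q powi (i + j) = q powi i * q powi j"
  using q by (intro power_int_add) auto

lemma powi_add_nat: "q powi (i + int k) = q powi i * q ^ k"
  by (simp only: powi_add power_int_of_nat)

text \<open>Together with s2 s3 < 0 this makes s0 s1 s2 s3 negative, so the factors 1 - s0 s1 s2 s3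
  q^i / T^2 in the denominators of the moments never vanish.\<close>

lemma s0_s1_pos: "\<exists>c>0. s0 * s1 = complex_of_real c"
proof (cases rule: adm_cases)
  case conj
  then have "s0 * s1 = complex_of_real ((norm s1)\<^sup>2)" by (simp only: complex_norm_square mult.commute)
  moreover have "s1 \<noteq> 0" using conj by auto
  ultimately show ?thesis by (intro exI[of _ "(norm s1)\<^sup>2"]) simp
next
  case (pos a b m)
  have "0 < inverse \<zeta> * q powi (m + 1)" using zeta_pos powi_pos by simp
  with pos have "0 < a" "0 < b" by linarith+
  with pos show ?thesis by (intro exI[of _ "a * b"]) simp
next
  case (neg a b m)
  have "0 < \<zeta> * q powi (m + 1)" using zeta_pos powi_pos by simp
  with neg have "a < 0" "b < 0" by linarith+
  with neg show ?thesis by (intro exI[of _ "a * b"]) (simp add: mult_neg_neg)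
qed

lemma s01_nonzero: "s0 \<noteq> 0" "s1 \<noteq> 0"
  using s0_s1_pos by auto

section \<open>Nodes and positive weights of the univariate polynomials\<close>

definition ynode :: "nat \<Rightarrow> real" where "ynode k = \<zeta> * q powi (R + int k)"
text \<open>The solution K of s3 y_K = q^(N-1), the condition that ends the telescoping sum; there
  are N + L - R nodes.\<close>

definition last_index :: "nat \<Rightarrow> nat" where "last_index N = N - 1 + nat (L - R)"
definition top_power :: "nat \<Rightarrow> real" where "top_power N = q ^ (N - 1)"
definition racah_node :: "nat \<Rightarrow> nat \<Rightarrow> real" where "racah_node N k = ynode k - top_power N / ynode k"

lemma ynode_pos: "0 < ynode k" and top_power_pos: "0 < top_power N"
  using q zeta_pos by (simp_all add: ynode_def top_power_def)

lemma ynode_Suc: "ynode (Suc k) = q * ynode k"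
proof -
  have "R + int (Suc k) = R + int k + 1" by simp
  then show ?thesis unfolding ynode_def by (simp only: powi_add[of _ 1]) simp
qed

text \<open>For conjugate parameters both products are squared moduli, nonzero because
  \<open>s0\<close> is not real. For positive parameters the zeros T/y_k of the linear factors lie
  on the lattice zeta^(-1) q^Z, for negative ones the points -q y_k lie on -zeta q^Z; both
  parameters lie in one open gap of that lattice, so the two factors have equal signs.\<close>

lemma rho_exists: "\<exists>\<rho>>0. complex_of_real \<rho> * ((s0 + of_real (q * ynode k)) * (s1 + of_real (q * ynode k)))
    = (of_real (top_power N) - s0 * of_real (ynode k)) * (of_real (top_power N) - s1 * of_real (ynode k))"
proof -
  have qy: "q * ynode k = \<zeta> * q powi (R + int k + 1)"
    unfolding ynode_Suc[symmetric] by (simp add: ynode_def add.assoc add.commute[of 1])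
  have T: "top_power N = q powi (int (N - 1))" by (simp only: top_power_def power_int_of_nat)
  have real_case: ?thesis
    if "s0 = complex_of_real a" "s1 = complex_of_real b"
      "0 < (top_power N - a * ynode k) * (top_power N - b * ynode k)" "0 < (a + q * ynode k) * (b + q * ynode k)" for a b
  proof (intro exI conjI)
    show "0 < (top_power N - a * ynode k) * (top_power N - b * ynode k) / ((a + q * ynode k) * (b + q * ynode k))"
      using that(3,4) by (rule divide_pos_pos)
    have "(top_power N - a * ynode k) * (top_power N - b * ynode k) / ((a + q * ynode k) * (b + q * ynode k)) * ((a + q * ynode k) * (b + q * ynode k))
        = (top_power N - a * ynode k) * (top_power N - b * ynode k)"
      using that(4) by (intro nonzero_eq_divide_eq[THEN iffD1]) auto
    then have "complex_of_real ((top_power N - a * ynode k) * (top_power N - b * ynode k) / ((a + q * ynode k) * (b + q * ynode k)) * ((a + q * ynode k) * (b + q * ynode k)))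
        = complex_of_real ((top_power N - a * ynode k) * (top_power N - b * ynode k))" by (rule arg_cong)
    then show "complex_of_real ((top_power N - a * ynode k) * (top_power N - b * ynode k) / ((a + q * ynode k) * (b + q * ynode k))) * ((s0 + of_real (q * ynode k)) * (s1 + of_real (q * ynode k)))
        = (of_real (top_power N) - s0 * of_real (ynode k)) * (of_real (top_power N) - s1 * of_real (ynode k))"
      unfolding that(1,2) by (simp only: of_real_mult of_real_add of_real_diff)
  qed
  show ?thesis
  proof (cases rule: adm_cases)
    case conj
    have s1: "s1 = cnj s0" using conj(1) by simp
    let ?n = "of_real (top_power N) - s0 * of_real (ynode k)" and ?d = "s0 + of_real (q * ynode k)"
    have "?n \<noteq> 0"
    proof
      assume "?n = 0"
      then have "s0 = of_real (top_power N / ynode k)" using ynode_pos[of k] by (simp add: field_simps)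
      then show False using conj(2) by simp
    qed
    moreover have "?d \<noteq> 0"
    proof
      assume "?d = 0"
      then have "s0 = of_real (- (q * ynode k))" by (simp add: add_eq_0_iff)
      then show False using conj(2) by simp
    qed
    ultimately have pos: "0 < (norm ?n)\<^sup>2 / (norm ?d)\<^sup>2" by simp
    have n: "?n * (of_real (top_power N) - s1 * of_real (ynode k)) = of_real ((norm ?n)\<^sup>2)"
      unfolding s1 complex_norm_square by simp
    have d: "?d * (s1 + of_real (q * ynode k)) = of_real ((norm ?d)\<^sup>2)"
      unfolding s1 complex_norm_square by simp
    show ?thesis unfolding n d using pos \<open>?d \<noteq> 0\<close> by (intro exI[of _ "(norm ?n)\<^sup>2 / (norm ?d)\<^sup>2"]) simp
  next
    case (pos a b m)
    have a0: "0 < inverse \<zeta> * q powi (m + 1)" using zeta_pos powi_pos by simp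
    have up: "c * ynode k < q powi (m + R + int k)" and lo: "q powi (m + 1 + R + int k) < c * ynode k"
      if "inverse \<zeta> * q powi (m + 1) < c" "c < inverse \<zeta> * q powi m" for c
    proof -
      have "c * ynode k < inverse \<zeta> * q powi m * ynode k" using that ynode_pos by (intro mult_strict_right_mono) auto
      also have "\<dots> = q powi (m + R + int k)" using zeta_pos by (simp add: ynode_def powi_add)
      finally show "c * ynode k < q powi (m + R + int k)" .
      have "q powi (m + 1 + R + int k) = inverse \<zeta> * q powi (m + 1) * ynode k" using zeta_pos by (simp add: ynode_def powi_add)
      also have "\<dots> < c * ynode k" using that ynode_pos by (intro mult_strict_right_mono) auto
      finally show "q powi (m + 1 + R + int k) < c * ynode k" .
    qed
    show ?thesis
    proof (rule real_case[OF pos(1,2)])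
      show "0 < (top_power N - a * ynode k) * (top_power N - b * ynode k)"
      proof (cases "int (N - 1) \<le> m + R + int k")
        case True
        then have "q powi (m + R + int k) \<le> top_power N" unfolding T by (rule powi_le)
        with up[of a] up[of b] pos show ?thesis by (intro mult_pos_pos) linarith+
      next
        case False
        then have "top_power N \<le> q powi (m + 1 + R + int k)" unfolding T by (intro powi_le) simp
        with lo[of a] lo[of b] pos show ?thesis by (intro mult_neg_neg) linarith+
      qed
      have "0 < q * ynode k" using q ynode_pos by simp
      with a0 pos show "0 < (a + q * ynode k) * (b + q * ynode k)" by (intro mult_pos_pos) linarith+
    qed
  next
    case (neg a b m)
    have n0: "0 < \<zeta> * q powi (m + 1)" using zeta_pos powi_pos by simp
    have T0: "0 < top_power N - c * ynode k" if "c < - \<zeta> * q powi (m + 1)" for c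
    proof -
      have "c < 0" using that n0 by simp
      then have "c * ynode k < 0" using ynode_pos[of k] by (rule mult_neg_pos)
      then show ?thesis using top_power_pos[of N] by simp
    qed
    show ?thesis
    proof (rule real_case[OF neg(1,2)])
      show "0 < (top_power N - a * ynode k) * (top_power N - b * ynode k)" using T0 neg by (intro mult_pos_pos) auto
      show "0 < (a + q * ynode k) * (b + q * ynode k)"
      proof (cases "R + int k + 1 \<le> m")
        case True
        then have "\<zeta> * q powi m \<le> q * ynode k" unfolding qy using zeta_pos by (intro mult_left_mono powi_le) auto
        with neg show ?thesis by (intro mult_pos_pos) linarith+
      next
        case False
        then have "q * ynode k \<le> \<zeta> * q powi (m + 1)" unfolding qy using zeta_pos by (intro mult_left_mono powi_le) auto
        with neg show ?thesis by (intro mult_neg_neg) linarith+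
      qed
    qed
  qed
qed

text \<open>The weights must be real although \<open>s0\<close> and \<open>s1\<close> need not be, hence the real representative \<open>rho\<close> of the
  quotient of the two products.\<close>

definition rho :: "nat \<Rightarrow> nat \<Rightarrow> real" where
  "rho N k = (SOME \<rho>. 0 < \<rho> \<and> complex_of_real \<rho> * ((s0 + of_real (q * ynode k)) * (s1 + of_real (q * ynode k)))
    = (of_real (top_power N) - s0 * of_real (ynode k)) * (of_real (top_power N) - s1 * of_real (ynode k)))"

lemma rho: "0 < rho N k" "complex_of_real (rho N k) * ((s0 + of_real (q * ynode k)) * (s1 + of_real (q * ynode k)))
    = (of_real (top_power N) - s0 * of_real (ynode k)) * (of_real (top_power N) - s1 * of_real (ynode k))"
  using someI_ex[OF rho_exists[of k N]] unfolding rho_def by auto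

definition r2 :: real where "r2 = - \<zeta> * q powi R"
definition r3 :: real where "r3 = inverse \<zeta> * q powi (- L)"

definition weight_ratio :: "nat \<Rightarrow> nat \<Rightarrow> real" where
  "weight_ratio N k = q * (top_power N + q\<^sup>2 * (ynode k)\<^sup>2) / ((top_power N + (ynode k)\<^sup>2) * (top_power N)\<^sup>2)
     * ((top_power N - r2 * ynode k) * (top_power N - r3 * ynode k) / ((r2 + q * ynode k) * (r3 + q * ynode k))) * rho N k"

definition racah_weight :: "nat \<Rightarrow> nat \<Rightarrow> real" where
  "racah_weight N k = (\<Prod>i<k. weight_ratio N i)"

text \<open>The numerator and the denominator of the weight ratio each contain exactly one negative
  factor here. For the numerator this uses that k lies strictly before the last node, where T - s3
  y_k reaches 0.\<close>

lemma boundary_factor_signs: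
  assumes "0 < N" "k < last_index N"
  shows "0 < top_power N - r2 * ynode k" "top_power N - r3 * ynode k < 0" "r2 + q * ynode k < 0" "0 < r3 + q * ynode k"
proof -
  have "r2 * ynode k < 0" unfolding r2_def using zeta_pos powi_pos ynode_pos by (intro mult_neg_pos) auto
  then show "0 < top_power N - r2 * ynode k" using top_power_pos[of N] by linarith
  have "r3 * ynode k = q powi (R - L + int k)"
  proof -
    have "r3 * ynode k = (inverse \<zeta> * \<zeta>) * (q powi (- L) * q powi (R + int k))" by (simp add: r3_def ynode_def)
    also have "\<dots> = q powi (- L + (R + int k))" unfolding powi_add[of "- L" "R + int k"] using zeta_pos by simp
    finally show ?thesis by (simp add: algebra_simps)
  qed
  moreover have "top_power N < q powi (R - L + int k)"
  proof -
    have "R - L + int k < int (N - 1)" using assms LR by (simp add: last_index_def)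
    then have "q powi (int (N - 1)) < q powi (R - L + int k)" by (rule powi_less)
    then show ?thesis by (simp only: top_power_def power_int_of_nat)
  qed
  ultimately show "top_power N - r3 * ynode k < 0" by simp
  have "q * ynode k = ynode (Suc k)" by (simp add: ynode_Suc)
  also have "\<dots> < \<zeta> * q powi R" unfolding ynode_def using zeta_pos by (intro mult_strict_left_mono powi_less) auto
  finally show "r2 + q * ynode k < 0" by (simp add: r2_def)
  show "0 < r3 + q * ynode k" unfolding r3_def using zeta_pos powi_pos ynode_pos q by (intro add_pos_pos mult_pos_pos) auto
qed

lemma weight_ratio_pos:
  assumes "0 < N" "k < last_index N"
  shows "0 < weight_ratio N k"
proof -
  note s = boundary_factor_signs[OF assms]
  have "0 < (top_power N - r2 * ynode k) * (top_power N - r3 * ynode k) / ((r2 + q * ynode k) * (r3 + q * ynode k))"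
    by (intro divide_neg_neg mult_pos_neg mult_neg_pos s)
  moreover have "0 < q * (top_power N + q\<^sup>2 * (ynode k)\<^sup>2) / ((top_power N + (ynode k)\<^sup>2) * (top_power N)\<^sup>2)"
    using q top_power_pos[of N] by (intro divide_pos_pos mult_pos_pos add_pos_nonneg) auto
  ultimately show ?thesis unfolding weight_ratio_def using rho(1) by (intro mult_pos_pos)
qed

lemma racah_weight_pos: "0 < N \<Longrightarrow> k \<le> last_index N \<Longrightarrow> 0 < racah_weight N k"
  unfolding racah_weight_def by (intro prod_pos) (auto intro: weight_ratio_pos)

lemma pearson_racah_weight:
  assumes "0 < N"
  shows "pearson (last_index N) (of_real q) (of_real (top_power N)) (\<lambda>k. of_real (ynode k)) s0 s1 s2 s3 (\<lambda>k. of_real (racah_weight N k))"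
  unfolding pearson_def
proof (intro allI impI)
  fix k assume k: "k < last_index N"
  note s = boundary_factor_signs[OF assms k]
  define D where "D = (r2 + q * ynode k) * (r3 + q * ynode k)"
  define E where "E = (top_power N - r2 * ynode k) * (top_power N - r3 * ynode k)"
  have cancel: "q * a / (b * t) * (E / D) * r * b * t * D = q * a * E * r"
    if "b \<noteq> 0" "t \<noteq> 0" "D \<noteq> 0" for a b t r :: real
    using that by (simp add: field_simps)
  have "D \<noteq> 0" using s by (simp add: D_def)
  moreover have "top_power N + (ynode k)\<^sup>2 \<noteq> 0" using top_power_pos[of N] by (intro less_imp_neq[symmetric] add_pos_nonneg) auto
  ultimately have real: "weight_ratio N k * (top_power N + (ynode k)\<^sup>2) * (top_power N)\<^sup>2 * D = q * (top_power N + q\<^sup>2 * (ynode k)\<^sup>2) * E * rho N k"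
    unfolding weight_ratio_def D_def[symmetric] E_def[symmetric] using top_power_pos[of N] by (intro cancel) auto
  let ?c = complex_of_real
  have 23: "(s2 + ?c q * ?c (ynode k)) * (s3 + ?c q * ?c (ynode k)) = ?c D"
    "(?c (top_power N) - s2 * ?c (ynode k)) * (?c (top_power N) - s3 * ?c (ynode k)) = ?c E"
    unfolding D_def E_def s2 s3 r2_def[symmetric] r3_def[symmetric] by simp_all
  have 01: "?c (rho N k) * ((s0 + ?c q * ?c (ynode k)) * (s1 + ?c q * ?c (ynode k)))
      = (?c (top_power N) - s0 * ?c (ynode k)) * (?c (top_power N) - s1 * ?c (ynode k))"
    using rho(2)[of N k] by simp
  have "?c (racah_weight N (Suc k)) * (?c (top_power N) + ?c (ynode k) ^ 2) * ?c (top_power N) ^ 2 *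
      ((s0 + ?c q * ?c (ynode k)) * (s1 + ?c q * ?c (ynode k)) * (s2 + ?c q * ?c (ynode k)) * (s3 + ?c q * ?c (ynode k)))
    = ?c (racah_weight N k) * ?c (weight_ratio N k * (top_power N + (ynode k)\<^sup>2) * (top_power N)\<^sup>2 * D) * ((s0 + ?c q * ?c (ynode k)) * (s1 + ?c q * ?c (ynode k)))"
    unfolding mult.assoc[of _ "s2 + _" "s3 + _"] 23 by (simp add: racah_weight_def ac_simps)
  also have "\<dots> = ?c (racah_weight N k) * ?c q * (?c (top_power N) + ?c q ^ 2 * ?c (ynode k) ^ 2) * ((?c (rho N k) * ((s0 + ?c q * ?c (ynode k)) * (s1 + ?c q * ?c (ynode k)))) * ?c E)"
    unfolding real by (simp add: ac_simps)
  also have "\<dots> = ?c (racah_weight N k) * ?c q * (?c (top_power N) + ?c q ^ 2 * ?c (ynode k) ^ 2) *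
      ((?c (top_power N) - s0 * ?c (ynode k)) * (?c (top_power N) - s1 * ?c (ynode k)) * (?c (top_power N) - s2 * ?c (ynode k)) * (?c (top_power N) - s3 * ?c (ynode k)))"
    unfolding 01 23(2)[symmetric] by (simp only: mult.assoc)
  finally show "?c (racah_weight N (Suc k)) * (?c (top_power N) + ?c (ynode k) ^ 2) * ?c (top_power N) ^ 2 *
      ((s0 + ?c q * ?c (ynode k)) * (s1 + ?c q * ?c (ynode k)) * (s2 + ?c q * ?c (ynode k)) * (s3 + ?c q * ?c (ynode k)))
    = ?c (racah_weight N k) * ?c q * (?c (top_power N) + ?c q ^ 2 * ?c (ynode k) ^ 2) *
      ((?c (top_power N) - s0 * ?c (ynode k)) * (?c (top_power N) - s1 * ?c (ynode k)) * (?c (top_power N) - s2 * ?c (ynode k)) * (?c (top_power N) - s3 * ?c (ynode k)))" .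
qed

lemma racah_weight_orthogonal:
  assumes N: "0 < N" and l: "l < n"
  shows "(\<Sum>k\<le>last_index N. complex_of_real (racah_weight N k) * racah_poly (of_real q) s0 s1 s2 s3 N n (of_real (racah_node N k))
     * (\<Prod>i<l. of_real (racah_node N k) - qnode (of_real q) s1 N i)) = 0"
proof -
  let ?c = complex_of_real
  have nz: "?c q \<noteq> 0" "?c (top_power N) \<noteq> 0" "\<And>k. ?c (ynode k) \<noteq> 0"
    using q ynode_pos top_power_pos[of N] by (simp_all add: less_imp_neq[symmetric])
  have yS: "\<And>k. ?c (ynode (Suc k)) = ?c q * ?c (ynode k)" by (simp add: ynode_Suc)
  have Ty: "?c (top_power N) + ?c (ynode k) ^ 2 \<noteq> 0" for k
  proof -
    have "top_power N + (ynode k)\<^sup>2 \<noteq> 0" using top_power_pos[of N] by (intro less_imp_neq[symmetric] add_pos_nonneg) auto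
    then have "?c (top_power N + (ynode k)\<^sup>2) \<noteq> 0" by (simp only: of_real_eq_0_iff not_False_eq_True)
    then show ?thesis by simp
  qed
  have x: "xnode (?c (top_power N)) (\<lambda>k. ?c (ynode k)) k = ?c (racah_node N k)" for k
    by (subst xnode_def[of "?c q" "?c (top_power N)" "\<lambda>k. ?c (ynode k)", OF nz yS Ty]) (simp add: racah_node_def)
  have "(\<Sum>k\<le>last_index N. ?c (racah_weight N k) * racah_poly (?c q) s0 s1 s2 s3 N n (xnode (?c (top_power N)) (\<lambda>k. ?c (ynode k)) k)
     * (\<Prod>i<l. xnode (?c (top_power N)) (\<lambda>k. ?c (ynode k)) k - qnode (?c q) s1 N i)) = 0"
  proof (rule racah_orthogonal)
    show "?c q \<noteq> 0" "?c (top_power N) \<noteq> 0" "\<And>k. ?c (ynode k) \<noteq> 0" by (rule nz)+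
    show "\<And>k. ?c (ynode (Suc k)) = ?c q * ?c (ynode k)" by (rule yS)
    show "\<And>k. ?c (top_power N) + ?c (ynode k) ^ 2 \<noteq> 0" by (rule Ty)
    show "pearson (last_index N) (?c q) (?c (top_power N)) (\<lambda>k. ?c (ynode k)) s0 s1 s2 s3 (\<lambda>k. ?c (racah_weight N k))" by (rule pearson_racah_weight[OF N])
    show "s0 \<noteq> 0" "s1 \<noteq> 0" by (rule s01_nonzero)+
    show "s2 = - ?c (ynode 0)" by (simp add: s2 ynode_def)
    show "s3 * ?c (ynode (last_index N)) = ?c (top_power N)"
    proof -
      have "inverse \<zeta> * q powi (- L) * ynode (last_index N) = (inverse \<zeta> * \<zeta>) * (q powi (- L) * q powi (R + int (last_index N)))" by (simp add: ynode_def)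
      also have "\<dots> = q powi (- L + (R + int (last_index N)))" unfolding powi_add[of "- L" "R + int (last_index N)"] using zeta_pos by simp
      also have "- L + (R + int (last_index N)) = int (N - 1)" using LR by (simp add: last_index_def)
      finally have "inverse \<zeta> * q powi (- L) * ynode (last_index N) = top_power N" by (simp only: top_power_def power_int_of_nat)
      then show ?thesis unfolding s3 by (metis of_real_mult)
    qed
    \<comment> \<open>The quantity is real and negative by the signs of s0 s1, s2 and s3.\<close>
    show "s0 * s1 * s2 * s3 / ?c (top_power N) ^ 2 * ?c q ^ i \<noteq> 1" for i
    proof -
      obtain c where c: "0 < c" "s0 * s1 = ?c c" using s0_s1_pos by blast
      have "s0 * s1 * s2 * s3 / ?c (top_power N) ^ 2 * ?c q ^ i = ?c (c * r2 * r3 / (top_power N)\<^sup>2 * q ^ i)"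
        by (simp add: c s2 s3 r2_def r3_def)
      moreover have "c * r2 * r3 / (top_power N)\<^sup>2 * q ^ i < 0"
      proof -
        have "r2 < 0" "0 < r3" unfolding r2_def r3_def using zeta_pos powi_pos by auto
        then have "c * r2 * r3 < 0" using c by (intro mult_neg_pos mult_pos_neg)
        then show ?thesis using top_power_pos[of N] q by (intro mult_neg_pos[OF divide_neg_pos]) auto
      qed
      ultimately show ?thesis by (metis less_numeral_extra(1) not_less_iff_gr_or_eq of_real_eq_1_iff)
    qed
    show "qpoch (?c q) (?c q) n \<noteq> 0" for n by (rule qpoch_self_nonzero[OF q])
    show "?c (top_power N) = ?c q ^ (N - 1)" by (simp add: top_power_def)
  qed (use N l in auto)
  then show ?thesis unfolding x .
qed

text \<open>Ordered tuples of distinct node indices; each set of N nodes occurs N! times with the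
  same weight, a multiplicity that normalisation removes.\<close>

definition ensemble :: "nat \<Rightarrow> (nat \<Rightarrow> nat) set" where
  "ensemble N = {g \<in> PiE {0..<N} (\<lambda>_. {..last_index N}). inj_on g {0..<N}}"

definition node_vandermonde :: "nat \<Rightarrow> (nat \<Rightarrow> nat) \<Rightarrow> real" where
  "node_vandermonde N g = (\<Prod>j<N. \<Prod>i<j. racah_node N (g i) - racah_node N (g j))"

definition ensemble_weight :: "nat \<Rightarrow> (nat \<Rightarrow> nat) \<Rightarrow> real" where
  "ensemble_weight N g = (\<Prod>j=0..<N. racah_weight N (g j)) * (node_vandermonde N g)\<^sup>2"

lemma finite_ensemble: "finite (ensemble N)"
  unfolding ensemble_def by (rule finite_subset[of _ "PiE {0..<N} (\<lambda>_. {..last_index N})"]) (auto intro: finite_PiE)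

lemma ensemble_weight_nonneg: "0 < N \<Longrightarrow> g \<in> ensemble N \<Longrightarrow> 0 \<le> ensemble_weight N g"
  unfolding ensemble_weight_def ensemble_def by (intro mult_nonneg_nonneg prod_nonneg) (auto intro!: less_imp_le[OF racah_weight_pos])

lemma racah_node_strict: "i < j \<Longrightarrow> racah_node N j < racah_node N i"
proof -
  assume "i < j"
  then have "ynode j < ynode i" unfolding ynode_def using zeta_pos by (intro mult_strict_left_mono powi_less) auto
  moreover have "top_power N / ynode i < top_power N / ynode j"
    using \<open>ynode j < ynode i\<close> ynode_pos top_power_pos by (intro divide_strict_left_mono) auto
  ultimately show ?thesis unfolding racah_node_def by linarith
qed

text \<open>There are at least N nodes and they decrease strictly, so the tuple of the first N has a
  nonzero Vandermonde product.\<close>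

lemma ensemble_weight_sum_pos:
  assumes "0 < N"
  shows "0 < (\<Sum>g\<in>ensemble N. ensemble_weight N g)"
proof -
  let ?g = "\<lambda>i\<in>{0..<N}. i"
  have g: "?g \<in> ensemble N" using assms by (auto simp: ensemble_def last_index_def inj_on_def)
  have "node_vandermonde N ?g \<noteq> 0" unfolding node_vandermonde_def using racah_node_strict[of _ _ N] by (fastforce simp: prod_zero_iff)
  moreover have "0 < (\<Prod>j=0..<N. racah_weight N (?g j))"
    using assms by (intro prod_pos) (auto intro!: racah_weight_pos simp: last_index_def)
  ultimately have "0 < ensemble_weight N ?g" unfolding ensemble_weight_def by (intro mult_pos_pos) auto
  then show ?thesis using g finite_ensemble ensemble_weight_nonneg[OF assms] by (intro sum_pos2) auto
qed

definition schur_value :: "nat \<Rightarrow> nat \<Rightarrow> (nat \<Rightarrow> nat) \<Rightarrow> (nat \<Rightarrow> nat) \<Rightarrow> complex" where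
  "schur_value N n mu g = jt (\<lambda>a. a) n mu (\<lambda>i r. (\<Sum>j<N. complex_of_real (racah_node N (g j)) ^ Suc r) - qnode_sum (of_real q) s0 mu N i r)"

text \<open>The squared Vandermonde product is split: one copy turns the combination of Schur values
  into a determinant of q-Racah polynomials, the other is a determinant of test polynomials. Row 0
  of the former has degree lam_0 + N - 1, which exceeds all degrees N - 1 - i of the latter as lam_0
  > 0, so \<open>andreief_zero\<close> applies to that row.\<close>

theorem ensemble_racah_zero:
  assumes N: "0 < N" and lam: "is_partition lam" "plen lam \<le> N" "lam \<noteq> empty_partition"
  shows "(\<Sum>g\<in>ensemble N. complex_of_real (ensemble_weight N g) * (\<Sum>mu | is_partition mu \<and> mu \<le> lam.
      sigma_qR lam mu (of_real q) s0 s1 s2 s3 * qfact_ratio (of_real q) N lam mu * schur_value N (plen lam) mu g)) = 0"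
proof -
  let ?c = complex_of_real
  let ?X = "PiE {0..<N} (\<lambda>_. {..last_index N})"
  let ?a = "\<lambda>i k. racah_poly (?c q) s0 s1 s2 s3 N (beta_set N lam i) (?c (racah_node N k))"
  \<comment> \<open>Monic polynomials of degrees N - 1 - i all give the Vandermonde determinant; the
    node products of \<open>s1\<close> are the ones covered by the orthogonality relation.\<close>
  let ?b = "\<lambda>i k. \<Prod>l<0 + (N - 1 - i). ?c (racah_node N k) - qnode (?c q) s1 N l"
  let ?A = "\<lambda>g. Determinant.det (mat N N (\<lambda>(i, j). ?a i (g j)))"
  let ?B = "\<lambda>g. Determinant.det (mat N N (\<lambda>(i, j). ?b i (g j)))"
  have lam0: "0 < lam 0"
  proof (rule ccontr)
    assume "\<not> 0 < lam 0"
    then have "plen lam \<le> 0" using partition_eq_0_iff[OF lam(1), of 0] by simp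
    then have "lam i = 0" for i using partition_eq_0_iff[OF lam(1), of i] by simp
    then show False using lam(3) by (auto simp: empty_partition_def)
  qed
  have B: "?B g = ?c (node_vandermonde N g)" for g
  proof -
    have "?B g = jt (\<lambda>a. a) N (\<lambda>_. 0) (\<lambda>i r. (\<Sum>j<N. ?c (racah_node N (g j)) ^ Suc r) - (\<Sum>l<0 + (N - 1 - i). qnode (?c q) s1 N l ^ Suc r))
        * (\<Prod>j<N. \<Prod>i<j. ?c (racah_node N (g i)) - ?c (racah_node N (g j)))"
      by (rule det_interp_eq_jt[OF comm_ring_hom_ident, where mu = "\<lambda>_. 0"])
    also have "jt (\<lambda>a. a) N (\<lambda>_. 0) p = jt (\<lambda>a. a) 0 (\<lambda>_. 0) p" for p :: "nat \<Rightarrow> nat \<Rightarrow> complex"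
      by (rule jt_stable) simp_all
    also have "jt (\<lambda>a. a) 0 (\<lambda>_. 0) p = 1" for p :: "nat \<Rightarrow> nat \<Rightarrow> complex" by (simp add: jt_def)
    finally show ?thesis by (simp add: node_vandermonde_def)
  qed
  have A: "?A g = (\<Sum>mu | is_partition mu \<and> mu \<le> lam.
      sigma_qR lam mu (of_real q) s0 s1 s2 s3 * qfact_ratio (of_real q) N lam mu * schur_value N (plen lam) mu g) * ?c (node_vandermonde N g)" for g
  proof -
    have D: "Determinant.det (mat N N (\<lambda>(k, j). \<Prod>l<beta_set N mu k. ?c (racah_node N (g j)) - qnode (?c q) s0 N l)) = schur_value N (plen lam) mu g * ?c (node_vandermonde N g)"
      if "mu \<le> lam" for mu
    proof -
      have "mu i = 0" if "plen lam \<le> i" for i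
        using le_funD[OF \<open>mu \<le> lam\<close>, of i] partition_eq_0_iff[OF lam(1), of i] that by simp
      then show ?thesis
        unfolding beta_set_def det_interp_eq_jt[OF comm_ring_hom_ident] schur_value_def qnode_sum_def
        by (simp add: jt_stable[OF lam(2)] node_vandermonde_def del: power_Suc)
    qed
    show ?thesis
      unfolding det_racah_poly[OF lam(1,2) s01_nonzero(1)] sum_distrib_right
      by (intro sum.cong refl) (simp add: D)
  qed
  have "(\<Sum>g\<in>ensemble N. ?c (ensemble_weight N g) * (\<Sum>mu | is_partition mu \<and> mu \<le> lam.
      sigma_qR lam mu (of_real q) s0 s1 s2 s3 * qfact_ratio (of_real q) N lam mu * schur_value N (plen lam) mu g))
    = (\<Sum>g\<in>ensemble N. (\<Prod>j=0..<N. ?c (racah_weight N (g j))) * ?A g * ?B g)"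
    unfolding A B ensemble_weight_def by (intro sum.cong refl) (simp add: power2_eq_square ac_simps)
  also have "\<dots> = (\<Sum>g\<in>?X. (\<Prod>j=0..<N. ?c (racah_weight N (g j))) * ?A g * ?B g)"
  proof (rule sum.mono_neutral_left)
    show "\<forall>g\<in>?X - ensemble N. (\<Prod>j=0..<N. ?c (racah_weight N (g j))) * ?A g * ?B g = 0"
    proof
      fix g assume "g \<in> ?X - ensemble N"
      then obtain i j where "i < N" "j < N" "i \<noteq> j" "g i = g j" by (auto simp: ensemble_def inj_on_def)
      then obtain i j where "i < j" "j < N" "g i = g j" by (metis linorder_neqE_nat)
      then have "(\<Prod>i<j. racah_node N (g i) - racah_node N (g j)) = 0" by (intro prod_zero bexI[of _ i]) auto
      with \<open>j < N\<close> have "\<exists>j\<in>{..<N}. (\<Prod>i<j. racah_node N (g i) - racah_node N (g j)) = 0" by blast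
      then have "node_vandermonde N g = 0" unfolding node_vandermonde_def by (rule prod_zero[OF finite_lessThan])
      then show "(\<Prod>j=0..<N. ?c (racah_weight N (g j))) * ?A g * ?B g = 0" unfolding B by simp
    qed
  qed (auto intro: finite_PiE simp: ensemble_def)
  also have "\<dots> = 0"
  proof (rule andreief_zero[of 0])
    show "(\<Sum>k\<le>last_index N. ?c (racah_weight N k) * ?a 0 k * ?b i k) = 0" if "i < N" for i
      by (rule racah_weight_orthogonal[OF N]) (use lam0 N that in \<open>simp add: beta_set_def\<close>)
  qed (rule N)
  finally show ?thesis .
qed

section \<open>Passage to the limit\<close>

text \<open>Interleaving the two halves of the grid gives moduli of order q^(j/2), hence the
  absolute summability on which the configuration space is built.\<close>

definition grid_enum :: "nat \<Rightarrow> real" where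
  "grid_enum j = (if even j then ynode (j div 2) else - (inverse \<zeta> * q powi (- L + int (j div 2))))"

lemma grid_enum_even: "grid_enum (2 * k) = ynode k"
  and grid_enum_odd: "grid_enum (Suc (2 * k)) = - (inverse \<zeta> * q powi (- L + int k))"
  by (simp_all add: grid_enum_def)

lemma powi_inj: "q powi i = q powi j \<Longrightarrow> i = j"
  using powi_less[of i j] powi_less[of j i] by (cases i j rule: linorder_cases) auto

lemma inj_grid_enum: "inj grid_enum"
proof (rule injI)
  fix i j assume eq: "grid_enum i = grid_enum j"
  have pos: "0 < grid_enum i" if "even i" for i using that ynode_pos by (simp add: grid_enum_def)
  have neg: "grid_enum i < 0" if "odd i" for i using that zeta_pos powi_pos by (simp add: grid_enum_def)
  show "i = j"
  proof (cases "even i"; cases "even j")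
    assume e: "even i" "even j"
    then have "\<zeta> * q powi (R + int (i div 2)) = \<zeta> * q powi (R + int (j div 2))" using eq by (simp add: grid_enum_def ynode_def)
    then have "q powi (R + int (i div 2)) = q powi (R + int (j div 2))" using zeta_pos by simp
    then have "i div 2 = j div 2" using powi_inj by fastforce
    with e show ?thesis by (metis dvd_mult_div_cancel)
  next
    assume o: "odd i" "odd j"
    then have "inverse \<zeta> * q powi (- L + int (i div 2)) = inverse \<zeta> * q powi (- L + int (j div 2))" using eq by (simp add: grid_enum_def)
    then have "q powi (- L + int (i div 2)) = q powi (- L + int (j div 2))" using zeta_pos by simp
    then have "i div 2 = j div 2" using powi_inj by fastforce
    with o show ?thesis by (metis odd_two_times_div_two_succ)
  next
    assume "even i" "odd j"
    then show ?thesis using pos[of i] neg[of j] eq by simp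
  next
    assume "odd i" "even j"
    then show ?thesis using pos[of j] neg[of i] eq by simp
  qed
qed

lemma grid_enum_nonzero: "grid_enum j \<noteq> 0"
  using q ynode_pos[of "j div 2"] zeta_pos powi_pos[of "- L + int (j div 2)"] by (auto simp: grid_enum_def)

lemma power_div2_le: "q ^ (j div 2) \<le> sqrt q ^ j / sqrt q"
proof -
  have s: "0 < sqrt q" "sqrt q \<le> 1" using q by auto
  have "q ^ (j div 2) * sqrt q = sqrt q ^ Suc (2 * (j div 2))"
    using q by (simp add: power_mult mult.commute)
  also have "\<dots> \<le> sqrt q ^ j" by (rule power_decreasing) (use s in auto)
  finally show ?thesis using s by (simp add: pos_le_divide_eq)
qed

lemma summable_grid_enum: "summable (\<lambda>j. \<bar>grid_enum j\<bar>)"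
proof (rule summable_comparison_test')
  let ?C = "\<zeta> * q powi R + inverse \<zeta> * q powi (- L)"
  show "summable (\<lambda>j. ?C / sqrt q * sqrt q ^ j)"
    using q by (intro summable_mult summable_geometric) (simp add: real_sqrt_lt_1_iff)
  fix j :: nat assume "0 \<le> j"
  have p: "0 \<le> \<zeta> * q powi R" "0 \<le> inverse \<zeta> * q powi (- L)" using zeta_pos q by auto
  have e: "grid_enum j = (if even j then \<zeta> * q powi R * q ^ (j div 2) else - (inverse \<zeta> * q powi (- L) * q ^ (j div 2)))"
    unfolding grid_enum_def ynode_def powi_add_nat by (simp only: mult.assoc)
  have "\<bar>a * b\<bar> = a * b" "\<bar>- (a * b)\<bar> = a * b" if "0 \<le> a" "0 \<le> b" for a b :: real
    using that by simp_all
  note abs = this[OF p(1) zero_le_power[of q "j div 2"]] this[OF p(2) zero_le_power[of q "j div 2"]]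
  have "\<bar>grid_enum j\<bar> = (if even j then \<zeta> * q powi R else inverse \<zeta> * q powi (- L)) * q ^ (j div 2)"
    unfolding e using q by (cases "even j") (simp_all only: if_True if_False abs less_imp_le)
  also have "\<dots> \<le> ?C * q ^ (j div 2)"
    by (intro mult_right_mono) (use p q in auto)
  also have "\<dots> \<le> ?C * (sqrt q ^ j / sqrt q)"
    using p power_div2_le by (intro mult_left_mono) auto
  finally show "norm \<bar>grid_enum j\<bar> \<le> ?C / sqrt q * sqrt q ^ j" by simp
qed

lemma range_grid_enum: "range grid_enum = qgrid q \<zeta> L R"
proof
  show "range grid_enum \<subseteq> qgrid q \<zeta> L R"
  proof
    fix z assume "z \<in> range grid_enum"
    then obtain j where j: "z = grid_enum j" by auto
    show "z \<in> qgrid q \<zeta> L R"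
    proof (cases "even j")
      case True
      then have "z = \<zeta> * q powi (R + int (j div 2))" by (simp add: j grid_enum_def ynode_def)
      then show ?thesis unfolding qgrid_def by (intro UnI2 CollectI exI[of _ "R + int (j div 2)"]) simp
    next
      case False
      then have "z = - inverse \<zeta> * q powi (- L + int (j div 2))" by (simp add: j grid_enum_def)
      then show ?thesis unfolding qgrid_def by (intro UnI1 CollectI exI[of _ "- L + int (j div 2)"]) simp
    qed
  qed
  show "qgrid q \<zeta> L R \<subseteq> range grid_enum"
  proof
    fix z assume "z \<in> qgrid q \<zeta> L R"
    then consider n where "z = - inverse \<zeta> * q powi n" "- L \<le> n" | n where "z = \<zeta> * q powi n" "R \<le> n"
      by (auto simp: qgrid_def)
    then show "z \<in> range grid_enum"
    proof cases
      case 1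
      have "- L + int (nat (n + L)) = n" using 1 by simp
      then have "grid_enum (Suc (2 * nat (n + L))) = z" using 1(1) unfolding grid_enum_odd by simp
      then show ?thesis by blast
    next
      case 2
      have "R + int (nat (n - R)) = n" using 2 by simp
      then have "grid_enum (2 * nat (n - R)) = z" using 2(1) unfolding grid_enum_even ynode_def by simp
      then show ?thesis by blast
    qed
  qed
qed

text \<open>The first nodes are close to the positive points \<open>ynode k\<close>; the remaining ones, counted from the other end,
  are close to the negative points of the grid.\<close>

definition grid_pt :: "nat \<Rightarrow> nat \<Rightarrow> real" where
  "grid_pt N k = (if 2 * k < N then grid_enum (2 * k) else grid_enum (Suc (2 * (last_index N - k))))"

definition grid_config :: "nat \<Rightarrow> (nat \<Rightarrow> nat) \<Rightarrow> real set" where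
  "grid_config N g = (\<lambda>j. grid_pt N (g j)) ` {..<N}"

lemma grid_pt_inj: "inj_on (grid_pt N) {..last_index N}"
proof (rule inj_onI)
  fix i j assume ij: "i \<in> {..last_index N}" "j \<in> {..last_index N}" "grid_pt N i = grid_pt N j"
  let ?h = "\<lambda>k. if 2 * k < N then 2 * k else Suc (2 * (last_index N - k))"
  have "grid_pt N k = grid_enum (?h k)" for k by (simp add: grid_pt_def)
  with ij(3) have "grid_enum (?h i) = grid_enum (?h j)" by (simp only:)
  then have "?h i = ?h j" by (rule injD[OF inj_grid_enum])
  then have "(2 * i < N \<and> 2 * j < N \<and> i = j) \<or> (\<not> 2 * i < N \<and> \<not> 2 * j < N \<and> last_index N - i = last_index N - j)"
    by (auto split: if_splits) presburger+
  with ij show "i = j" by auto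
qed

lemma grid_config_range: "grid_config N g \<subseteq> range grid_enum"
  by (auto simp: grid_config_def grid_pt_def)

lemma top_power_over_ynode: "top_power N / ynode k = inverse \<zeta> * q powi (int (N - 1) - R - int k)"
proof -
  have "top_power N = q powi (int (N - 1) - R - int k + (R + int k))"
    by (simp add: top_power_def power_int_of_nat[symmetric] del: power_int_of_nat)
  also have "\<dots> = q powi (int (N - 1) - R - int k) * q powi (R + int k)" by (rule powi_add)
  finally have T: "top_power N = q powi (int (N - 1) - R - int k) * q powi (R + int k)" .
  have cancel: "a * b / (z * b) = inverse z * a" if "b \<noteq> 0" "z \<noteq> 0" for a b z :: real
    using that by (simp add: field_simps)
  show ?thesis unfolding T ynode_def by (rule cancel) (use q zeta_pos in auto)
qed

lemma grid_pt_eq: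
  assumes "0 < N" "k \<le> last_index N"
  shows "grid_pt N k = (if 2 * k < N then ynode k else - (top_power N / ynode k))"
proof -
  have "- L + int (last_index N - k) = int (N - 1) - R - int k"
    using assms LR by (simp add: last_index_def of_nat_diff)
  then show ?thesis unfolding grid_pt_def top_power_over_ynode grid_enum_even grid_enum_odd by simp
qed

definition gap_const :: real where "gap_const = \<zeta> * q powi R + inverse \<zeta> * q powi (- R)"
definition node_bound :: real where "node_bound = \<zeta> * q powi R + inverse \<zeta> * q powi (- L)"

lemma gap_const_node_bound_pos: "0 \<le> gap_const" "0 \<le> node_bound"
  unfolding gap_const_def node_bound_def using zeta_pos q by auto

text \<open>The grid point keeps one of the two terms of y_k - T/y_k. With the switch at 2 k = N the
  neglected term is a constant times q^(N-1-k) or q^k, both exponents being at least half of N - 1,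
  rounded down.\<close>

lemma grid_pt_close:
  assumes N: "0 < N" and k: "k \<le> last_index N"
  shows "\<bar>racah_node N k - grid_pt N k\<bar> \<le> gap_const * q ^ ((N - 1) div 2)" "\<bar>racah_node N k\<bar> \<le> node_bound" "\<bar>grid_pt N k\<bar> \<le> node_bound"
proof -
  have p: "0 \<le> \<zeta> * q powi R" "0 \<le> inverse \<zeta> * q powi (- L)" "0 \<le> inverse \<zeta> * q powi (- R)" using zeta_pos q by auto
  have y0: "0 < ynode k" "0 < top_power N / ynode k" using ynode_pos top_power_pos by auto
  have y: "ynode k = \<zeta> * q powi R * q ^ k" by (simp add: ynode_def powi_add_nat)
  have yB: "ynode k \<le> \<zeta> * q powi R" unfolding y using p q by (intro mult_left_le power_le_one) auto
  have tB: "top_power N / ynode k \<le> inverse \<zeta> * q powi (- L)"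
    unfolding top_power_over_ynode using zeta_pos LR k N
    by (intro mult_left_mono powi_le) (auto simp: last_index_def)
  show "\<bar>racah_node N k\<bar> \<le> node_bound" unfolding racah_node_def node_bound_def using y0 yB tB by linarith
  show "\<bar>grid_pt N k\<bar> \<le> node_bound" unfolding grid_pt_eq[OF N k] node_bound_def using y0 yB tB by auto
  show "\<bar>racah_node N k - grid_pt N k\<bar> \<le> gap_const * q ^ ((N - 1) div 2)"
  proof (cases "2 * k < N")
    case True
    then have e: "int (N - 1) - R - int k = - R + int (N - 1 - k)" by (simp add: of_nat_diff)
    have "racah_node N k - grid_pt N k = - (top_power N / ynode k)" using True by (simp add: grid_pt_eq[OF N k] racah_node_def)
    then have "\<bar>racah_node N k - grid_pt N k\<bar> = top_power N / ynode k" by (simp only: abs_minus_cancel abs_of_pos[OF y0(2)])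
    also have "\<dots> = inverse \<zeta> * q powi (- R) * q ^ (N - 1 - k)"
      unfolding top_power_over_ynode e powi_add_nat by simp
    also have "\<dots> \<le> gap_const * q ^ ((N - 1) div 2)"
      unfolding gap_const_def by (intro mult_mono power_decreasing) (use p q True in auto)
    finally show ?thesis .
  next
    case False
    have "\<bar>racah_node N k - grid_pt N k\<bar> = ynode k" using False y0 by (simp add: grid_pt_eq[OF N k] racah_node_def)
    also have "\<dots> \<le> gap_const * q ^ ((N - 1) div 2)"
      unfolding gap_const_def y by (intro mult_mono power_decreasing) (use p q False in auto)
    finally show ?thesis .
  qed
qed

lemma power_sum_grid_config:
  assumes "g \<in> ensemble N"
  shows "power_sum_at (grid_config N g) (Suc k) = (\<Sum>j<N. grid_pt N (g j) ^ Suc k)"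
proof -
  have g: "g \<in> PiE {0..<N} (\<lambda>_. {..last_index N})" "inj_on g {0..<N}" using assms by (auto simp: ensemble_def)
  have "inj_on (\<lambda>j. grid_pt N (g j)) {..<N}"
  proof (rule inj_onI)
    fix i j assume ij: "i \<in> {..<N}" "j \<in> {..<N}" "grid_pt N (g i) = grid_pt N (g j)"
    then have "g i = g j" using g(1) by (intro inj_onD[OF grid_pt_inj]) auto
    then show "i = j" using g(2) ij by (auto dest: inj_onD)
  qed
  then show ?thesis by (simp add: power_sum_at_def grid_config_def sum.reindex comp_def del: power_Suc)
qed

text \<open>A power sum has N terms, each with error of order q^(N/2), and N q^(N/2) tends to 0.
  Compactness bounds the power sums of grid configurations, and the vanishing error transfers the
  bound to the nodes.\<close>

lemma near_psums:
  "near (\<lambda>n. ensemble (Suc n)) (\<lambda>n g. \<Sum>j<Suc n. complex_of_real (racah_node (Suc n) (g j)) ^ Suc k) (\<lambda>n g. psums (grid_config (Suc n) g) k)"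
proof -
  define \<delta> where "\<delta> = (\<lambda>n. real (Suc n) * (real (Suc k) * node_bound ^ k * (gap_const * q ^ (n div 2))))"
  have \<delta>0: "\<delta> \<longlonglongrightarrow> 0"
  proof (rule Lim_null_comparison)
    let ?C = "real (Suc k) * node_bound ^ k * gap_const / sqrt q"
    have s: "0 < sqrt q" "sqrt q < 1" using q by auto
    have "norm (\<delta> n) \<le> ?C * (real n * sqrt q ^ n + sqrt q ^ n)" for n
    proof -
      have C: "0 \<le> real (Suc n) * (real (Suc k) * node_bound ^ k * gap_const)" using gap_const_node_bound_pos by (intro mult_nonneg_nonneg) auto
      have "norm (\<delta> n) = real (Suc n) * (real (Suc k) * node_bound ^ k * gap_const) * q ^ (n div 2)"
        using gap_const_node_bound_pos q by (simp add: \<delta>_def abs_mult)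
      also have "\<dots> \<le> real (Suc n) * (real (Suc k) * node_bound ^ k * gap_const) * (sqrt q ^ n / sqrt q)"
        by (rule mult_left_mono[OF power_div2_le C])
      also have "\<dots> = ?C * (real n * sqrt q ^ n + sqrt q ^ n)" by (simp add: algebra_simps add_divide_distrib)
      finally show ?thesis .
    qed
    then show "\<forall>\<^sub>F n in sequentially. norm (\<delta> n) \<le> ?C * (real n * sqrt q ^ n + sqrt q ^ n)" by simp
    have "(\<lambda>n. real n * sqrt q ^ n) \<longlonglongrightarrow> 0" using s powser_times_n_limit_0[of "sqrt q"] by simp
    moreover have "(\<lambda>n. sqrt q ^ n) \<longlonglongrightarrow> 0" using s by (intro LIMSEQ_power_zero) simp
    ultimately have "(\<lambda>n. ?C * (real n * sqrt q ^ n + sqrt q ^ n)) \<longlonglongrightarrow> ?C * (0 + 0)"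
      by (intro tendsto_mult tendsto_add tendsto_const)
    then show "(\<lambda>n. ?C * (real n * sqrt q ^ n + sqrt q ^ n)) \<longlonglongrightarrow> 0" by simp
  qed
  obtain B where B: "\<And>X. X \<subseteq> range grid_enum \<Longrightarrow> norm (psums X k) \<le> B"
    using pval_bounded[OF inj_grid_enum grid_enum_nonzero summable_grid_enum, of "pvar k"] by auto
  have diff: "norm ((\<Sum>j<Suc n. complex_of_real (racah_node (Suc n) (g j)) ^ Suc k) - psums (grid_config (Suc n) g) k) \<le> \<delta> n" if g: "g \<in> ensemble (Suc n)" for n g
  proof -
    have gK: "g j \<le> last_index (Suc n)" if "j < Suc n" for j
      using g that by (auto simp: ensemble_def)
    have "(\<Sum>j<Suc n. complex_of_real (racah_node (Suc n) (g j)) ^ Suc k) - psums (grid_config (Suc n) g) k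
        = complex_of_real (\<Sum>j<Suc n. racah_node (Suc n) (g j) ^ Suc k - grid_pt (Suc n) (g j) ^ Suc k)"
      unfolding psums_def power_sum_grid_config[OF g] sum_subtractf by (simp only: of_real_diff of_real_sum of_real_power)
    then have "norm ((\<Sum>j<Suc n. complex_of_real (racah_node (Suc n) (g j)) ^ Suc k) - psums (grid_config (Suc n) g) k)
        = \<bar>\<Sum>j<Suc n. racah_node (Suc n) (g j) ^ Suc k - grid_pt (Suc n) (g j) ^ Suc k\<bar>" by (simp only: norm_of_real)
    also have "\<dots> \<le> (\<Sum>j<Suc n. real (Suc k) * node_bound ^ k * (gap_const * q ^ (n div 2)))"
    proof (rule order_trans[OF sum_abs sum_mono])
      fix j assume "j \<in> {..<Suc n}"
      then have gj: "g j \<le> last_index (Suc n)" by (intro gK) simp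
      note c = grid_pt_close[OF zero_less_Suc gj]
      have "\<bar>racah_node (Suc n) (g j) ^ Suc k - grid_pt (Suc n) (g j) ^ Suc k\<bar> \<le> real (Suc k) * node_bound ^ k * \<bar>racah_node (Suc n) (g j) - grid_pt (Suc n) (g j)\<bar>"
        by (rule abs_power_diff_le[OF c(2,3)])
      also have "\<dots> \<le> real (Suc k) * node_bound ^ k * (gap_const * q ^ (n div 2))"
        using c(1) gap_const_node_bound_pos by (intro mult_left_mono mult_nonneg_nonneg) auto
      finally show "\<bar>racah_node (Suc n) (g j) ^ Suc k - grid_pt (Suc n) (g j) ^ Suc k\<bar> \<le> real (Suc k) * node_bound ^ k * (gap_const * q ^ (n div 2))" .
    qed
    also have "\<dots> = \<delta> n" by (simp add: \<delta>_def)
    finally show ?thesis .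
  qed
  have "0 \<le> B" using order_trans[OF norm_ge_zero B[of "{}"]] by simp
  show ?thesis
  proof (rule nearI[OF _ \<delta>0])
    show "0 \<le> B + 1" using \<open>0 \<le> B\<close> by simp
    have "\<forall>\<^sub>F n in sequentially. \<delta> n < 1" by (rule order_tendstoD(2)[OF \<delta>0]) simp
    then show "\<forall>\<^sub>F n in sequentially. \<forall>g\<in>ensemble (Suc n). norm (\<Sum>j<Suc n. complex_of_real (racah_node (Suc n) (g j)) ^ Suc k) \<le> B + 1
       \<and> norm (psums (grid_config (Suc n) g) k) \<le> B + 1
       \<and> norm ((\<Sum>j<Suc n. complex_of_real (racah_node (Suc n) (g j)) ^ Suc k) - psums (grid_config (Suc n) g) k) \<le> \<delta> n"
    proof eventually_elim
      case (elim n)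
      show ?case
      proof
        fix g assume g: "g \<in> ensemble (Suc n)"
        let ?u = "\<Sum>j<Suc n. complex_of_real (racah_node (Suc n) (g j)) ^ Suc k" and ?v = "psums (grid_config (Suc n) g) k"
        have "norm ?v \<le> B" by (rule B[OF grid_config_range])
        moreover have "norm (?u - ?v) \<le> \<delta> n" by (rule diff[OF g])
        moreover have "norm ?u \<le> norm ?v + norm (?u - ?v)" by (rule norm_triangle_sub)
        ultimately show "norm ?u \<le> B + 1 \<and> norm ?v \<le> B + 1 \<and> norm (?u - ?v) \<le> \<delta> n"
          using elim by linarith
      qed
    qed
  qed
qed

lemma pval_ibc_pres:
  "pval p (ibc_pres (of_real q) s0 m mu) = jt (\<lambda>a. a) m mu (\<lambda>i r. p r - lim (\<lambda>N. qnode_sum (of_real q) s0 mu N i r))"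
proof -
  interpret v: comm_ring_hom "pval p" by (rule pval_hom)
  show ?thesis unfolding ibc_pres_def hom_jt[OF pval_hom] by (simp add: v.hom_minus)
qed

lemma near_schur_value:
  "near (\<lambda>n. ensemble (Suc n)) (\<lambda>n g. schur_value (Suc n) m mu g) (\<lambda>n g. pval (psums (grid_config (Suc n) g)) (ibc_pres (of_real q) s0 m mu))"
  unfolding schur_value_def pval_ibc_pres
  by (intro near_jt near_diff near_psums near_const LIMSEQ_Suc qnode_sum_tendsto[OF q s01_nonzero(1)])

definition Phi_pres :: "(nat \<Rightarrow> nat) \<Rightarrow> cpoly" where
  "Phi_pres lam = (\<Sum>mu | is_partition mu \<and> mu \<le> lam. pconst (sigma_qR lam mu (of_real q) s0 s1 s2 s3) * ibc_pres (of_real q) s0 (plen lam) mu)"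

lemma Sym_eval_Phi:
  assumes "is_partition lam" "X \<subseteq> range grid_enum"
  shows "Sym_eval (Phi_qR lam (of_real q) s0 s1 s2 s3) X = pval (psums X) (Phi_pres lam)"
  unfolding Phi_qR_eq[OF q s01_nonzero(1) assms(1)] Phi_pres_def
  by (rule Sym_eval_config[OF inj_grid_enum grid_enum_nonzero summable_grid_enum assms(2)])

section \<open>Expectation as a linear functional on polynomials in power sums\<close>

definition mean :: "real set measure \<Rightarrow> cpoly \<Rightarrow> complex" where
  "mean M P = (LINT X|M. pval (psums X) P)"

context
  fixes M assumes M: "prob_space M" "sets M = sets (config_borel (range grid_enum))"
begin

lemma mean_integrable: "integrable M (\<lambda>X. pval (psums X) P)"
  by (rule integrable_pval[OF inj_grid_enum grid_enum_nonzero summable_grid_enum M])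

lemma mean_add: "mean M (P + Q) = mean M P + mean M Q"
proof -
  interpret v: comm_ring_hom "pval p" for p by (rule pval_hom)
  show ?thesis unfolding mean_def by (simp add: v.hom_add mean_integrable)
qed

lemma mean_scale: "mean M (pconst a * P) = a * mean M P"
proof -
  interpret v: comm_ring_hom "pval p" for p by (rule pval_hom)
  show ?thesis unfolding mean_def by (simp add: v.hom_mult)
qed

lemma mean_sum: "mean M (\<Sum>i\<in>I. P i) = (\<Sum>i\<in>I. mean M (P i))"
proof -
  interpret v: comm_ring_hom "pval p" for p by (rule pval_hom)
  show ?thesis unfolding mean_def by (simp add: v.hom_sum mean_integrable)
qed

lemma mean_Phi_pres:
  "mean M (Phi_pres lam) = (\<Sum>mu | is_partition mu \<and> mu \<le> lam. sigma_qR lam mu (of_real q) s0 s1 s2 s3 * mean M (ibc_pres (of_real q) s0 (plen lam) mu))"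
  by (simp add: Phi_pres_def mean_sum mean_scale)

lemma space_M: "space M = Pow (range grid_enum)"
  using sets_eq_imp_space_eq[OF M(2)] by (simp add: space_config_borel[OF inj_grid_enum])

lemma Phi_integral:
  assumes "is_partition lam"
  shows "integrable M (Sym_eval (Phi_qR lam (of_real q) s0 s1 s2 s3))"
    and "(LINT X|M. Sym_eval (Phi_qR lam (of_real q) s0 s1 s2 s3) X) = mean M (Phi_pres lam)"
proof -
  have eq: "Sym_eval (Phi_qR lam (of_real q) s0 s1 s2 s3) X = pval (psums X) (Phi_pres lam)" if "X \<in> space M" for X
    using Sym_eval_Phi[OF assms, of X] that by (simp add: space_M)
  show "integrable M (Sym_eval (Phi_qR lam (of_real q) s0 s1 s2 s3))"
    using mean_integrable[of "Phi_pres lam"] by (simp add: eq cong: Bochner_Integration.integrable_cong)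
  show "(LINT X|M. Sym_eval (Phi_qR lam (of_real q) s0 s1 s2 s3) X) = mean M (Phi_pres lam)"
    unfolding mean_def by (rule Bochner_Integration.integral_cong[OF refl eq])
qed

lemma mean_Phi_pres_empty: "mean M (Phi_pres empty_partition) = 1"
proof -
  interpret M: prob_space M by (rule M(1))
  have e: "is_partition empty_partition" by (simp add: is_partition_def empty_partition_def antimono_def)
  have "{mu. is_partition mu \<and> mu \<le> empty_partition} = {empty_partition}"
    using e by (auto simp: empty_partition_def le_fun_def fun_eq_iff)
  moreover have "plen empty_partition = 0" by (simp add: plen_def empty_partition_def)
  moreover have "mean M (ibc_pres (of_real q) s0 0 empty_partition) = 1"
  proof -
    interpret v: comm_ring_hom "pval p" for p by (rule pval_hom)
    have "ibc_pres (of_real q) s0 0 empty_partition = 1" by (simp add: ibc_pres_def jt_def)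
    then show ?thesis by (simp add: mean_def M.prob_space)
  qed
  ultimately show ?thesis
    by (simp add: mean_Phi_pres sigma_qR_diag[OF e s01_nonzero(1)])
qed

end

text \<open>For fixed \<open>lam\<close> the finite identity is a combination of finitely many
  expectations, valid as soon as N reaches the length of \<open>lam\<close>. Along the one
  subsequence each expectation converges and each quotient of q-factorials tends to 1, so the
  identity survives in the limit.\<close>

theorem racah_measure_exists:
  obtains M where "prob_space M" "sets M = sets (config_borel (range grid_enum))"
    "\<And>lam. is_partition lam \<Longrightarrow> lam \<noteq> empty_partition \<Longrightarrow> mean M (Phi_pres lam) = 0"
proof -
  let ?G = "\<lambda>n. ensemble (Suc n)" and ?W = "\<lambda>n. ensemble_weight (Suc n)"
  define w where "w = (\<lambda>n g. ?W n g / (\<Sum>g\<in>?G n. ?W n g))"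
  have Zpos: "0 < (\<Sum>g\<in>?G n. ?W n g)" for n by (rule ensemble_weight_sum_pos[OF zero_less_Suc])
  have fin: "finite (?G n)" for n by (rule finite_ensemble)
  have w0: "0 \<le> w n g" if "g \<in> ?G n" for n g
    unfolding w_def using Zpos[of n] ensemble_weight_nonneg[OF zero_less_Suc that] by (intro divide_nonneg_pos)
  have w1: "(\<Sum>g\<in>?G n. w n g) = 1" for n
    unfolding w_def sum_divide_distrib[symmetric] using Zpos[of n] by simp
  obtain r M where r: "strict_mono (r :: nat \<Rightarrow> nat)" and M: "prob_space M" "sets M = sets (config_borel (range grid_enum))"
    and lim: "\<And>F :: real set \<Rightarrow> complex. continuous_on (cantor grid_enum) (\<lambda>t. F (decode grid_enum t)) \<Longrightarrow> F \<in> borel_measurable (config_borel (range grid_enum)) \<Longrightarrow>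
       integrable M F \<and> (\<lambda>n. \<Sum>g\<in>?G (r n). of_real (w (r n) g) * F (grid_config (Suc (r n)) g)) \<longlonglongrightarrow> (LINT X|M. F X)"
    using limit_measure[OF inj_grid_enum, of ?G w "\<lambda>n. grid_config (Suc n)", OF fin w0 w1 grid_config_range] by blast
  show thesis
  proof (rule that[OF M])
    fix lam assume lam: "is_partition lam" "lam \<noteq> empty_partition"
    let ?S = "{mu. is_partition mu \<and> mu \<le> lam}"
    let ?\<sigma> = "\<lambda>mu. sigma_qR lam mu (of_real q) s0 s1 s2 s3"
    let ?f = "\<lambda>n mu g. schur_value (Suc n) (plen lam) mu g"
    let ?E = "\<lambda>n mu. \<Sum>g\<in>?G n. complex_of_real (w n g) * ?f n mu g"
    have E: "(\<lambda>n. ?E (r n) mu) \<longlonglongrightarrow> mean M (ibc_pres (of_real q) s0 (plen lam) mu)" for mu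
    proof -
      let ?F = "\<lambda>X. pval (psums X) (ibc_pres (of_real q) s0 (plen lam) mu)"
      have "(\<lambda>n. \<Sum>g\<in>?G (r n). of_real (w (r n) g) * ?F (grid_config (Suc (r n)) g)) \<longlonglongrightarrow> mean M (ibc_pres (of_real q) s0 (plen lam) mu)"
        unfolding mean_def
        using lim[OF continuous_pval[OF inj_grid_enum grid_enum_nonzero summable_grid_enum] measurable_pval[OF inj_grid_enum grid_enum_nonzero summable_grid_enum]] by blast
      moreover have "(\<lambda>n. ?E (r n) mu - (\<Sum>g\<in>?G (r n). of_real (w (r n) g) * ?F (grid_config (Suc (r n)) g))) \<longlonglongrightarrow> 0"
        using LIMSEQ_subseq_LIMSEQ[OF near_weighted[OF near_schur_value fin w0 w1, of "plen lam" mu] r] by (simp add: comp_def)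
      ultimately show ?thesis using tendsto_add by fastforce
    qed
    have ratio: "(\<lambda>n. qfact_ratio (of_real q) (Suc (r n)) lam mu) \<longlonglongrightarrow> 1" if "mu \<le> lam" for mu
      using LIMSEQ_subseq_LIMSEQ[OF LIMSEQ_Suc[OF qfact_ratio_tendsto[OF q lam(1) that]] r] by (simp add: comp_def)
    have "(\<lambda>n. \<Sum>mu\<in>?S. ?\<sigma> mu * qfact_ratio (of_real q) (Suc (r n)) lam mu * ?E (r n) mu) \<longlonglongrightarrow> (\<Sum>mu\<in>?S. ?\<sigma> mu * 1 * mean M (ibc_pres (of_real q) s0 (plen lam) mu))"
      by (intro tendsto_sum tendsto_mult tendsto_const E ratio) simp
    moreover have "\<forall>\<^sub>F n in sequentially. (\<Sum>mu\<in>?S. ?\<sigma> mu * qfact_ratio (of_real q) (Suc (r n)) lam mu * ?E (r n) mu) = 0"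
      using eventually_ge_at_top[of "plen lam"]
    proof eventually_elim
      case (elim n)
      then have N: "plen lam \<le> Suc (r n)" using seq_suble[OF r, of n] by simp
      let ?Z = "\<Sum>g\<in>?G (r n). ?W (r n) g"
      have "(\<Sum>mu\<in>?S. ?\<sigma> mu * qfact_ratio (of_real q) (Suc (r n)) lam mu * ?E (r n) mu)
         = (\<Sum>g\<in>?G (r n). complex_of_real (?W (r n) g) * (\<Sum>mu\<in>?S. ?\<sigma> mu * qfact_ratio (of_real q) (Suc (r n)) lam mu * ?f (r n) mu g)) / complex_of_real ?Z"
        unfolding sum_distrib_left sum_divide_distrib
        by (subst sum.swap) (simp add: w_def ac_simps)
      also have "\<dots> = 0"
        unfolding ensemble_racah_zero[OF zero_less_Suc lam(1) N lam(2)] by simp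
      finally show ?case .
    qed
    ultimately have "(\<lambda>n. 0) \<longlonglongrightarrow> (\<Sum>mu\<in>?S. ?\<sigma> mu * 1 * mean M (ibc_pres (of_real q) s0 (plen lam) mu))"
      by (rule Lim_transform_eventually)
    then show "mean M (Phi_pres lam) = 0"
      unfolding mean_Phi_pres[OF M] by (simp add: LIMSEQ_const_iff)
  qed
qed

lemma psize_less:
  assumes mu: "is_partition mu" and nu: "nu \<le> mu" "nu \<noteq> mu"
  shows "psize nu < psize mu"
proof -
  have le: "nu i \<le> mu i" for i using nu(1) by (rule le_funD)
  have m0: "mu i = 0" if "plen mu \<le> i" for i using that partition_eq_0_iff[OF mu] by simp
  have n0: "nu i = 0" if "plen mu \<le> i" for i using m0[OF that] le[of i] by simp
  obtain i where i: "nu i \<noteq> mu i" using nu(2) by (auto simp: fun_eq_iff)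
  then have "i < plen mu" using m0[of i] n0[of i] by (cases "i < plen mu") auto
  moreover have "nu i < mu i" using le[of i] i by simp
  ultimately have "(\<Sum>i<plen mu. nu i) < (\<Sum>i<plen mu. mu i)"
    using le by (intro sum_strict_mono_ex1) auto
  moreover have "psize mu = (\<Sum>i<plen mu. mu i)" by (rule psize_eq_sum) (rule m0)
  moreover have "psize nu = (\<Sum>i<plen mu. nu i)" by (rule psize_eq_sum) (rule n0)
  ultimately show ?thesis by simp
qed

text \<open>The system relating the means of the q-Racah and the interpolation functions is
  triangular for inclusion with unit diagonal, so it is inverted by induction on the size.
  \<open>straightening\<close>, applied to the space where both means agree, then covers every
  polynomial in the power sums.\<close>

theorem racah_measure_unique:
  assumes M1: "prob_space M1" "sets M1 = sets (config_borel (range grid_enum))"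
    and M2: "prob_space M2" "sets M2 = sets (config_borel (range grid_enum))"
    and eq: "\<And>lam. is_partition lam \<Longrightarrow> mean M1 (Phi_pres lam) = mean M2 (Phi_pres lam)"
  shows "M1 = M2"
proof -
  let ?I = "\<lambda>n mu. ibc_pres (of_real q) s0 n mu"
  have stable: "?I n mu = ?I (plen mu) mu" if "is_partition mu" "plen mu \<le> n" for n mu
    unfolding ibc_pres_def
    by (rule jt_stable[OF that(2)]) (use partition_eq_0_iff[OF that(1)] in simp)
  have I: "mean M1 (?I (plen mu) mu) = mean M2 (?I (plen mu) mu)" if "is_partition mu" for mu
    using that
  proof (induction "psize mu" arbitrary: mu rule: less_induct)
    case less
    let ?S = "{nu. is_partition nu \<and> nu \<le> mu}"
    let ?\<sigma> = "\<lambda>nu. sigma_qR mu nu (of_real q) s0 s1 s2 s3"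
    have fin: "finite ?S" by (rule finite_partitions_le[OF less.prems])
    have mem: "mu \<in> ?S" using less.prems by simp
    have other: "mean M1 (?I (plen mu) nu) = mean M2 (?I (plen mu) nu)" if "nu \<in> ?S - {mu}" for nu
    proof -
      have nu: "is_partition nu" "nu \<le> mu" "nu \<noteq> mu" using that by auto
      have "plen nu \<le> plen mu"
      proof -
        have "nu (plen mu) \<le> mu (plen mu)" using nu(2) by (rule le_funD)
        also have "mu (plen mu) = 0" using partition_eq_0_iff[OF less.prems] by simp
        finally show ?thesis using partition_eq_0_iff[OF nu(1)] by simp
      qed
      then show ?thesis
        unfolding stable[OF nu(1) \<open>plen nu \<le> plen mu\<close>]
        by (intro less.hyps psize_less[OF less.prems nu(2,3)] nu(1))
    qed
    have all: "(\<Sum>nu\<in>?S. ?\<sigma> nu * mean M1 (?I (plen mu) nu)) = (\<Sum>nu\<in>?S. ?\<sigma> nu * mean M2 (?I (plen mu) nu))"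
      using eq[OF less.prems] unfolding mean_Phi_pres[OF M1] mean_Phi_pres[OF M2] .
    have rest: "(\<Sum>nu\<in>?S - {mu}. ?\<sigma> nu * mean M1 (?I (plen mu) nu)) = (\<Sum>nu\<in>?S - {mu}. ?\<sigma> nu * mean M2 (?I (plen mu) nu))"
      by (intro sum.cong refl) (simp only: other)
    from all have "?\<sigma> mu * mean M1 (?I (plen mu) mu) = ?\<sigma> mu * mean M2 (?I (plen mu) mu)"
      unfolding sum.remove[OF fin mem] rest by (rule add_right_imp_eq)
    then show ?case by (simp add: sigma_qR_diag[OF less.prems s01_nonzero(1)])
  qed
  let ?V = "{P. mean M1 P = mean M2 P}"
  have "?V = UNIV"
  proof (rule straightening[where C = "\<lambda>mu i r. lim (\<lambda>N. qnode_sum (of_real q) s0 mu N i r)"])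
    fix mu :: "nat \<Rightarrow> nat" and n
    assume mu: "is_partition mu" "\<And>i. n \<le> i \<Longrightarrow> mu i = 0"
    then have "plen mu \<le> n" using partition_eq_0_iff[OF mu(1), of n] by simp
    then have "?I n mu \<in> ?V"
      unfolding mem_Collect_eq stable[OF mu(1) \<open>plen mu \<le> n\<close>] by (intro I mu(1))
    then show "jt pconst n mu (\<lambda>i r. pvar r - pconst (lim (\<lambda>N. qnode_sum (of_real q) s0 mu N i r))) \<in> ?V"
      by (simp only: ibc_pres_def)
  qed (simp_all add: mean_add[OF M1] mean_add[OF M2] mean_scale[OF M1] mean_scale[OF M2])
  then have "mean M1 P = mean M2 P" for P by blast
  then show ?thesis
    using config_measure_unique[OF inj_grid_enum grid_enum_nonzero summable_grid_enum M1 M2] by (simp add: mean_def)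
qed

end

theorem theorem3p18:
  fixes q \<zeta> :: real and L R :: int and s0 s1 s2 s3 :: complex
  assumes "0 < q" and "q < 1"
    and "admissible q \<zeta> L R s0 s1 s2 s3"
  shows "\<exists>!M :: real set measure.
    prob_space M \<and> sets M = sets (config_borel (qgrid q \<zeta> L R)) \<and>
    (\<forall>lam. is_partition lam \<longrightarrow>
       integrable M (Sym_eval (Phi_qR lam (complex_of_real q) s0 s1 s2 s3)) \<and>
       (LINT X|M. Sym_eval (Phi_qR lam (complex_of_real q) s0 s1 s2 s3) X)
         = (if lam = empty_partition then 1 else 0))"
proof -
  interpret q_racah q \<zeta> L R s0 s1 s2 s3 by unfold_locales (fact assms)+
  let ?m = "\<lambda>M lam. mean M (Phi_pres lam)"
  \<comment> \<open>Integrability is automatic for every probability measure on the configuration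
    space, so the required property reduces to the values of \<open>mean\<close>.\<close>
  have iff: "(\<forall>lam. is_partition lam \<longrightarrow>
       integrable M (Sym_eval (Phi_qR lam (complex_of_real q) s0 s1 s2 s3)) \<and>
       (LINT X|M. Sym_eval (Phi_qR lam (complex_of_real q) s0 s1 s2 s3) X) = (if lam = empty_partition then 1 else 0))
     \<longleftrightarrow> (\<forall>lam. is_partition lam \<longrightarrow> ?m M lam = (if lam = empty_partition then 1 else 0))"
    if "prob_space M" "sets M = sets (config_borel (range grid_enum))" for M
    using Phi_integral[OF that] by simp
  show ?thesis unfolding range_grid_enum[symmetric]
  proof (rule ex_ex1I)
    obtain M where M: "prob_space M" "sets M = sets (config_borel (range grid_enum))"
      "\<And>lam. is_partition lam \<Longrightarrow> lam \<noteq> empty_partition \<Longrightarrow> ?m M lam = 0"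
      using racah_measure_exists by blast
    have "\<forall>lam. is_partition lam \<longrightarrow> ?m M lam = (if lam = empty_partition then 1 else 0)"
      using M(3) mean_Phi_pres_empty[OF M(1,2)] by simp
    then show "\<exists>M. prob_space M \<and> sets M = sets (config_borel (range grid_enum)) \<and>
      (\<forall>lam. is_partition lam \<longrightarrow>
       integrable M (Sym_eval (Phi_qR lam (complex_of_real q) s0 s1 s2 s3)) \<and>
       (LINT X|M. Sym_eval (Phi_qR lam (complex_of_real q) s0 s1 s2 s3) X) = (if lam = empty_partition then 1 else 0))"
      using M(1,2) iff[OF M(1,2)] by blast
  next
    fix M1 M2 :: "real set measure"
    assume "prob_space M1 \<and> sets M1 = sets (config_borel (range grid_enum)) \<and>
      (\<forall>lam. is_partition lam \<longrightarrow>
       integrable M1 (Sym_eval (Phi_qR lam (complex_of_real q) s0 s1 s2 s3)) \<and>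
       (LINT X|M1. Sym_eval (Phi_qR lam (complex_of_real q) s0 s1 s2 s3) X) = (if lam = empty_partition then 1 else 0))"
    then have M1: "prob_space M1" "sets M1 = sets (config_borel (range grid_enum))"
      and m1: "\<And>lam. is_partition lam \<Longrightarrow> ?m M1 lam = (if lam = empty_partition then 1 else 0)"
      using iff[of M1] by auto
    assume "prob_space M2 \<and> sets M2 = sets (config_borel (range grid_enum)) \<and>
      (\<forall>lam. is_partition lam \<longrightarrow>
       integrable M2 (Sym_eval (Phi_qR lam (complex_of_real q) s0 s1 s2 s3)) \<and>
       (LINT X|M2. Sym_eval (Phi_qR lam (complex_of_real q) s0 s1 s2 s3) X) = (if lam = empty_partition then 1 else 0))"
    then have M2: "prob_space M2" "sets M2 = sets (config_borel (range grid_enum))"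
      and m2: "\<And>lam. is_partition lam \<Longrightarrow> ?m M2 lam = (if lam = empty_partition then 1 else 0)"
      using iff[of M2] by auto
    show "M1 = M2" by (rule racah_measure_unique[OF M1 M2]) (simp only: m1 m2)
  qed
qed

end
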